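(* Let $R\subset\mathbb{R}^{14}$ be the set of all $(a_1,\dots,a_{14})$ satisfying $$0\le a_1\le\pi,\quad 0\le a_2\le\tfrac{\pi}{2},\quad 0\le a_3\le\tfrac{\pi}{2},\quad 0\le a_4\le 2\pi,\quad 0\le a_5\le\tfrac{\pi}{4},\quad 0\le a_6\le\pi,$$ $$0\le a_7\le\tfrac{\pi}{6},\quad 3a_7\le a_8\le\tfrac{\pi}{2},$$ $$0\le a_9\le 2\pi,\quad 0\le a_{10}\le\tfrac{\pi}{2},\quad 0\le a_{11}\le\pi,\quad 0\le a_{12}\le\pi,\quad 0\le a_{13}\le\tfrac{\pi}{2},\quad 0\le a_{14}\le\pi.$$ Consider the map $g:R\to G_2$, $$g(a_1,\dots,a_{14})=\sigma(a_1,a_2,a_3)\,s(a_4,a_5,a_6)\,e^{\sqrt3\,a_7C_{11}}\,e^{a_8C_5}\,s(a_9,a_{10},a_{11})\,\sigma(a_{12},a_{13},a_{14}).$$ Then $g$ covers the whole group $G_2$, i.e. $g(R)=G_2$, and it does so exactly once up to sets of measure zero: there is a Lebesgue-null set $N\subset R$ such that $g|_{R\setminus N}$ is injective and $g(R\setminus N)$ has full Haar measure in $G_2$.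
   Context: The octonions $\mathbb{O}$ are pairs of quaternions with product $(\alpha_1,\alpha_2)(\beta_1,\beta_2)=(\alpha_1\beta_1-\bar\beta_2\alpha_2,\ \beta_2\alpha_1+\alpha_2\bar\beta_1)$. The canonical basis is $e_0=(1,0)$, $e_1=(i,0)$, $e_2=(j,0)$, $e_3=(k,0)$, $e_4=(0,1)$, $e_5=(0,i)$, $e_6=(0,j)$, $e_7=(0,k)$. $G_2$ is the group of algebra automorphisms of $\mathbb{O}$; it fixes $e_0$ and is identified with a group of $7\times7$ real matrices acting on column vectors of coordinates with respect to $e_1,\dots,e_7$. Let $E_{ij}$ be the $7\times 7$ matrix units and $A_{ij}=E_{ij}-E_{ji}$. The following are elements of $\mathrm{Lie}(G_2)$: $$C_2=A_{46}-A_{57},\qquad C_3=-A_{45}-A_{67},\qquad C_5=-A_{26}+A_{37},$$ $$C_8=\tfrac1{\sqrt3}(-2A_{23}+A_{45}-A_{67}),\qquad C_9=\tfrac1{\sqrt3}(-2A_{12}+A_{47}-A_{56}),\qquad C_{11}=\tfrac1{\sqrt3}(-2A_{14}-A_{27}+A_{36}).$$ Define $$s(x,y,z)=e^{xC_3}e^{yC_2}e^{zC_3},\qquad \sigma(x,y,z)=e^{\sqrt3\,xC_8}e^{\sqrt3\,yC_9}e^{\sqrt3\,zC_8}.$$ *)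

theory Defs
  imports "HOL-Analysis.Analysis"
begin

section \<open>Quaternions and octonions\<close>

text \<open>A quaternion \<open>a + b i + c j + d k\<close> is the vector \<open>(a, b, c, d)\<close>.\<close>

type_synonym quat = "real ^ 4"

definition qmult :: "quat \<Rightarrow> quat \<Rightarrow> quat" where
  "qmult p q = vector
    [p$1 * q$1 - p$2 * q$2 - p$3 * q$3 - p$4 * q$4,
     p$1 * q$2 + p$2 * q$1 + p$3 * q$4 - p$4 * q$3,
     p$1 * q$3 - p$2 * q$4 + p$3 * q$1 + p$4 * q$2,
     p$1 * q$4 + p$2 * q$3 - p$3 * q$2 + p$4 * q$1]"

definition qconj :: "quat \<Rightarrow> quat" where
  "qconj p = vector [p$1, - p$2, - p$3, - p$4]"

definition quat_1 :: quat where "quat_1 = axis 1 1"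
definition quat_i :: quat where "quat_i = axis 2 1"
definition quat_j :: quat where "quat_j = axis 3 1"
definition quat_k :: quat where "quat_k = axis 4 1"

type_synonym octonion = "quat \<times> quat"

definition omult :: "octonion \<Rightarrow> octonion \<Rightarrow> octonion" where
  "omult x y =
    (qmult (fst x) (fst y) - qmult (qconj (snd y)) (snd x),
     qmult (snd y) (fst x) + qmult (snd x) (qconj (fst y)))"

definition oct_basis :: "nat \<Rightarrow> octonion" where
  "oct_basis n =
    [(quat_1, 0), (quat_i, 0), (quat_j, 0), (quat_k, 0),
     (0, quat_1), (0, quat_i), (0, quat_j), (0, quat_k)] ! n"

section \<open>The group \<open>G\<^sub>2\<close>\<close>

definition octonion_automorphism :: "(octonion \<Rightarrow> octonion) \<Rightarrow> bool" where
  "octonion_automorphism f \<longleftrightarrow>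
     linear f \<and> bij f \<and> (\<forall>x y. f (omult x y) = omult (f x) (f y))"

text \<open>Indices of \<open>real ^ 7\<close> live in the numeral type \<open>7\<close>, in which the numerals
  \<open>1, \<dots>, 7\<close> are pairwise distinct (and \<open>7 = 0\<close>); likewise for \<open>real ^ 4\<close> and \<open>real ^ 14\<close>.\<close>

definition im_octonion :: "real ^ 7 \<Rightarrow> octonion" where
  "im_octonion v = (\<Sum>n = 1..7. (v $ of_nat n) *\<^sub>R oct_basis n)"

text \<open>An automorphism fixes \<open>e\<^sub>0\<close>, so it is determined by its matrix with respect to
  \<open>e\<^sub>1, \<dots>, e\<^sub>7\<close>.\<close>

definition G2 :: "(real ^ 7 ^ 7) set" where
  "G2 = {M. \<exists>f. octonion_automorphism f \<and>
              (\<forall>v. f (im_octonion v) = im_octonion (M *v v))}"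

section \<open>Matrix exponential\<close>

text \<open>The library's \<open>exp\<close> is not available for \<open>real ^ 'n ^ 'n\<close>, whose
  matrix product \<open>**\<close> is not the multiplication of a type class instance.\<close>

definition matrix_power :: "real ^ 'n ^ 'n \<Rightarrow> nat \<Rightarrow> real ^ 'n ^ 'n" where
  "matrix_power A n = (((**) A) ^^ n) (mat 1)"

definition mexp :: "real ^ 'n ^ 'n \<Rightarrow> real ^ 'n ^ 'n" where
  "mexp A = (\<Sum>n. (1 / fact n) *\<^sub>R matrix_power A n)"

section \<open>The Euler-angle map\<close>

definition matrix_unit :: "7 \<Rightarrow> 7 \<Rightarrow> real ^ 7 ^ 7" where
  "matrix_unit i j = (\<chi> r c. if r = i \<and> c = j then 1 else 0)"

definition skew_unit :: "7 \<Rightarrow> 7 \<Rightarrow> real ^ 7 ^ 7" where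
  "skew_unit i j = matrix_unit i j - matrix_unit j i"

definition C2 :: "real ^ 7 ^ 7" where
  "C2 = skew_unit 4 6 - skew_unit 5 7"

definition C3 :: "real ^ 7 ^ 7" where
  "C3 = - skew_unit 4 5 - skew_unit 6 7"

definition C5 :: "real ^ 7 ^ 7" where
  "C5 = - skew_unit 2 6 + skew_unit 3 7"

definition C8 :: "real ^ 7 ^ 7" where
  "C8 = (1 / sqrt 3) *\<^sub>R (- 2 *\<^sub>R skew_unit 2 3 + skew_unit 4 5 - skew_unit 6 7)"

definition C9 :: "real ^ 7 ^ 7" where
  "C9 = (1 / sqrt 3) *\<^sub>R (- 2 *\<^sub>R skew_unit 1 2 + skew_unit 4 7 - skew_unit 5 6)"

definition C11 :: "real ^ 7 ^ 7" where
  "C11 = (1 / sqrt 3) *\<^sub>R (- 2 *\<^sub>R skew_unit 1 4 - skew_unit 2 7 + skew_unit 3 6)"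

definition euler_s :: "real \<Rightarrow> real \<Rightarrow> real \<Rightarrow> real ^ 7 ^ 7" where
  "euler_s x y z = mexp (x *\<^sub>R C3) ** mexp (y *\<^sub>R C2) ** mexp (z *\<^sub>R C3)"

definition euler_sigma :: "real \<Rightarrow> real \<Rightarrow> real \<Rightarrow> real ^ 7 ^ 7" where
  "euler_sigma x y z =
     mexp ((sqrt 3 * x) *\<^sub>R C8) ** mexp ((sqrt 3 * y) *\<^sub>R C9) ** mexp ((sqrt 3 * z) *\<^sub>R C8)"

definition euler_region :: "(real ^ 14) set" where
  "euler_region = {a.
     0 \<le> a$1 \<and> a$1 \<le> pi \<and>
     0 \<le> a$2 \<and> a$2 \<le> pi / 2 \<and>
     0 \<le> a$3 \<and> a$3 \<le> pi / 2 \<and>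
     0 \<le> a$4 \<and> a$4 \<le> 2 * pi \<and>
     0 \<le> a$5 \<and> a$5 \<le> pi / 4 \<and>
     0 \<le> a$6 \<and> a$6 \<le> pi \<and>
     0 \<le> a$7 \<and> a$7 \<le> pi / 6 \<and>
     3 * a$7 \<le> a$8 \<and> a$8 \<le> pi / 2 \<and>
     0 \<le> a$9 \<and> a$9 \<le> 2 * pi \<and>
     0 \<le> a$10 \<and> a$10 \<le> pi / 2 \<and>
     0 \<le> a$11 \<and> a$11 \<le> pi \<and>
     0 \<le> a$12 \<and> a$12 \<le> pi \<and>
     0 \<le> a$13 \<and> a$13 \<le> pi / 2 \<and>
     0 \<le> a$14 \<and> a$14 \<le> pi}"

definition euler_map :: "real ^ 14 \<Rightarrow> real ^ 7 ^ 7" where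
  "euler_map a =
     euler_sigma (a$1) (a$2) (a$3) ** euler_s (a$4) (a$5) (a$6)
     ** mexp ((sqrt 3 * a$7) *\<^sub>R C11) ** mexp (a$8 *\<^sub>R C5)
     ** euler_s (a$9) (a$10) (a$11) ** euler_sigma (a$12) (a$13) (a$14)"

section \<open>Haar measure of a compact matrix group\<close>

text \<open>Finite nonzero left-invariant Borel measures; on a compact matrix group such measures
  are automatically regular and unique up to a positive factor.\<close>

definition haar_measure_on :: "(real ^ 'n ^ 'n) set \<Rightarrow> (real ^ 'n ^ 'n) measure \<Rightarrow> bool" where
  "haar_measure_on G \<mu> \<longleftrightarrow>
     sets \<mu> = sets (restrict_space borel G) \<and>
     finite_measure \<mu> \<and> emeasure \<mu> G \<noteq> 0 \<and>
     (\<forall>h\<in>G. \<forall>A\<in>sets \<mu>. emeasure \<mu> ((\<lambda>M. h ** M) ` A) = emeasure \<mu> A)"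

end

theory Submission
  imports Defs
begin

text \<open>The automorphisms preserving the quaternion subalgebra are
  \<open>(\<alpha>, \<beta>) \<mapsto> (q \<alpha> q\<inverse>, p \<beta> q\<inverse>)\<close> for unit quaternions \<open>q, p\<close>; they form \<open>K = SO(4)\<close>, in which
  \<open>\<sigma>\<close> and \<open>s\<close> are Euler angles of \<open>q\<close> and of \<open>p\<close>. The factors of \<open>C\<^sub>1\<^sub>1\<close> and \<open>C\<^sub>5\<close> are a maximal torus
  \<open>A\<close> transverse to \<open>K\<close>, which in a rotated basis consists of rotations by \<open>u, v, u + v\<close> in three planes.

  Surjectivity is the Cartan decomposition \<open>G\<^sub>2 = K A K\<close>: maximising \<open>2 B\<^sub>1\<^sub>1 + B\<^sub>2\<^sub>2\<close> over \<open>K M K\<close>, where \<open>B\<close>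
  is the \<open>3 \<times> 3\<close> block of imaginary quaternions, makes \<open>B\<close> diagonal with sorted singular values, and this
  already puts the torus parameters into the stated alcove. The centraliser of \<open>A\<close> in \<open>K\<close> is
  \<open>\<int>\<^sub>2 \<times> \<int>\<^sub>2\<close>, which is used up by the shorter ranges of \<open>a\<^sub>3\<close> and \<open>a\<^sub>5\<close>. Injectivity in the interior is
  uniqueness of singular values.

  For the measure statement it suffices that the image of the boundary, a compact Lebesgue-null set, is
  Haar-null. By invariance and Fubini the Haar measure of \<open>Z\<close> is an average of the
  Lebesgue measures of \<open>{t. \<phi>(t) x \<in> Z}\<close> for a chart \<open>\<phi>\<close> at the identity, and for the image \<open>Z\<close> of a null
  set under a smooth map these vanish because \<open>\<phi>\<close>, a product of one-parameter subgroups, is bi-Lipschitz.\<close>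

section \<open>Coordinates and finite index types\<close>

lemma vector_4:
  "(vector [a, b, c, d] :: 'a::zero ^ 4) $ 1 = a"
  "(vector [a, b, c, d] :: 'a::zero ^ 4) $ 2 = b"
  "(vector [a, b, c, d] :: 'a::zero ^ 4) $ 3 = c"
  "(vector [a, b, c, d] :: 'a::zero ^ 4) $ 4 = d"
  unfolding vector_def by simp_all

lemma UNIV_7: "(UNIV :: 7 set) = {1, 2, 3, 4, 5, 6, 7}"
proof -
  have "card {1, 2, 3, 4, 5, 6, 7 :: 7} = CARD(7)" by simp
  then show ?thesis by (metis card_subset_eq finite_class.finite_UNIV subset_UNIV)
qed

lemma forall_7: "(\<forall>i::7. P i) \<longleftrightarrow> P 1 \<and> P 2 \<and> P 3 \<and> P 4 \<and> P 5 \<and> P 6 \<and> P 7"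
proof -
  have "(\<forall>i::7. P i) \<longleftrightarrow> (\<forall>i\<in>{1, 2, 3, 4, 5, 6, 7}. P i)"
    by (metis UNIV_7 UNIV_I)
  then show ?thesis by auto
qed

section \<open>Quaternions\<close>

lemma quat_eq_iff:
  "p = (q :: quat) \<longleftrightarrow> p $ 1 = q $ 1 \<and> p $ 2 = q $ 2 \<and> p $ 3 = q $ 3 \<and> p $ 4 = q $ 4"
  by (simp add: vec_eq_iff forall_4)

lemma qmult_nth:
  "qmult p q $ 1 = p$1 * q$1 - p$2 * q$2 - p$3 * q$3 - p$4 * q$4"
  "qmult p q $ 2 = p$1 * q$2 + p$2 * q$1 + p$3 * q$4 - p$4 * q$3"
  "qmult p q $ 3 = p$1 * q$3 - p$2 * q$4 + p$3 * q$1 + p$4 * q$2"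
  "qmult p q $ 4 = p$1 * q$4 + p$2 * q$3 - p$3 * q$2 + p$4 * q$1"
  by (simp_all add: qmult_def vector_4)

lemma qconj_nth:
  "qconj p $ 1 = p $ 1" "qconj p $ 2 = - p $ 2" "qconj p $ 3 = - p $ 3" "qconj p $ 4 = - p $ 4"
  by (simp_all add: qconj_def vector_4)

lemma quat_unit_nth:
  "quat_1 $ 1 = 1" "quat_1 $ 2 = 0" "quat_1 $ 3 = 0" "quat_1 $ 4 = 0"
  "quat_i $ 1 = 0" "quat_i $ 2 = 1" "quat_i $ 3 = 0" "quat_i $ 4 = 0"
  "quat_j $ 1 = 0" "quat_j $ 2 = 0" "quat_j $ 3 = 1" "quat_j $ 4 = 0"
  "quat_k $ 1 = 0" "quat_k $ 2 = 0" "quat_k $ 3 = 0" "quat_k $ 4 = 1"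
  by (simp_all add: quat_1_def quat_i_def quat_j_def quat_k_def axis_def)

lemmas quat_nth = qmult_nth qconj_nth quat_unit_nth vector_4

lemma qmult_assoc: "qmult (qmult p q) r = qmult p (qmult q r)"
  by (simp add: quat_eq_iff qmult_nth algebra_simps)

lemma qmult_1 [simp]: "qmult quat_1 p = p" "qmult p quat_1 = p"
  by (simp_all add: quat_eq_iff quat_nth)

lemma qmult_0 [simp]: "qmult 0 p = 0" "qmult p 0 = 0"
  by (simp_all add: quat_eq_iff quat_nth)

lemma qmult_minus [simp]: "qmult (- p) q = - qmult p q" "qmult p (- q) = - qmult p q"
  by (simp_all add: quat_eq_iff quat_nth)

lemma qmult_scaleR [simp]:
  "qmult (c *\<^sub>R p) q = c *\<^sub>R qmult p q" "qmult p (c *\<^sub>R q) = c *\<^sub>R qmult p q"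
  by (simp_all add: quat_eq_iff quat_nth algebra_simps)

lemma qmult_add:
  "qmult (p + q) r = qmult p r + qmult q r" "qmult r (p + q) = qmult r p + qmult r q"
  by (simp_all add: quat_eq_iff quat_nth algebra_simps)

lemma qmult_diff:
  "qmult (p - q) r = qmult p r - qmult q r" "qmult r (p - q) = qmult r p - qmult r q"
  by (simp_all add: quat_eq_iff quat_nth algebra_simps)

lemma qconj_qmult: "qconj (qmult p q) = qmult (qconj q) (qconj p)"
  by (simp add: quat_eq_iff quat_nth)

lemma qconj_simps [simp]:
  "qconj (qconj p) = p" "qconj quat_1 = quat_1" "qconj 0 = 0" "qconj (- p) = - qconj p"
  "qconj (c *\<^sub>R p) = c *\<^sub>R qconj p"
  by (simp_all add: quat_eq_iff quat_nth)

definition qunit :: "quat \<Rightarrow> bool" where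
  "qunit q \<longleftrightarrow> (q$1)\<^sup>2 + (q$2)\<^sup>2 + (q$3)\<^sup>2 + (q$4)\<^sup>2 = 1"

lemma qunit_iff_norm: "qunit q \<longleftrightarrow> norm q = 1"
  by (simp add: qunit_def norm_vec_def L2_set_def sum_4)

lemma qmult_qconj: "qmult q (qconj q) = (norm q)\<^sup>2 *\<^sub>R quat_1" "qmult (qconj q) q = (norm q)\<^sup>2 *\<^sub>R quat_1"
  by (simp_all add: quat_eq_iff quat_nth norm_vec_def L2_set_def sum_4 sum_nonneg power2_eq_square)

lemma norm_qconj [simp]: "norm (qconj q) = norm q"
  by (simp add: norm_vec_def L2_set_def sum_4 quat_nth)

text \<open>After squaring, this is Euler's four-square identity.\<close>

lemma norm_qmult: "norm (qmult p q) = norm p * norm q"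
proof -
  have "(norm (qmult p q))\<^sup>2 = (norm p * norm q)\<^sup>2"
    by (simp add: power_mult_distrib norm_vec_def L2_set_def sum_4 quat_nth) algebra
  then show ?thesis by (simp add: power2_eq_iff_nonneg)
qed

lemma qunit_simps [simp]:
  "qunit (qconj q) = qunit q" "qunit (- q) = qunit q" "qunit quat_1"
  "qunit quat_i" "qunit quat_j" "qunit quat_k"
  by (simp_all add: qunit_def quat_nth)

lemma qunit_qmult: "qunit p \<Longrightarrow> qunit q \<Longrightarrow> qunit (qmult p q)"
  by (simp add: qunit_iff_norm norm_qmult)

lemma qunit_cancel:
  assumes "qunit q"
  shows "qmult q (qconj q) = quat_1" "qmult (qconj q) q = quat_1"
    "qmult q (qmult (qconj q) r) = r" "qmult (qconj q) (qmult q r) = r"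
proof -
  show *: "qmult q (qconj q) = quat_1" "qmult (qconj q) q = quat_1"
    using assms by (simp_all add: qmult_qconj qunit_iff_norm)
  show "qmult q (qmult (qconj q) r) = r" "qmult (qconj q) (qmult q r) = r"
    by (simp_all flip: qmult_assoc add: *)
qed

section \<open>Two families of octonion automorphisms\<close>

text \<open>For unit \<open>q\<close> and \<open>p\<close> these are the elements of
  \<open>K\<close>. A pair and its negative give the same map; this sign is what halves the range of
  the first angle of \<open>euler_sigma\<close>.\<close>

definition kmap :: "quat \<Rightarrow> quat \<Rightarrow> octonion \<Rightarrow> octonion" where
  "kmap q p x = (qmult (qmult q (fst x)) (qconj q), qmult (qmult p (snd x)) (qconj q))"

lemma kmap_comp: "kmap q p (kmap q' p' x) = kmap (qmult q q') (qmult p p') x"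
  by (simp add: kmap_def qconj_qmult qmult_assoc)

lemma kmap_1 [simp]: "kmap quat_1 quat_1 = id"
  by (auto simp: kmap_def)

lemma kmap_uminus [simp]: "kmap (- q) (- p) = kmap q p"
  by (auto simp: kmap_def)

lemma kmap_inverse:
  assumes "qunit q" "qunit p"
  shows "kmap q p (kmap (qconj q) (qconj p) x) = x" "kmap (qconj q) (qconj p) (kmap q p x) = x"
  using assms by (simp_all add: kmap_comp qunit_cancel)

lemma linear_kmap: "linear (kmap q p)"
  by (rule linearI) (simp_all add: kmap_def qmult_add)

lemma octonion_automorphism_kmap:
  assumes "qunit q" "qunit p"
  shows "octonion_automorphism (kmap q p)"
  unfolding octonion_automorphism_def
proof (intro conjI allI linear_kmap)
  show "bij (kmap q p)"
    by (rule o_bij[of "kmap (qconj q) (qconj p)"]) (auto simp: kmap_inverse assms)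
  show "kmap q p (omult x y) = omult (kmap q p x) (kmap q p y)" for x y
    by (simp add: kmap_def omult_def qmult_assoc qconj_qmult qmult_add qmult_diff qunit_cancel assms)
qed

text \<open>The planes are those of \<open>e_1, e_4\<close>, of \<open>e_2, e_7\<close> and of
  \<open>e_3, e_6\<close>, while \<open>e_5\<close> is fixed. The third angle is forced by
  \<open>k = i j\<close>, since products must be preserved.\<close>

definition tmap :: "real \<Rightarrow> real \<Rightarrow> octonion \<Rightarrow> octonion" where
  "tmap u v x = (let a = fst x; b = snd x; w = u + v in
     (vector [a$1, cos u * a$2 - sin u * b$1, cos v * a$3 + sin v * b$4, cos w * a$4 + sin w * b$3],
      vector [cos u * b$1 + sin u * a$2, b$2, cos w * b$3 - sin w * a$4, cos v * b$4 - sin v * a$3]))"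

lemma tmap_nth:
  "fst (tmap u v x) $ 1 = fst x $ 1"
  "fst (tmap u v x) $ 2 = cos u * fst x $ 2 - sin u * snd x $ 1"
  "fst (tmap u v x) $ 3 = cos v * fst x $ 3 + sin v * snd x $ 4"
  "fst (tmap u v x) $ 4 = cos (u + v) * fst x $ 4 + sin (u + v) * snd x $ 3"
  "snd (tmap u v x) $ 1 = cos u * snd x $ 1 + sin u * fst x $ 2"
  "snd (tmap u v x) $ 2 = snd x $ 2"
  "snd (tmap u v x) $ 3 = cos (u + v) * snd x $ 3 - sin (u + v) * fst x $ 4"
  "snd (tmap u v x) $ 4 = cos v * snd x $ 4 - sin v * fst x $ 3"
  by (simp_all add: tmap_def Let_def vector_4)

lemma tmap_add: "tmap u v (tmap u' v' x) = tmap (u + u') (v + v') x"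
proof -
  have *: "u + u' + (v + v') = (u + v) + (u' + v')" by simp
  show ?thesis
    unfolding prod_eq_iff quat_eq_iff tmap_nth *
    by (simp add: cos_add sin_add algebra_simps)
qed

lemma tmap_0 [simp]: "tmap 0 0 = id"
  by (auto simp: fun_eq_iff prod_eq_iff quat_eq_iff tmap_nth)

lemma linear_tmap: "linear (tmap u v)"
  by (rule linearI) (simp_all add: prod_eq_iff quat_eq_iff tmap_nth algebra_simps)

text \<open>With one angle at a time only one pair \<open>c\<close>, \<open>s\<close> occurs, so
  multiplicativity is a polynomial identity modulo \<open>s * s = 1 - c * c\<close>. The general
  torus element is a composition of the two cases.\<close>

lemma tmap_omult_aux:
  "tmap u 0 (omult x y) = omult (tmap u 0 x) (tmap u 0 y)"
  "tmap 0 u (omult x y) = omult (tmap 0 u x) (tmap 0 u y)"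
proof -
  define c s where "c = cos u" "s = sin u"
  have "s * s = 1 - c * c"
    using sin_cos_squared_add[of u] by (simp add: c_s_def power2_eq_square)
  then have 1: "s * s = 1 - c * c" "s * (s * z) = z - c * (c * z)" for z
    by (simp_all flip: mult.assoc add: left_diff_distrib)
  show "tmap u 0 (omult x y) = omult (tmap u 0 x) (tmap u 0 y)"
    unfolding prod_eq_iff quat_eq_iff tmap_nth omult_def fst_conv snd_conv vector_add_component
       vector_minus_component quat_nth c_s_def[symmetric] add_0_left add_0_right cos_zero sin_zero mult_1_left mult_zero_left
    by (simp add: algebra_simps 1)
  show "tmap 0 u (omult x y) = omult (tmap 0 u x) (tmap 0 u y)"
    unfolding prod_eq_iff quat_eq_iff tmap_nth omult_def fst_conv snd_conv vector_add_component
       vector_minus_component quat_nth c_s_def[symmetric] add_0_left add_0_right cos_zero sin_zero mult_1_left mult_zero_left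
    by (simp add: algebra_simps 1)
qed

lemma tmap_omult: "tmap u v (omult x y) = omult (tmap u v x) (tmap u v y)"
  using tmap_add[of u 0 0 v] by (simp add: tmap_omult_aux flip: tmap_add[of u 0 0 v, simplified])

lemma octonion_automorphism_tmap: "octonion_automorphism (tmap u v)"
  unfolding octonion_automorphism_def
proof (intro conjI allI linear_tmap tmap_omult)
  show "bij (tmap u v)"
    by (rule o_bij[of "tmap (- u) (- v)"]) (auto simp: tmap_add)
qed

section \<open>Matrices of automorphisms\<close>

lemma im_octonion_eq:
  "im_octonion v = (vector [0, v$1, v$2, v$3], vector [v$4, v$5, v$6, v$7])"
proof -
  have *: "{1..7::nat} = {1, 2, 3, 4, 5, 6, 7}" by auto
  show ?thesis
    unfolding im_octonion_def oct_basis_def *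
    by (simp add: prod_eq_iff quat_eq_iff quat_nth)
qed

lemma im_octonion_nth:
  "fst (im_octonion v) $ 1 = 0" "fst (im_octonion v) $ 2 = v$1" "fst (im_octonion v) $ 3 = v$2"
  "fst (im_octonion v) $ 4 = v$3" "snd (im_octonion v) $ 1 = v$4" "snd (im_octonion v) $ 2 = v$5"
  "snd (im_octonion v) $ 3 = v$6" "snd (im_octonion v) $ 4 = v$7"
  by (simp_all add: im_octonion_eq quat_nth)

lemma im_octonion_inject: "im_octonion v = im_octonion w \<longleftrightarrow> v = w"
  by (auto simp: prod_eq_iff quat_eq_iff im_octonion_nth vec_eq_iff forall_7)

text \<open>Turns products of matrices into compositions of octonion maps, so that all later
  identities in the group can be checked with quaternions.\<close>

definition represents :: "real ^ 7 ^ 7 \<Rightarrow> (octonion \<Rightarrow> octonion) \<Rightarrow> bool" where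
  "represents M f \<longleftrightarrow> (\<forall>v. f (im_octonion v) = im_octonion (M *v v))"

lemma G2_iff: "M \<in> G2 \<longleftrightarrow> (\<exists>f. octonion_automorphism f \<and> represents M f)"
  by (simp add: G2_def represents_def)

lemma represents_mult:
  "represents M f \<Longrightarrow> represents N g \<Longrightarrow> represents (M ** N) (f \<circ> g)"
  by (simp add: represents_def flip: matrix_vector_mul_assoc)

lemma represents_unique: "represents M f \<Longrightarrow> represents N f \<Longrightarrow> M = N"
  by (simp add: represents_def matrix_eq im_octonion_inject)

lemma represents_id: "represents (mat 1) id"
  by (simp add: represents_def)

lemma octonion_automorphism_comp:
  "octonion_automorphism f \<Longrightarrow> octonion_automorphism g \<Longrightarrow> octonion_automorphism (f \<circ> g)"
  by (simp add: octonion_automorphism_def bij_comp linear_compose del: split_paired_All)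

lemma octonion_automorphism_id: "octonion_automorphism id"
  by (simp add: octonion_automorphism_def linear_id)

lemma G2_mult: "M \<in> G2 \<Longrightarrow> N \<in> G2 \<Longrightarrow> M ** N \<in> G2"
  using represents_mult octonion_automorphism_comp unfolding G2_iff by blast

lemma G2_1: "mat 1 \<in> G2"
  using represents_id octonion_automorphism_id unfolding G2_iff by blast

lemma G2_inverse:
  assumes "M \<in> G2"
  obtains N where "N \<in> G2" "N ** M = mat 1" "M ** N = mat 1"
proof -
  obtain f where f: "octonion_automorphism f" "represents M f"
    using assms by (auto simp: G2_iff)
  then have f': "linear f" "bij f" and mult: "\<And>x y. f (omult x y) = omult (f x) (f y)"
    by (auto simp: octonion_automorphism_def)
  have "v = w" if "M *v v = M *v w" for v w
  proof -
    have "f (im_octonion v) = f (im_octonion w)"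
      using f(2) that by (simp add: represents_def)
    then show ?thesis
      using \<open>bij f\<close> by (simp add: bij_is_inj inj_eq im_octonion_inject)
  qed
  then obtain N where N: "N ** M = mat 1"
    using matrix_left_invertible_injective[of M] by (auto simp: inj_def)
  then have N': "M ** N = mat 1"
    by (simp add: matrix_left_right_inverse)
  have "octonion_automorphism (inv f)"
    unfolding octonion_automorphism_def
  proof (intro conjI allI)
    show "linear (inv f)"
      using f' by (simp add: bij_is_inj bij_is_surj inj_linear_imp_inv_linear)
    show "bij (inv f)"
      using f' by (simp add: bij_imp_bij_inv)
    show "inv f (omult x y) = omult (inv f x) (inv f y)" for x y
      using f'(2) by (metis mult bij_inv_eq_iff)
  qed
  moreover have "represents N (inv f)"
    unfolding represents_def
  proof
    fix v
    have "f (im_octonion (N *v v)) = im_octonion v"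
      using f(2) N' by (simp add: represents_def matrix_vector_mul_assoc)
    then show "inv f (im_octonion v) = im_octonion (N *v v)"
      by (metis bij_is_inj f'(2) inv_f_f)
  qed
  ultimately show ?thesis
    using N N' that by (auto simp: G2_iff)
qed

section \<open>Products of coordinate plane rotations\<close>

text \<open>For \<open>a \<noteq> b\<close> this is the exponential of \<open>t\<close> times
  \<open>skew_unit b a\<close>. Being affine in \<open>cos t\<close> and \<open>sin t\<close>, it
  can be differentiated directly.\<close>

definition prot :: "7 \<Rightarrow> 7 \<Rightarrow> real \<Rightarrow> real ^ 7 ^ 7" where
  "prot a b t = mat 1 + (cos t - 1) *\<^sub>R (matrix_unit a a + matrix_unit b b) + sin t *\<^sub>R skew_unit b a"

lemma matrix_unit_mult_vec: "matrix_unit a b *v v = axis a (v $ b)"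
proof -
  have "(\<Sum>j\<in>UNIV. matrix_unit a b $ i $ j * v $ j) = axis a (v $ b) $ i" for i
  proof -
    have "(\<Sum>j\<in>UNIV. matrix_unit a b $ i $ j * v $ j) = (\<Sum>j\<in>UNIV. if j = b then (if i = a then v $ j else 0) else 0)"
      by (rule sum.cong) (auto simp: matrix_unit_def)
    also have "\<dots> = axis a (v $ b) $ i"
      by (simp add: axis_def)
    finally show ?thesis .
  qed
  then show ?thesis
    by (simp add: vec_eq_iff matrix_vector_mult_def)
qed

lemma skew_unit_mult_vec: "skew_unit a b *v v = axis a (v $ b) - axis b (v $ a)"
  by (simp add: skew_unit_def matrix_vector_mult_diff_rdistrib matrix_unit_mult_vec)

lemma scaleR_matrix_vector: "(c *\<^sub>R M) *v v = c *\<^sub>R (M *v (v :: real ^ 'n))"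
  by (simp add: scaleR_matrix_vector_assoc)

lemma prot_mult_vec:
  assumes "a \<noteq> b"
  shows "(prot a b t *v v) $ i =
    (if i = a then cos t * v$a - sin t * v$b else if i = b then sin t * v$a + cos t * v$b else v $ i)"
  using assms
  by (simp add: prot_def matrix_vector_mult_add_rdistrib scaleR_matrix_vector
      matrix_unit_mult_vec skew_unit_mult_vec axis_def algebra_simps)

lemma prot_0 [simp]: "prot a b 0 = mat 1"
  by (simp add: prot_def)

lemma skew_unit_axis:
  "skew_unit a b *v axis i 1 = (if i = b then axis a 1 else 0) - (if i = a then axis b 1 else 0)"
  by (auto simp: skew_unit_mult_vec axis_def vec_eq_iff)

lemma prot_axis:
  assumes "a \<noteq> b"
  shows "prot a b t *v axis i 1 = (if i = a then cos t *\<^sub>R axis a 1 + sin t *\<^sub>R axis b 1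
     else if i = b then cos t *\<^sub>R axis b 1 - sin t *\<^sub>R axis a 1 else axis i 1)"
  unfolding vec_eq_iff prot_mult_vec[OF assms] using assms by (auto simp: axis_def)

section \<open>Matrix exponentials\<close>

lemma matrix_power_mult_vec: "matrix_power X n *v u = ((*v) X ^^ n) u"
  by (induction n) (simp_all add: matrix_power_def flip: matrix_vector_mul_assoc)

text \<open>Convergence of matrices is convergence of entries, so the exponential series can be
  summed on each basis vector separately.\<close>

lemma mexp_eqI:
  fixes X \<Phi> :: "real ^ 'n ^ 'n"
  assumes "\<And>i. (\<lambda>n. (1 / fact n) *\<^sub>R (matrix_power X n *v axis i 1)) sums (\<Phi> *v axis i 1)"
  shows "mexp X = \<Phi>"
proof -
  have col: "(M *v axis i 1) $ r = M $ r $ i" for M :: "real ^ 'n ^ 'n" and i r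
    by (simp add: matrix_vector_mul_component inner_axis)
  have "(\<lambda>n. (1 / fact n) *\<^sub>R matrix_power X n) sums \<Phi>"
    unfolding sums_def
  proof (rule vec_tendstoI, rule vec_tendstoI)
    fix r i
    have "(\<lambda>n. (\<Sum>m<n. (1 / fact m) *\<^sub>R (matrix_power X m *v axis i 1)) $ r) \<longlonglongrightarrow> (\<Phi> *v axis i 1) $ r"
      using assms[of i] unfolding sums_def by (rule tendsto_vec_nth)
    then show "(\<lambda>n. (\<Sum>m<n. (1 / fact m) *\<^sub>R matrix_power X m) $ r $ i) \<longlonglongrightarrow> \<Phi> $ r $ i"
      by (simp add: col sum_component)
  qed
  then show ?thesis
    unfolding mexp_def by (rule sums_unique[symmetric])
qed

text \<open>On the span of \<open>u\<close> and \<open>v\<close> the matrix acts as \<open>t\<close>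
  times a quarter turn, so its powers produce the Taylor coefficients of cosine and sine. Vectors in
  the kernel fit the pattern with \<open>t = 0\<close> and \<open>v = 0\<close>.\<close>

lemma matrix_power_rotation:
  fixes X :: "real ^ 'n ^ 'n"
  assumes "X *v u = t *\<^sub>R v" "X *v v = - t *\<^sub>R u"
  shows "(1 / fact n) *\<^sub>R (matrix_power X n *v u) = (cos_coeff n * t ^ n) *\<^sub>R u + (sin_coeff n * t ^ n) *\<^sub>R v"
proof (induction n)
  case 0
  then show ?case by (simp add: matrix_power_mult_vec)
next
  case (Suc n)
  have "(1 / fact (Suc n)) *\<^sub>R (matrix_power X (Suc n) *v u) =
     (1 / real (Suc n)) *\<^sub>R (X *v ((1 / fact n) *\<^sub>R (matrix_power X n *v u)))"
    by (simp add: matrix_power_mult_vec matrix_vector_mult_scaleR mult.commute)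
  also have "\<dots> = (cos_coeff (Suc n) * t ^ Suc n) *\<^sub>R u + (sin_coeff (Suc n) * t ^ Suc n) *\<^sub>R v"
    unfolding Suc
    by (simp add: matrix_vector_right_distrib matrix_vector_mult_scaleR assms cos_coeff_Suc sin_coeff_Suc
         scaleR_add_right scaleR_diff_right mult_ac del: of_nat_Suc)
  finally show ?case .
qed

lemma mexp_rotations:
  fixes X \<Phi> :: "real ^ 'n ^ 'n"
  assumes "\<And>i. \<exists>t v. X *v axis i 1 = t *\<^sub>R v \<and> X *v v = - t *\<^sub>R axis i 1 \<and>
                   \<Phi> *v axis i 1 = cos t *\<^sub>R axis i 1 + sin t *\<^sub>R v"
  shows "mexp X = \<Phi>"
proof (rule mexp_eqI)
  fix i
  obtain t v where *: "X *v axis i 1 = t *\<^sub>R v" "X *v v = - t *\<^sub>R axis i 1"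
      "\<Phi> *v axis i 1 = cos t *\<^sub>R axis i 1 + sin t *\<^sub>R v"
    using assms by blast
  have "(\<lambda>n. (cos_coeff n *\<^sub>R t ^ n) *\<^sub>R axis i 1 + (sin_coeff n *\<^sub>R t ^ n) *\<^sub>R v) sums
      (cos t *\<^sub>R axis i 1 + sin t *\<^sub>R v)"
    by (intro sums_add sums_scaleR_left cos_converges sin_converges)
  then show "(\<lambda>n. (1 / fact n) *\<^sub>R (matrix_power X n *v axis i 1)) sums (\<Phi> *v axis i 1)"
    by (simp add: matrix_power_rotation[OF *(1,2)] *(3))
qed

text \<open>Rotations in disjoint planes do not interact. For a generator with two planes the third
  slot is filled by any disjoint plane with angle 0.\<close>

lemma mexp_planes:
  assumes "distinct [a, b, c, d, e, f]"
  shows "mexp (r *\<^sub>R skew_unit b a + s *\<^sub>R skew_unit d c + t *\<^sub>R skew_unit f e) =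
     prot a b r ** prot c d s ** prot e f t"
proof (rule mexp_rotations)
  fix i :: 7
  let ?X = "r *\<^sub>R skew_unit b a + s *\<^sub>R skew_unit d c + t *\<^sub>R skew_unit f e"
  let ?P = "prot a b r ** prot c d s ** prot e f t"
  \<comment> \<open>\<open>w\<close> is the angle of the plane that contains the basis vector and
    \<open>v\<close> is the quarter turn of that vector; both are 0 outside the three
    planes.\<close>
  define w where "w = (if i \<in> {a, b} then r else if i \<in> {c, d} then s else if i \<in> {e, f} then t else 0)"
  define v :: "real ^ 7" where "v = (if i = a then axis b 1 else if i = b then - axis a 1 else if i = c then axis d 1
    else if i = d then - axis c 1 else if i = e then axis f 1 else if i = f then - axis e 1 else 0)"
  have dist: "a \<noteq> b" "c \<noteq> d" "e \<noteq> f" "a \<noteq> c" "a \<noteq> d" "a \<noteq> e" "a \<noteq> f" "b \<noteq> c" "b \<noteq> d" "b \<noteq> e" "b \<noteq> f"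
    "c \<noteq> e" "c \<noteq> f" "d \<noteq> e" "d \<noteq> f"
    using assms by auto
  note dist = dist dist[symmetric]
  note simps = matrix_vector_mult_add_rdistrib scaleR_matrix_vector skew_unit_axis prot_axis
     matrix_vector_right_distrib matrix_vector_mult_diff_distrib matrix_vector_mult_scaleR dist
  have neg: "M *v (- x) = - (M *v x)" for M :: "real ^ 7 ^ 7" and x
    using matrix_vector_mult_scaleR[of M "- 1" x] by simp
  consider "i = a" | "i = b" | "i = c" | "i = d" | "i = e" | "i = f" | "i \<notin> {a, b, c, d, e, f}"
    by auto
  then have "?X *v axis i 1 = w *\<^sub>R v \<and> ?X *v v = - w *\<^sub>R axis i 1 \<and>
        ?P *v axis i 1 = cos w *\<^sub>R axis i 1 + sin w *\<^sub>R v"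
    by cases (simp_all add: v_def w_def simps neg flip: matrix_vector_mul_assoc)
  then show "\<exists>w v. ?X *v axis i 1 = w *\<^sub>R v \<and> ?X *v v = - w *\<^sub>R axis i 1 \<and>
        ?P *v axis i 1 = cos w *\<^sub>R axis i 1 + sin w *\<^sub>R v"
    by blast
qed

lemma skew_unit_swap: "skew_unit a b = - skew_unit b a"
  by (simp add: skew_unit_def)

lemma mexp_C2: "mexp (t *\<^sub>R C2) = prot 6 4 t ** prot 5 7 t"
  using mexp_planes[of 6 4 5 7 1 2 t t 0]
  by (simp add: C2_def skew_unit_swap[of 5 7] algebra_simps)

lemma mexp_C3: "mexp (t *\<^sub>R C3) = prot 4 5 t ** prot 6 7 t"
  using mexp_planes[of 4 5 6 7 1 2 t t 0]
  by (simp add: C3_def skew_unit_swap[of 4 5] skew_unit_swap[of 6 7] algebra_simps)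

lemma mexp_C5: "mexp (t *\<^sub>R C5) = prot 2 6 t ** prot 7 3 t"
  using mexp_planes[of 2 6 7 3 1 4 t t 0]
  by (simp add: C5_def skew_unit_swap[of 2 6] algebra_simps)

lemma mexp_C8: "mexp ((sqrt 3 * t) *\<^sub>R C8) = prot 2 3 (2 * t) ** prot 5 4 t ** prot 6 7 t"
  using mexp_planes[of 2 3 5 4 6 7 "2 * t" t t]
  by (simp add: C8_def skew_unit_swap[of 2 3] skew_unit_swap[of 6 7] algebra_simps)

lemma mexp_C9: "mexp ((sqrt 3 * t) *\<^sub>R C9) = prot 1 2 (2 * t) ** prot 7 4 t ** prot 5 6 t"
  using mexp_planes[of 1 2 7 4 5 6 "2 * t" t t]
  by (simp add: C9_def skew_unit_swap[of 1 2] skew_unit_swap[of 5 6] algebra_simps)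

lemma mexp_C11: "mexp ((sqrt 3 * t) *\<^sub>R C11) = prot 1 4 (2 * t) ** prot 2 7 t ** prot 6 3 t"
  using mexp_planes[of 1 4 2 7 6 3 "2 * t" t t]
  by (simp add: C11_def skew_unit_swap[of 1 4] skew_unit_swap[of 2 7] algebra_simps)

text \<open>Rewrite rules that eliminate squares of sines. The second form applies to right-nested
  products, which arise when products are normalised.\<close>

lemma sqr_sin: "sin t * sin t = 1 - cos t * cos (t::real)" "sin t * (sin t * z) = z - cos t * (cos t * z)"
proof -
  show "sin t * sin t = 1 - cos t * cos t"
    using sin_cos_squared_add[of t] by (simp add: power2_eq_square)
  then show "sin t * (sin t * z) = z - cos t * (cos t * z)"
    by (simp flip: mult.assoc add: left_diff_distrib)
qed

lemma cos_sin_double: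
  "cos (2 * t) = 2 * (cos t * cos t) - (1::real)" "cos (t * 2) = 2 * (cos t * cos t) - 1"
  "sin (2 * t) = 2 * (sin t * cos t)" "sin (t * 2) = 2 * (sin t * cos t)"
  using cos_double_cos[of t] sin_double[of t] by (simp_all add: power2_eq_square mult.commute)

section \<open>One-parameter subgroups in quaternion form\<close>

definition qi :: "real \<Rightarrow> quat" where "qi t = vector [cos t, sin t, 0, 0]"
definition qj :: "real \<Rightarrow> quat" where "qj t = vector [cos t, 0, sin t, 0]"
definition qk :: "real \<Rightarrow> quat" where "qk t = vector [cos t, 0, 0, sin t]"

lemma qijk_nth:
  "qi t $ 1 = cos t" "qi t $ 2 = sin t" "qi t $ 3 = 0" "qi t $ 4 = 0"
  "qj t $ 1 = cos t" "qj t $ 2 = 0" "qj t $ 3 = sin t" "qj t $ 4 = 0"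
  "qk t $ 1 = cos t" "qk t $ 2 = 0" "qk t $ 3 = 0" "qk t $ 4 = sin t"
  by (simp_all add: qi_def qj_def qk_def vector_4)

lemma qunit_qijk [simp]: "qunit (qi t)" "qunit (qj t)" "qunit (qk t)"
  by (simp_all add: qunit_def qijk_nth)

lemma qconj_qijk [simp]: "qconj (qi t) = qi (- t)" "qconj (qj t) = qj (- t)" "qconj (qk t) = qk (- t)"
  by (simp_all add: quat_eq_iff quat_nth qijk_nth)

lemma kmap_nth:
  "fst (kmap q p x) = qmult (qmult q (fst x)) (qconj q)"
  "snd (kmap q p x) = qmult (qmult p (snd x)) (qconj q)"
  by (simp_all add: kmap_def)

lemmas represents_simps = prod_eq_iff quat_eq_iff tmap_nth kmap_nth quat_nth qijk_nth
  im_octonion_nth prot_mult_vec cos_sin_double algebra_simps sqr_sin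

text \<open>Conjugation by \<open>q\<close> doubles the angle on imaginary quaternions, whence the
  factor 2. Four cases are the exponentials of \<open>C8\<close>, \<open>C9\<close>,
  \<open>C3\<close> and \<open>C2\<close>; the other two complete a set of directions for
  \<open>K\<close>.\<close>

lemma represents_kmap:
  "represents (prot 2 3 (2 * t) ** prot 5 4 t ** prot 6 7 t) (kmap (qi t) quat_1)"
  "represents (prot 3 1 (2 * t) ** prot 6 4 t ** prot 7 5 t) (kmap (qj t) quat_1)"
  "represents (prot 1 2 (2 * t) ** prot 7 4 t ** prot 5 6 t) (kmap (qk t) quat_1)"
  "represents (prot 4 5 t ** prot 6 7 t) (kmap quat_1 (qi t))"
  "represents (prot 6 4 t ** prot 5 7 t) (kmap quat_1 (qj (- t)))"
  "represents (prot 4 7 t ** prot 5 6 t) (kmap quat_1 (qk t))"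
  unfolding represents_def by (simp_all add: represents_simps flip: matrix_vector_mul_assoc)

text \<open>Conjugating the two torus directions by \<open>1, i, j, k\<close> yields the eight
  directions of the group that are transverse to \<open>K\<close>.\<close>

definition tconj :: "quat \<Rightarrow> real \<Rightarrow> real \<Rightarrow> octonion \<Rightarrow> octonion" where
  "tconj w u v = kmap quat_1 w \<circ> tmap u v \<circ> kmap quat_1 (qconj w)"

lemma represents_tconj:
  "represents (prot 1 4 t ** prot 6 3 t) (tconj quat_1 t 0)"
  "represents (prot 1 5 t ** prot 7 3 t) (tconj quat_i t 0)"
  "represents (prot 1 6 t ** prot 3 4 t) (tconj quat_j t 0)"
  "represents (prot 1 7 t ** prot 3 5 t) (tconj quat_k t 0)"
  "represents (prot 7 2 t ** prot 6 3 t) (tconj quat_1 0 t)"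
  "represents (prot 2 6 t ** prot 7 3 t) (tconj quat_i 0 t)"
  "represents (prot 5 2 t ** prot 3 4 t) (tconj quat_j 0 t)"
  "represents (prot 2 4 t ** prot 3 5 t) (tconj quat_k 0 t)"
  unfolding represents_def tconj_def by (simp_all add: represents_simps flip: matrix_vector_mul_assoc)

text \<open>\<open>C11\<close> and \<open>C5\<close> are not block diagonal in the standard basis. A
  rotation by \<open>pi / 4\<close> in the planes of \<open>e_2, e_3\<close> and of
  \<open>e_6, e_7\<close> makes them so, with angles \<open>2 x\<close>, \<open>y - x\<close> and
  \<open>x + y\<close>.\<close>

definition amap :: "real \<Rightarrow> real \<Rightarrow> octonion \<Rightarrow> octonion" where
  "amap x y = kmap (qi (pi / 8)) (qi (pi / 8)) \<circ> tmap (2 * x) (y - x) \<circ> kmap (qi (- pi / 8)) (qi (- pi / 8))"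

lemma kmap_qi_qi_nth:
  "fst (kmap (qi t) (qi t) x) $ 1 = fst x $ 1"
  "fst (kmap (qi t) (qi t) x) $ 2 = fst x $ 2"
  "fst (kmap (qi t) (qi t) x) $ 3 = cos (2 * t) * fst x $ 3 - sin (2 * t) * fst x $ 4"
  "fst (kmap (qi t) (qi t) x) $ 4 = cos (2 * t) * fst x $ 4 + sin (2 * t) * fst x $ 3"
  "snd (kmap (qi t) (qi t) x) $ 1 = snd x $ 1"
  "snd (kmap (qi t) (qi t) x) $ 2 = snd x $ 2"
  "snd (kmap (qi t) (qi t) x) $ 3 = cos (2 * t) * snd x $ 3 - sin (2 * t) * snd x $ 4"
  "snd (kmap (qi t) (qi t) x) $ 4 = cos (2 * t) * snd x $ 4 + sin (2 * t) * snd x $ 3"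
  by (simp_all add: kmap_nth quat_nth qijk_nth cos_sin_double algebra_simps sqr_sin)

lemma represents_amap:
  "represents (mexp ((sqrt 3 * x) *\<^sub>R C11) ** mexp (y *\<^sub>R C5)) (amap x y)"
proof -
  have s: "sqrt 2 * (sqrt 2 * z) = 2 * z" for z
    by (simp flip: mult.assoc)
  have a: "2 * x + (y - x) = x + y" by simp
  show ?thesis
    unfolding represents_def mexp_C11 mexp_C5 amap_def comp_def
    by (simp add: prod_eq_iff quat_eq_iff tmap_nth kmap_qi_qi_nth cos_45 sin_45 a
        im_octonion_nth prot_mult_vec cos_add sin_add cos_diff sin_diff
       flip: matrix_vector_mul_assoc) (simp add: field_simps s)
qed

section \<open>The Cartan decomposition\<close>

lemma omult_one: "omult (quat_1, 0) x = x" "omult x (quat_1, 0) = x"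
  by (simp_all add: omult_def)

text \<open>If \<open>f x = 1\<close>, then \<open>f 1 = f 1 * f x = f (1 * x) = 1\<close>.\<close>

lemma octonion_automorphism_one:
  assumes "octonion_automorphism f"
  shows "f (quat_1, 0) = (quat_1, 0)"
proof -
  obtain x where x: "f x = (quat_1, 0)"
    using assms by (metis octonion_automorphism_def bij_pointE)
  have "f (quat_1, 0) = omult (f (quat_1, 0)) (f x)"
    by (simp add: x omult_one)
  also have "\<dots> = f (omult (quat_1, 0) x)"
    using assms by (simp add: octonion_automorphism_def del: split_paired_All)
  finally show ?thesis
    by (simp add: omult_one x)
qed

lemma omult_units:
  "omult (quat_i, 0) (quat_i, 0) = (- quat_1, 0)"
  "omult (quat_j, 0) (quat_j, 0) = (- quat_1, 0)"
  "omult (quat_i, 0) (quat_j, 0) = (quat_k, 0)"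
  "omult (0, quat_1) (0, quat_1) = (- quat_1, 0)"
  "omult (0, quat_1) (quat_i, 0) = - omult (quat_i, 0) (0, quat_1)"
  "omult (0, quat_1) (quat_j, 0) = - omult (quat_j, 0) (0, quat_1)"
  "omult (0, quat_1) (quat_k, 0) = - omult (quat_k, 0) (0, quat_1)"
  "omult (0, quat_1) (qconj b, 0) = (0, b)"
  by (simp_all add: omult_def prod_eq_iff quat_eq_iff quat_nth)

lemma quat_decomp: "(a, 0) = a$1 *\<^sub>R (quat_1, 0) + a$2 *\<^sub>R (quat_i, 0) + a$3 *\<^sub>R (quat_j, 0) + a$4 *\<^sub>R (quat_k, 0 :: quat)"
  by (simp add: prod_eq_iff quat_eq_iff quat_nth)

text \<open>The image of \<open>(0, 1)\<close> anticommutes with \<open>i, j, k\<close>, which kills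
  its quaternion part, and squares to \<open>-1\<close>, which makes the other part a unit
  \<open>p\<close>. Since \<open>(0, b)\<close> is the product of \<open>(0, 1)\<close> and
  \<open>(qconj b, 0)\<close>, this determines \<open>f\<close>.\<close>

lemma automorphism_fixing_quaternions:
  assumes f: "octonion_automorphism f"
    and i: "f (quat_i, 0) = (quat_i, 0)" and j: "f (quat_j, 0) = (quat_j, 0)"
  obtains p where "qunit p" "f = kmap quat_1 p"
proof -
  have lin: "linear f" and mult: "\<And>x y. f (omult x y) = omult (f x) (f y)"
    using f by (auto simp: octonion_automorphism_def)
  have k: "f (quat_k, 0) = (quat_k, 0)"
    using mult[of "(quat_i, 0)" "(quat_j, 0)"] by (simp add: i j omult_units)
  have H: "f (a, 0) = (a, 0)" for a
    unfolding quat_decomp[of a]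
    by (simp only: linear_add[OF lin] linear_scale[OF lin] i j k octonion_automorphism_one[OF f])
  obtain x p where l: "f (0, quat_1) = (x, p)"
    by fastforce
  have "omult (x, p) (quat_i, 0) = - omult (quat_i, 0) (x, p)"
    "omult (x, p) (quat_j, 0) = - omult (quat_j, 0) (x, p)"
    "omult (x, p) (quat_k, 0) = - omult (quat_k, 0) (x, p)"
    using arg_cong[OF omult_units(5), of f] arg_cong[OF omult_units(6), of f]
      arg_cong[OF omult_units(7), of f]
    unfolding linear_neg[OF lin] mult i j k l by simp_all
  then have x: "x = 0"
    by (simp add: omult_def prod_eq_iff quat_eq_iff quat_nth)
  have "omult (0, p) (0, p) = (- quat_1, 0)"
    using mult[of "(0, quat_1)" "(0, quat_1)"] linear_neg[OF lin, of "(quat_1, 0)"]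
    by (simp add: l x omult_units octonion_automorphism_one[OF f])
  then have "qunit p"
    by (simp add: omult_def prod_eq_iff quat_eq_iff quat_nth qunit_def power2_eq_square)
  moreover have "f = kmap quat_1 p"
  proof
    fix y :: octonion
    obtain a b where y: "y = (a, b)" by fastforce
    have "f y = f ((a, 0) + omult (0, quat_1) (qconj b, 0))"
      by (simp add: y omult_units)
    also have "\<dots> = (a, 0) + omult (0, p) (qconj b, 0)"
      by (simp only: linear_add[OF lin] mult H l x)
    also have "\<dots> = kmap quat_1 p y"
      by (simp add: y omult_def kmap_def)
    finally show "f y = kmap quat_1 p y" .
  qed
  ultimately show ?thesis
    using that by blast
qed

section \<open>Extremal position of the quaternion block\<close>

lemma trig_maximum:
  fixes a b :: real
  assumes "\<And>t. a * cos t + b * sin t \<le> a"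
  shows "b = 0"
proof (rule ccontr)
  assume "b \<noteq> 0"
  \<comment> \<open>At the angle with \<open>cos t = a / r\<close> and \<open>sin t = b / r\<close>
    the expression equals \<open>r\<close>, which exceeds \<open>a\<close> unless
    \<open>b = 0\<close>. This serves as a first-order condition at \<open>t = 0\<close>.\<close>
  define r where "r = sqrt (a\<^sup>2 + b\<^sup>2)"
  have "a\<^sup>2 + b\<^sup>2 > 0" using \<open>b \<noteq> 0\<close> by (simp add: add_nonneg_pos)
  then have r: "r > 0" "r\<^sup>2 = a\<^sup>2 + b\<^sup>2"
    by (simp_all add: r_def)
  have "(a / r)\<^sup>2 + (b / r)\<^sup>2 = 1"
    using \<open>b \<noteq> 0\<close> by (simp add: power_divide r(2) flip: add_divide_distrib)
  then obtain t where t: "a / r = cos t" "b / r = sin t"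
    using sincos_total_2pi[of "a / r" "b / r"] by blast
  have "a * cos t + b * sin t = (a\<^sup>2 + b\<^sup>2) / r"
    unfolding t[symmetric] by (simp add: power2_eq_square add_divide_distrib)
  also have "\<dots> = r"
    unfolding r(2)[symmetric] by (simp add: power2_eq_square)
  finally have "r \<le> a"
    using assms[of t] by simp
  then have "r\<^sup>2 \<le> a\<^sup>2"
    using r(1) by (simp add: power_mono)
  then show False
    using r(2) \<open>b \<noteq> 0\<close> by simp
qed

lemma bounded_bilinear_qmult: "bounded_bilinear qmult"
proof -
  have "bilinear qmult"
    by (auto simp: bilinear_def qmult_add intro!: linearI)
  then show ?thesis
    using bilinear_conv_bounded_bilinear by blast
qed

lemma linear_qconj: "linear qconj"
  by (rule linearI) (simp_all add: quat_eq_iff quat_nth)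

lemmas continuous_on_qmult [continuous_intros] = bounded_bilinear.continuous_on[OF bounded_bilinear_qmult]

lemma continuous_on_qconj [continuous_intros]:
  "continuous_on S f \<Longrightarrow> continuous_on S (\<lambda>x. qconj (f x))"
  by (rule bounded_linear.continuous_on[OF linear_qconj[unfolded linear_conv_bounded_linear]])

text \<open>A continuous function on a product of two 3-spheres attains its maximum. Optimality is
  stated relative to the maximiser, ready for testing with further rotations \<open>r\<close> and
  \<open>r'\<close>.\<close>

lemma exists_block_maximizer:
  assumes f: "linear f"
  obtains q q' where "qunit q" "qunit q'"
    "\<And>r r'. qunit r \<Longrightarrow> qunit r' \<Longrightarrow>
       2 * fst (kmap r quat_1 (kmap q quat_1 (f (kmap q' quat_1 (kmap r' quat_1 (quat_i, 0)))))) $ 2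
         + fst (kmap r quat_1 (kmap q quat_1 (f (kmap q' quat_1 (kmap r' quat_1 (quat_j, 0)))))) $ 3
       \<le> 2 * fst (kmap q quat_1 (f (kmap q' quat_1 (quat_i, 0)))) $ 2 + fst (kmap q quat_1 (f (kmap q' quat_1 (quat_j, 0)))) $ 3"
proof -
  define F where "F q q' = (2 * fst ((kmap q quat_1 \<circ> f \<circ> kmap q' quat_1) (quat_i, 0)) $ 2 +
     fst ((kmap q quat_1 \<circ> f \<circ> kmap q' quat_1) (quat_j, 0)) $ 3)" for q q'
  let ?S = "sphere (0::quat) 1 \<times> sphere (0::quat) 1"
  have lin: "continuous_on S (\<lambda>x. f (g x))" if "continuous_on S g" for S and g :: "quat \<times> quat \<Rightarrow> octonion"
    by (rule linear_continuous_on_compose[OF that f])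
  have cont: "continuous_on ?S (\<lambda>x. F (fst x) (snd x))"
    unfolding F_def comp_def kmap_def by (intro continuous_intros lin)
  have "compact ?S" by (intro compact_Times compact_sphere)
  moreover have "?S \<noteq> {}"
  proof -
    have "(quat_1, quat_1) \<in> ?S" using qunit_simps(3) by (simp add: qunit_iff_norm)
    then show ?thesis by blast
  qed
  ultimately obtain z where z: "z \<in> ?S" "\<And>x. x \<in> ?S \<Longrightarrow> F (fst x) (snd x) \<le> F (fst z) (snd z)"
    using continuous_attains_sup[OF _ _ cont] by blast
  obtain q q' where qq: "z = (q, q')" by fastforce
  have q: "qunit q" "qunit q'"
    using z(1) by (auto simp: qq qunit_iff_norm)
  have "F (qmult r q) (qmult q' r') \<le> F q q'" if "qunit r" "qunit r'" for r r'
    using z(2)[of "(qmult r q, qmult q' r')"] that q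
    by (simp add: qq qunit_iff_norm norm_qmult)
  then show ?thesis
    using that[OF q] by (simp add: F_def kmap_comp)
qed

text \<open>Rotating only rows or only columns about a coordinate axis gives first-order conditions
  that kill the off-diagonal entries; turns by \<open>pi / 2\<close> of rows and columns together
  permute diagonal entries and give the inequalities. The last entry may be negative, as only
  rotations are available.\<close>

lemma maximal_block_diagonal:
  fixes g :: "octonion \<Rightarrow> octonion"
  defines "B \<equiv> (\<lambda>r c. fst (g (c, 0)) $ r)"
  assumes g: "linear g"
    and max: "\<And>r r'. qunit r \<Longrightarrow> qunit r' \<Longrightarrow>
       2 * fst (kmap r quat_1 (g (kmap r' quat_1 (quat_i, 0)))) $ 2 + fst (kmap r quat_1 (g (kmap r' quat_1 (quat_j, 0)))) $ 3
       \<le> 2 * B 2 quat_i + B 3 quat_j"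
  shows "B 2 quat_j = 0" "B 2 quat_k = 0" "B 3 quat_i = 0" "B 3 quat_k = 0" "B 4 quat_i = 0" "B 4 quat_j = 0"
    "B 3 quat_j \<le> B 2 quat_i" "0 \<le> B 3 quat_j" "\<bar>B 4 quat_k\<bar> \<le> B 3 quat_j"
proof -
  have col: "kmap (qi t) quat_1 (quat_i, 0) = (quat_i, 0)"
      "kmap (qi t) quat_1 (quat_j, 0) = cos (2 * t) *\<^sub>R (quat_j, 0) + sin (2 * t) *\<^sub>R (quat_k, 0)"
      "kmap (qj t) quat_1 (quat_i, 0) = cos (2 * t) *\<^sub>R (quat_i, 0) - sin (2 * t) *\<^sub>R (quat_k, 0)"
      "kmap (qj t) quat_1 (quat_j, 0) = (quat_j, 0)"
      "kmap (qk t) quat_1 (quat_i, 0) = cos (2 * t) *\<^sub>R (quat_i, 0) + sin (2 * t) *\<^sub>R (quat_j, 0)"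
      "kmap (qk t) quat_1 (quat_j, 0) = cos (2 * t) *\<^sub>R (quat_j, 0) - sin (2 * t) *\<^sub>R (quat_i, 0)" for t
    by (simp_all add: prod_eq_iff quat_eq_iff kmap_nth quat_nth qijk_nth cos_sin_double algebra_simps sqr_sin)
  have row: "fst (kmap (qi t) quat_1 x) $ 2 = fst x $ 2"
      "fst (kmap (qi t) quat_1 x) $ 3 = cos (2 * t) * fst x $ 3 - sin (2 * t) * fst x $ 4"
      "fst (kmap (qj t) quat_1 x) $ 2 = cos (2 * t) * fst x $ 2 + sin (2 * t) * fst x $ 4"
      "fst (kmap (qj t) quat_1 x) $ 3 = fst x $ 3"
      "fst (kmap (qk t) quat_1 x) $ 2 = cos (2 * t) * fst x $ 2 - sin (2 * t) * fst x $ 3"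
      "fst (kmap (qk t) quat_1 x) $ 3 = cos (2 * t) * fst x $ 3 + sin (2 * t) * fst x $ 2" for t x
    by (simp_all add: kmap_nth quat_nth qijk_nth cos_sin_double algebra_simps sqr_sin)
  note lin = linear_add[OF g] linear_diff[OF g] linear_scale[OF g] fst_add fst_diff fst_scaleR vector_add_component
     vector_minus_component vector_scaleR_component
  note left = max[OF _ qunit_simps(3), unfolded kmap_1 id_apply row lin]
  note right = max[OF qunit_simps(3), unfolded kmap_1 id_apply col lin]
  have B: "fst (g (c, 0)) $ r = B r c" for r c
    by (simp add: B_def)
  have i: "B 3 quat_j * cos t + (- B 4 quat_j) * sin t \<le> B 3 quat_j" "B 3 quat_j * cos t + B 3 quat_k * sin t \<le> B 3 quat_j" for t
    using left[of "qi (t / 2)", unfolded row] right[of "qi (t / 2)", unfolded col lin] by (simp_all add: B mult.commute)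
  then show "B 4 quat_j = 0" "B 3 quat_k = 0"
    using trig_maximum neg_equal_0_iff_equal by blast+
  show "0 \<le> B 3 quat_j"
    \<comment> \<open>A half turn about the first axis changes the sign of the second diagonal
      entry.\<close>
    using i[of pi] by simp
  have "(2 * B 2 quat_i) * cos t + (2 * B 4 quat_i) * sin t \<le> 2 * B 2 quat_i"
      "(2 * B 2 quat_i) * cos t + (- 2 * B 2 quat_k) * sin t \<le> 2 * B 2 quat_i" for t
    using left[of "qj (t / 2)", unfolded row] right[of "qj (t / 2)", unfolded col lin] by (simp_all add: B algebra_simps)
  from trig_maximum[OF this(1)] trig_maximum[OF this(2)]
  show "B 4 quat_i = 0" "B 2 quat_k = 0" by simp_all
  \<comment> \<open>Rows and columns give two linear equations for the two remaining entries. They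
    are independent because the weights 2 and 1 differ.\<close>
  have "(2 * B 2 quat_i + B 3 quat_j) * cos t + (B 2 quat_j - 2 * B 3 quat_i) * sin t \<le> 2 * B 2 quat_i + B 3 quat_j"
      "(2 * B 2 quat_i + B 3 quat_j) * cos t + (2 * B 2 quat_j - B 3 quat_i) * sin t \<le> 2 * B 2 quat_i + B 3 quat_j" for t
    using left[of "qk (t / 2)", unfolded row] right[of "qk (t / 2)", unfolded col lin] by (simp_all add: B algebra_simps)
  from trig_maximum[OF this(1)] trig_maximum[OF this(2)]
  show "B 2 quat_j = 0" "B 3 quat_i = 0" by simp_all
  \<comment> \<open>Quarter turns exchange two adjacent diagonal entries, so the larger weight must
    sit on the larger entry; for the last two, both signs of the turn bound the absolute
    value.\<close>
  have "cos (2 * (pi / 4)) = 0" "sin (2 * (pi / 4)) = 1" "cos (2 * (- pi / 4)) = 0" "sin (2 * (- pi / 4)) = - 1"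
    by simp_all
  note q = this
  show "B 3 quat_j \<le> B 2 quat_i"
    using max[of "qk (pi / 4)" "qk (- pi / 4)", unfolded row col lin q] by (simp add: B)
  have "B 4 quat_k \<le> B 3 quat_j"
    using max[of "qi (pi / 4)" "qi (- pi / 4)", unfolded row col lin q] by (simp add: B)
  moreover have "- B 4 quat_k \<le> B 3 quat_j"
    using max[of "qi (pi / 4)" "qi (pi / 4)", unfolded row col lin q] by (simp add: B)
  ultimately show "\<bar>B 4 quat_k\<bar> \<le> B 3 quat_j" by simp
qed

section \<open>Reduction of an automorphism to the torus\<close>

lemma imaginary_iff: "fst x $ 1 = 0 \<longleftrightarrow> (\<exists>v. x = im_octonion v)"
proof
  assume "fst x $ 1 = 0"
  then have "x = im_octonion (\<chi> i. if i = 1 then fst x $ 2 else if i = 2 then fst x $ 3 else if i = 3 then fst x $ 4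
      else if i = 4 then snd x $ 1 else if i = 5 then snd x $ 2 else if i = 6 then snd x $ 3 else snd x $ 4)"
    by (simp add: prod_eq_iff quat_eq_iff im_octonion_nth)
  then show "\<exists>v. x = im_octonion v" ..
qed (auto simp: im_octonion_nth)

lemma kmap_imaginary:
  assumes "fst x $ 1 = 0"
  shows "fst (kmap q p x) $ 1 = 0"
  using assms by (simp add: kmap_nth quat_nth algebra_simps)

lemma qconj_mult_norm: "norm w \<noteq> 0 \<Longrightarrow> qmult ((1 / norm w) *\<^sub>R qconj w) w = norm w *\<^sub>R quat_1"
  by (simp add: qmult_qconj power2_eq_square)

text \<open>Left multiplication is simply transitive on unit quaternions, so a nonzero
  \<open>w1\<close> determines \<open>p\<close>. The product condition then fixes
  \<open>qmult p w2\<close> up to sign, and \<open>c \<le> cos v\<close> selects the sign.\<close>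

lemma align_pair:
  fixes w1 w2 :: quat
  assumes uv: "0 \<le> u" "u \<le> v" "v \<le> pi / 2"
    and n: "norm w1 = sin u" "norm w2 = sin v"
    and prod: "qmult (qconj w2) w1 = (cos u * cos v - c) *\<^sub>R quat_k" and c: "c \<le> cos v"
  obtains p where "qunit p" "qmult p w1 = sin u *\<^sub>R quat_1" "qmult p w2 = - sin v *\<^sub>R quat_k"
proof (cases "w1 = 0")
  case False
  define p where "p = (1 / norm w1) *\<^sub>R qconj w1"
  have p: "qunit p"
    using False by (simp add: p_def qunit_iff_norm)
  have p1: "qmult p w1 = sin u *\<^sub>R quat_1"
    using qconj_mult_norm[of w1] False unfolding p_def n[symmetric] by simp
  define s where "s = (cos u * cos v - c) / sin u"
  have "qmult p w2 = (1 / norm w1) *\<^sub>R qconj (qmult (qconj w2) w1)"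
    by (simp add: p_def qconj_qmult)
  also have "\<dots> = - s *\<^sub>R quat_k"
    by (simp add: prod s_def n) (simp add: quat_eq_iff quat_nth)
  finally have p2: "qmult p w2 = - s *\<^sub>R quat_k" .
  have "norm (qmult p w2) = sin v"
    using p n by (simp add: norm_qmult qunit_iff_norm)
  then have s: "\<bar>s\<bar> = sin v"
    unfolding p2 using qunit_simps(6) by (simp add: qunit_iff_norm)
  \<comment> \<open>The other sign would give \<open>c = cos (v - u)\<close>, which is larger than
    \<open>cos v\<close> since \<open>u > 0\<close>.\<close>
  have "s = sin v"
  proof (rule ccontr)
    assume "s \<noteq> sin v"
    with s have s: "s = - sin v" by linarith
    have "sin u \<noteq> 0" using False n by auto
    then have "c = cos u * cos v + sin u * sin v"
      using s by (simp add: s_def field_simps)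
    then have "cos (v - u) \<le> cos v"
      using c by (simp add: cos_diff mult.commute)
    then have "u = 0"
      using uv cos_mono_le_eq[of "v - u" v] pi_gt_zero by simp
    then show False using \<open>sin u \<noteq> 0\<close> by simp
  qed
  then show ?thesis
    using that p p1 p2 by simp
next
  \<comment> \<open>Here \<open>sin u = 0\<close> makes the first requirement void, and
    \<open>p\<close> is chosen to align \<open>w2\<close>.\<close>
  case True
  then have u: "sin u = 0" using n by simp
  show ?thesis
  proof (cases "w2 = 0")
    case True
    then have "sin v = 0" using n by simp
    then show ?thesis
      using that[of quat_1] u True \<open>w1 = 0\<close> by simp
  next
    case False
    define p where "p = - qmult quat_k ((1 / norm w2) *\<^sub>R qconj w2)"
    have "qunit p"
      unfolding p_def qunit_simps by (rule qunit_qmult) (use False in \<open>simp_all add: qunit_iff_norm[of "_ *\<^sub>R _"]\<close>)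
    moreover have "qmult p w2 = - sin v *\<^sub>R quat_k"
      unfolding p_def qmult_minus qmult_assoc using False by (simp only: qconj_mult_norm norm_eq_zero not_False_eq_True) (simp add: n)
    ultimately show ?thesis
      using that u \<open>w1 = 0\<close> by simp
  qed
qed

text \<open>In extremal position the images of \<open>i\<close> and \<open>j\<close> have diagonal
  quaternion parts, and the relations \<open>i i = j j = -1\<close> and \<open>i j = k\<close>
  determine their other parts up to a left factor \<open>p\<close>. Hence they agree with a torus
  element on \<open>i\<close> and \<open>j\<close>, and the remainder fixes the quaternions.\<close>

lemma cartan_decomposition_tmap:
  assumes f: "octonion_automorphism f" and M: "represents M f"
  obtains q p q' p' u v where "qunit q" "qunit p" "qunit q'" "qunit p'"
    "0 \<le> u" "u \<le> v" "u + 2 * v \<le> pi" "f = kmap q p \<circ> tmap u v \<circ> kmap q' p'"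
proof -
  have "linear f" using f by (simp add: octonion_automorphism_def)
  then obtain a b where ab: "qunit a" "qunit b"
    and max: "\<And>r r'. qunit r \<Longrightarrow> qunit r' \<Longrightarrow>
       2 * fst (kmap r quat_1 (kmap a quat_1 (f (kmap b quat_1 (kmap r' quat_1 (quat_i, 0)))))) $ 2
         + fst (kmap r quat_1 (kmap a quat_1 (f (kmap b quat_1 (kmap r' quat_1 (quat_j, 0)))))) $ 3
       \<le> 2 * fst (kmap a quat_1 (f (kmap b quat_1 (quat_i, 0)))) $ 2 + fst (kmap a quat_1 (f (kmap b quat_1 (quat_j, 0)))) $ 3"
    using exists_block_maximizer by blast
  define g where "g = kmap a quat_1 \<circ> f \<circ> kmap b quat_1"
  have g: "octonion_automorphism g"
    unfolding g_def by (intro octonion_automorphism_comp octonion_automorphism_kmap ab f qunit_simps)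
  then have lin: "linear g" and mult: "\<And>x y. g (omult x y) = omult (g x) (g y)"
    by (auto simp: octonion_automorphism_def)
  have im: "fst (g x) $ 1 = 0" if x: "fst x $ 1 = 0" for x
  proof -
    obtain v where v: "kmap b quat_1 x = im_octonion v"
      using kmap_imaginary[OF x] imaginary_iff by blast
    then have "fst (f (kmap b quat_1 x)) $ 1 = 0"
      using M by (simp add: represents_def im_octonion_nth)
    then show ?thesis
      by (simp add: g_def kmap_imaginary)
  qed
  have "2 * fst (kmap r quat_1 (g (kmap r' quat_1 (quat_i, 0)))) $ 2 + fst (kmap r quat_1 (g (kmap r' quat_1 (quat_j, 0)))) $ 3
       \<le> 2 * fst (g (quat_i, 0)) $ 2 + fst (g (quat_j, 0)) $ 3" if "qunit r" "qunit r'" for r r'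
    using max[OF that] by (simp add: g_def)
  note diag = maximal_block_diagonal[OF lin this]
  define c1 c2 c3 where c: "c1 = fst (g (quat_i, 0)) $ 2" "c2 = fst (g (quat_j, 0)) $ 3" "c3 = fst (g (quat_k, 0)) $ 4"
  define w1 w2 w3 where w: "w1 = snd (g (quat_i, 0))" "w2 = snd (g (quat_j, 0))" "w3 = snd (g (quat_k, 0))"
  have gi: "g (quat_i, 0) = (c1 *\<^sub>R quat_i, w1)" and gj: "g (quat_j, 0) = (c2 *\<^sub>R quat_j, w2)"
    and gk: "g (quat_k, 0) = (c3 *\<^sub>R quat_k, w3)"
    using diag im[of "(quat_i, 0)"] im[of "(quat_j, 0)"] im[of "(quat_k, 0)"]
    by (simp_all add: prod_eq_iff quat_eq_iff quat_nth c w)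
  have ord: "c2 \<le> c1" "0 \<le> c2" "\<bar>c3\<bar> \<le> c2"
    using diag by (simp_all add: c)
  have sq: "g (- quat_1, 0) = (- quat_1, 0)"
    using linear_neg[OF lin, of "(quat_1, 0)"] octonion_automorphism_one[OF g] by simp
  have "(norm w1)\<^sup>2 = 1 - c1\<^sup>2" "(norm w2)\<^sup>2 = 1 - c2\<^sup>2"
    using mult[of "(quat_i, 0)" "(quat_i, 0)"] mult[of "(quat_j, 0)" "(quat_j, 0)"]
    unfolding omult_units sq gi gj
    by (simp_all add: omult_def qmult_qconj quat_eq_iff quat_nth power2_eq_square)
  then have n2: "norm w1 = sqrt (1 - c1\<^sup>2)" "norm w2 = sqrt (1 - c2\<^sup>2)" and sq1: "c1\<^sup>2 \<le> 1" "c2\<^sup>2 \<le> 1"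
    using zero_le_power2[of "norm w1"] zero_le_power2[of "norm w2"] by (smt (verit) norm_ge_zero real_sqrt_unique)+
  have c01: "0 \<le> c1" "c1 \<le> 1" "c2 \<le> 1"
    using ord sq1 by (auto simp: abs_square_le_1)
  define u v where uv: "u = arccos c1" "v = arccos c2"
  have cs: "cos u = c1" "sin u = norm w1" "cos v = c2" "sin v = norm w2"
    using c01 ord n2 by (simp_all add: uv sin_arccos)
  have u: "0 \<le> u" "u \<le> v" "v \<le> pi / 2"
    unfolding uv using c01 ord by (auto intro: arccos_lbound arccos_le_mono[THEN iffD2] simp: arccos_le_pi2 simp del: le_divide_eq_numeral1)
  have "omult (c1 *\<^sub>R quat_i, w1) (c2 *\<^sub>R quat_j, w2) = (c3 *\<^sub>R quat_k, w3)"
    using mult[of "(quat_i, 0)" "(quat_j, 0)"] unfolding omult_units gi gj gk by simp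
  then have prod: "qmult (qconj w2) w1 = (cos u * cos v - c3) *\<^sub>R quat_k"
    by (simp add: omult_def cs quat_eq_iff quat_nth mult.commute[of c2 c1])
  have "c3 \<le> cos v"
    using ord cs by simp
  then obtain p where p: "qunit p" "qmult p w1 = sin u *\<^sub>R quat_1" "qmult p w2 = - sin v *\<^sub>R quat_k"
    using align_pair[OF u cs(2)[symmetric] cs(4)[symmetric] prod] by blast
  \<comment> \<open>This product is unchanged when \<open>w1\<close> and \<open>w2\<close> are both
    multiplied by the unit \<open>p\<close> on the left; evaluated after the alignment it identifies
    the third singular value with its sign.\<close>
  have "qmult (qconj w2) w1 = qmult (qconj (qmult p w2)) (qmult p w1)"
    using p(1) by (simp add: qconj_qmult qmult_assoc qunit_cancel)
  then have "c3 = cos (u + v)"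
    unfolding prod p by (simp add: quat_eq_iff quat_nth cos_add algebra_simps)
  \<comment> \<open>The lower bound \<open>- c2 \<le> c3\<close> is the remaining wall of the
    alcove.\<close>
  then have "cos (pi - v) \<le> cos (u + v)"
    using ord cs by simp
  then have uv_le: "u + 2 * v \<le> pi"
    using cos_mono_le_eq[of "pi - v" "u + v"] u by simp
  define h where "h = tmap (- u) (- v) \<circ> kmap quat_1 p \<circ> g"
  have "octonion_automorphism h"
    unfolding h_def by (intro octonion_automorphism_comp octonion_automorphism_tmap octonion_automorphism_kmap p g qunit_simps)
  moreover have "kmap quat_1 p (g (quat_i, 0)) = tmap u v (quat_i, 0)" "kmap quat_1 p (g (quat_j, 0)) = tmap u v (quat_j, 0)"
    unfolding gi gj
    by (simp_all add: kmap_def p prod_eq_iff tmap_nth quat_eq_iff quat_nth cs)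
  then have "h (quat_i, 0) = (quat_i, 0)" "h (quat_j, 0) = (quat_j, 0)"
    unfolding h_def by (simp_all add: tmap_add)
  ultimately obtain p' where p': "qunit p'" "h = kmap quat_1 p'"
    using automorphism_fixing_quaternions by blast
  have "f = kmap (qconj a) quat_1 \<circ> kmap quat_1 (qconj p) \<circ> tmap u v \<circ> h \<circ> kmap (qconj b) quat_1"
  proof
    fix x
    have inv: "kmap c quat_1 (kmap (qconj c) quat_1 x) = x" "kmap (qconj c) quat_1 (kmap c quat_1 x) = x"
       "kmap quat_1 (qconj c) (kmap quat_1 c x) = x" if "qunit c" for c x
      using kmap_inverse[of c quat_1] kmap_inverse[of quat_1 c] that by simp_all
    show "f x = (kmap (qconj a) quat_1 \<circ> kmap quat_1 (qconj p) \<circ> tmap u v \<circ> h \<circ> kmap (qconj b) quat_1) x"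
      by (simp add: h_def g_def tmap_add inv ab p)
  qed
  then have "f = kmap (qconj a) (qconj p) \<circ> tmap u v \<circ> kmap (qconj b) p'"
    by (simp add: fun_eq_iff p' kmap_comp)
  then show ?thesis
    using that[of "qconj a" "qconj p" "qconj b" p' u v] ab p p' u uv_le by simp
qed

lemma cartan_decomposition:
  assumes f: "octonion_automorphism f" and M: "represents M f"
  obtains q p q' p' x y where "qunit q" "qunit p" "qunit q'" "qunit p'"
    "0 \<le> x" "x \<le> pi / 6" "3 * x \<le> y" "y \<le> pi / 2" "f = kmap q p \<circ> amap x y \<circ> kmap q' p'"
proof -
  obtain q p q' p' u v where *: "qunit q" "qunit p" "qunit q'" "qunit p'"
    "0 \<le> u" "u \<le> v" "u + 2 * v \<le> pi" "f = kmap q p \<circ> tmap u v \<circ> kmap q' p'"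
    using cartan_decomposition_tmap[OF assms] .
  define r where "r = qi (pi / 8)"
  have r: "qunit r" "qi (- pi / 8) = qconj r" by (simp_all add: r_def)
  \<comment> \<open>The substitution \<open>u = 2 x\<close>, \<open>v = y - x\<close> turns
    \<open>u \<le> v\<close> and \<open>u + 2 v \<le> pi\<close> into \<open>3 x \<le> y\<close> and
    \<open>y \<le> pi / 2\<close>; these imply \<open>x \<le> pi / 6\<close>.\<close>
  have "f = kmap (qmult q (qconj r)) (qmult p (qconj r)) \<circ> amap (u / 2) (v + u / 2) \<circ> kmap (qmult r q') (qmult r p')"
    unfolding amap_def fun_eq_iff r r_def[symmetric]
    using r by (simp add: * kmap_comp qmult_assoc qunit_cancel)
  then show ?thesis
    by (rule that[rotated -1]) (use * r in \<open>auto intro!: qunit_qmult\<close>)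
qed

section \<open>Euler angles for unit quaternions\<close>

definition qQ :: "real \<Rightarrow> real \<Rightarrow> real \<Rightarrow> quat" where
  "qQ x y z = qmult (qmult (qi x) (qk y)) (qi z)"

text \<open>The sign of \<open>y\<close> is that of \<open>represents_kmap\<close>, where the
  exponential of \<open>C2\<close> corresponds to \<open>qj\<close> of the negative angle.\<close>

definition qP :: "real \<Rightarrow> real \<Rightarrow> real \<Rightarrow> quat" where
  "qP x y z = qmult (qmult (qi x) (qj (- y))) (qi z)"

lemma qQ_nth:
  "qQ x y z $ 1 = cos y * cos (x + z)" "qQ x y z $ 2 = cos y * sin (x + z)"
  "qQ x y z $ 3 = sin y * sin (z - x)" "qQ x y z $ 4 = sin y * cos (z - x)"
  unfolding qQ_def qmult_nth qijk_nth cos_add sin_add cos_diff sin_diff by (simp_all add: algebra_simps)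

lemma qP_nth:
  "qP x y z $ 1 = cos y * cos (x + z)" "qP x y z $ 2 = cos y * sin (x + z)"
  "qP x y z $ 3 = - sin y * cos (z - x)" "qP x y z $ 4 = sin y * sin (z - x)"
  unfolding qP_def qmult_nth qijk_nth cos_add sin_add cos_diff sin_diff by (simp_all add: algebra_simps)

lemma qunit_qQ [simp]: "qunit (qQ x y z)" and qunit_qP [simp]: "qunit (qP x y z)"
  by (simp_all add: qQ_def qP_def qunit_qmult)

lemma polar_coordinates:
  obtains t where "a = sqrt (a\<^sup>2 + b\<^sup>2) * cos t" "b = sqrt (a\<^sup>2 + b\<^sup>2) * sin t"
proof (cases "a = 0 \<and> b = 0")
  case False
  define r where "r = sqrt (a\<^sup>2 + b\<^sup>2)"
  have "r\<^sup>2 = a\<^sup>2 + b\<^sup>2" "r \<noteq> 0"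
    using False by (simp_all add: r_def sum_power2_eq_zero_iff)
  then have "(a / r)\<^sup>2 + (b / r)\<^sup>2 = 1"
    using False by (simp add: power_divide sum_power2_eq_zero_iff flip: add_divide_distrib)
  then obtain t where "a / r = cos t" "b / r = sin t"
    using sincos_total_2pi[of "a / r" "b / r"] by blast
  then have "a = r * cos t" "b = r * sin t"
    using \<open>r \<noteq> 0\<close> by (simp_all add: field_simps)
  then show ?thesis
    unfolding r_def by (rule that)
next
  case True
  then show ?thesis
    by (intro that[of 0]) simp_all
qed

text \<open>Write the pairs \<open>(a, b)\<close> and \<open>(d, c)\<close> in polar coordinates;
  their radii are \<open>cos y\<close> and \<open>sin y\<close>, and their angles are
  \<open>x + z\<close> and \<open>z - x\<close> modulo \<open>2 * pi\<close>.\<close>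

lemma euler_angles:
  fixes a b c d :: real
  assumes "a\<^sup>2 + b\<^sup>2 + c\<^sup>2 + d\<^sup>2 = 1"
  obtains x y z where "0 \<le> x" "x \<le> 2 * pi" "0 \<le> y" "y \<le> pi / 2" "0 \<le> z" "z \<le> pi"
    "a = cos y * cos (x + z)" "b = cos y * sin (x + z)" "c = sin y * sin (z - x)" "d = sin y * cos (z - x)"
proof -
  define r where "r = sqrt (a\<^sup>2 + b\<^sup>2)"
  define y where "y = arccos r"
  have r: "0 \<le> r" "r\<^sup>2 = a\<^sup>2 + b\<^sup>2"
    by (simp_all add: r_def)
  then have "r\<^sup>2 \<le> 1"
    using assms zero_le_power2[of c] zero_le_power2[of d] by linarith
  then have "r \<le> 1"
    by (rule power2_le_imp_le[OF _ zero_le_one, unfolded power_one])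
  have y: "0 \<le> y" "y \<le> pi / 2" "cos y = r" "sin y = sqrt (d\<^sup>2 + c\<^sup>2)"
    using r \<open>r \<le> 1\<close> assms
    by (simp_all add: y_def arccos_lbound arccos_le_pi2 sin_arccos algebra_simps del: le_divide_eq_numeral1)
  obtain s where s: "a = cos y * cos s" "b = cos y * sin s"
    unfolding y r_def using polar_coordinates by blast
  obtain t where t: "d = sin y * cos t" "c = sin y * sin t"
    unfolding y using polar_coordinates by blast
  \<comment> \<open>Subtracting \<open>pi * n\<close> from both angles leaves \<open>z - x\<close>
    alone and changes \<open>x + z\<close> by a period. So \<open>z\<close> is first brought into
    its interval, and then \<open>x\<close> is reduced modulo \<open>2 * pi\<close>.\<close>
  define n where "n = \<lfloor>(s + t) / (2 * pi)\<rfloor>"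
  define z where "z = (s + t) / 2 - pi * n"
  define x0 where "x0 = (s - t) / 2 - pi * n"
  define m where "m = \<lfloor>x0 / (2 * pi)\<rfloor>"
  define x where "x = x0 - 2 * pi * m"
  have "n \<le> (s + t) / (2 * pi)" "(s + t) / (2 * pi) \<le> n + 1"
    unfolding n_def by linarith+
  then have z: "0 \<le> z" "z \<le> pi"
    using pi_gt_zero by (simp_all add: z_def field_simps)
  have "m \<le> x0 / (2 * pi)" "x0 / (2 * pi) \<le> m + 1"
    unfolding m_def by linarith+
  then have x: "0 \<le> x" "x \<le> 2 * pi"
    using pi_gt_zero by (simp_all add: x_def field_simps)
  have "sin (x + z) = sin s \<and> cos (x + z) = cos s"
    unfolding sin_cos_eq_iff
    by (rule exI[of _ "- n - m"]) (simp add: x_def x0_def z_def field_simps)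
  moreover have "sin (z - x) = sin t \<and> cos (z - x) = cos t"
    unfolding sin_cos_eq_iff
    by (rule exI[of _ "m"]) (simp add: x_def x0_def z_def field_simps)
  ultimately show ?thesis
    using that[OF x y(1,2) z] s t by simp
qed

lemma euler_angles_qP:
  assumes "qunit p"
  obtains x y z where "0 \<le> x" "x \<le> 2 * pi" "0 \<le> y" "y \<le> pi / 2" "0 \<le> z" "z \<le> pi" "p = qP x y z"
proof -
  have "(p$1)\<^sup>2 + (p$2)\<^sup>2 + (p$4)\<^sup>2 + (- p$3)\<^sup>2 = 1"
    using assms by (simp add: qunit_def)
  then obtain x y z where *: "0 \<le> x" "x \<le> 2 * pi" "0 \<le> y" "y \<le> pi / 2" "0 \<le> z" "z \<le> pi"
    "p$1 = cos y * cos (x + z)" "p$2 = cos y * sin (x + z)" "p$4 = sin y * sin (z - x)" "- p$3 = sin y * cos (z - x)"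
    by (rule euler_angles)
  then have "p = qP x y z"
    by (simp add: quat_eq_iff qP_nth)
  then show ?thesis
    by (rule that[OF *(1-6)])
qed

text \<open>Shifting \<open>x\<close> by \<open>pi\<close> negates the quaternion, so half the range
  of \<open>x\<close> suffices up to a sign \<open>e\<close>, which is absorbed later by the other
  factor of \<open>K\<close>.\<close>

lemma euler_angles_qQ:
  assumes "qunit q"
  obtains x y z e where "0 \<le> x" "x \<le> pi" "0 \<le> y" "y \<le> pi / 2" "0 \<le> z" "z \<le> pi"
    "e = 1 \<or> e = - 1" "q = e *\<^sub>R qQ x y z"
proof -
  obtain x y z where *: "0 \<le> x" "x \<le> 2 * pi" "0 \<le> y" "y \<le> pi / 2" "0 \<le> z" "z \<le> pi"
    "q$1 = cos y * cos (x + z)" "q$2 = cos y * sin (x + z)" "q$3 = sin y * sin (z - x)" "q$4 = sin y * cos (z - x)"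
    by (rule euler_angles[OF assms[unfolded qunit_def]])
  show ?thesis
  proof (cases "x \<le> pi")
    case True
    then show ?thesis
      using that[of x y z 1] * by (simp add: quat_eq_iff qQ_nth)
  next
    case False
    have "x - pi + z = (x + z) - pi" "z - (x - pi) = (z - x) + pi" by simp_all
    then have "cos (x - pi + z) = - cos (x + z)" "sin (x - pi + z) = - sin (x + z)"
      "cos (z - (x - pi)) = - cos (z - x)" "sin (z - (x - pi)) = - sin (z - x)"
      by (simp_all only: cos_diff[of "x + z" pi] sin_diff[of "x + z" pi] cos_add[of "z - x" pi] sin_add[of "z - x" pi]) simp_all
    then have "q = (- 1) *\<^sub>R qQ (x - pi) y z"
      using * unfolding quat_eq_iff vector_scaleR_component qQ_nth by simp
    then show ?thesis
      using that[of "x - pi" y z "- 1"] * False by simp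
  qed
qed

lemma represents_euler_sigma: "represents (euler_sigma x y z) (kmap (qQ x y z) quat_1)"
proof -
  have "represents (euler_sigma x y z) (kmap (qi x) quat_1 \<circ> kmap (qk y) quat_1 \<circ> kmap (qi z) quat_1)"
    unfolding euler_sigma_def mexp_C8 mexp_C9 by (intro represents_mult represents_kmap)
  then show ?thesis
    by (simp add: comp_def kmap_comp qQ_def qmult_assoc)
qed

lemma represents_euler_s: "represents (euler_s x y z) (kmap quat_1 (qP x y z))"
proof -
  have "represents (euler_s x y z) (kmap quat_1 (qi x) \<circ> kmap quat_1 (qj (- y)) \<circ> kmap quat_1 (qi z))"
    unfolding euler_s_def mexp_C2 mexp_C3 by (intro represents_mult represents_kmap)
  then show ?thesis
    by (simp add: comp_def kmap_comp qP_def qmult_assoc)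
qed

text \<open>The two factors of \<open>K\<close> commute, so \<open>euler_sigma\<close> and
  \<open>euler_s\<close> merge into one \<open>kmap\<close> on either side, although their order
  differs.\<close>

lemma represents_euler_map:
  "represents (euler_map a)
     (kmap (qQ (a$1) (a$2) (a$3)) (qP (a$4) (a$5) (a$6)) \<circ> amap (a$7) (a$8) \<circ>
      kmap (qQ (a$12) (a$13) (a$14)) (qP (a$9) (a$10) (a$11)))"
proof -
  have "represents (euler_sigma (a$1) (a$2) (a$3) ** euler_s (a$4) (a$5) (a$6)
     ** (mexp ((sqrt 3 * a$7) *\<^sub>R C11) ** mexp (a$8 *\<^sub>R C5))
     ** euler_s (a$9) (a$10) (a$11) ** euler_sigma (a$12) (a$13) (a$14))
     (kmap (qQ (a$1) (a$2) (a$3)) quat_1 \<circ> kmap quat_1 (qP (a$4) (a$5) (a$6)) \<circ> amap (a$7) (a$8) \<circ>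
      kmap quat_1 (qP (a$9) (a$10) (a$11)) \<circ> kmap (qQ (a$12) (a$13) (a$14)) quat_1)"
    by (intro represents_mult represents_euler_sigma represents_euler_s represents_amap)
  then show ?thesis
    by (simp add: euler_map_def matrix_mul_assoc comp_def kmap_comp)
qed

lemma octonion_automorphism_amap: "octonion_automorphism (amap x y)"
  unfolding amap_def
  by (intro octonion_automorphism_comp octonion_automorphism_kmap octonion_automorphism_tmap qunit_qijk)

lemma euler_map_in_G2: "euler_map a \<in> G2"
proof -
  have "octonion_automorphism (kmap (qQ (a$1) (a$2) (a$3)) (qP (a$4) (a$5) (a$6)) \<circ> amap (a$7) (a$8) \<circ>
      kmap (qQ (a$12) (a$13) (a$14)) (qP (a$9) (a$10) (a$11)))"
    by (intro octonion_automorphism_comp octonion_automorphism_amap octonion_automorphism_kmap qunit_qQ qunit_qP)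
  then show ?thesis
    using represents_euler_map[of a] G2_iff by metis
qed

section \<open>Surjectivity\<close>

text \<open>The conjugate of \<open>quat_j\<close> by \<open>qi (pi / 8)\<close>, which is the
  change of basis built into \<open>amap\<close>.\<close>

definition qj' :: quat where "qj' = vector [0, 0, cos (pi / 4), sin (pi / 4)]"

lemma qj'_nth: "qj' $ 1 = 0" "qj' $ 2 = 0" "qj' $ 3 = cos (pi / 4)" "qj' $ 4 = sin (pi / 4)"
  by (simp_all add: qj'_def vector_4)

lemma qunit_qj' [simp]: "qunit qj'"
  by (simp add: qunit_def qj'_nth)

lemma kmap_tmap_commute:
  "kmap quat_i quat_i (tmap u v x) = tmap u v (kmap quat_i quat_i x)"
  "kmap quat_j (- quat_j) (tmap u v x) = tmap u v (kmap quat_j (- quat_j) x)"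
  by (simp_all add: prod_eq_iff quat_eq_iff kmap_nth tmap_nth quat_nth)

text \<open>In the rotated basis the pairs \<open>(i, i)\<close> and \<open>(j, - j)\<close> act by
  signs that are constant on each plane of the torus. Conjugating back gives the stated
  pairs.\<close>

lemma kmap_amap_commute:
  assumes m: "(m, m') \<in> {(- quat_i, - quat_i), (qj', - qj')}"
  shows "kmap m m' (amap x y z) = amap x y (kmap m m' z)"
proof -
  define r where "r = qi (pi / 8)"
  have r: "qunit r" "qi (- pi / 8) = qconj r" by (simp_all add: r_def)
  have q: "qmult r (qmult quat_i (qconj r)) = quat_i" "qmult r (qmult quat_j (qconj r)) = qj'"
    using cos_sin_double[of "pi / 8"]
    by (simp_all add: r_def quat_eq_iff quat_nth qijk_nth qj'_nth algebra_simps sqr_sin)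
  obtain n n' where n: "kmap m m' = kmap (qmult r (qmult n (qconj r))) (qmult r (qmult n' (qconj r)))"
    and comm: "\<And>u v x. kmap n n' (tmap u v x) = tmap u v (kmap n n' x)"
  proof -
    from m consider "m = - quat_i" "m' = - quat_i" | "m = qj'" "m' = - qj'" by auto
    then show thesis
    proof cases
      case 1
      then show thesis
        using that[of quat_i quat_i] kmap_tmap_commute(1) q(1) by simp
    next
      case 2
      then show thesis
        using that[of quat_j "- quat_j"] kmap_tmap_commute(2) q(2) by simp
    qed
  qed
  have *: "kmap m m' z = kmap r r (kmap n n' (kmap (qconj r) (qconj r) z))" for z
    unfolding n kmap_comp qmult_assoc ..
  show ?thesis
    unfolding * amap_def r r_def[symmetric] comp_def using r comm by (simp add: kmap_inverse)
qed

text \<open>Elements of the centraliser can be moved through the torus. This is the freedom used to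
  shorten the ranges of the left angles.\<close>

lemma kmap_amap_insert:
  assumes "(m, m') \<in> {(quat_1, quat_1), (- quat_i, - quat_i), (qj', - qj')}"
  shows "kmap q p \<circ> amap x y \<circ> kmap q' p' =
     kmap (qmult q m) (qmult p m') \<circ> amap x y \<circ> kmap (qmult (qconj m) q') (qmult (qconj m') p')"
proof -
  have "qunit m" "qunit m'" using assms by auto
  then have "amap x y (kmap q' p' z) = amap x y (kmap m m' (kmap (qconj m) (qconj m') (kmap q' p' z)))" for z
    by (simp add: kmap_inverse)
  moreover have "amap x y (kmap m m' z) = kmap m m' (amap x y z)" for z
    using assms kmap_amap_commute[of m m' x y z] by (cases "m = quat_1") auto
  ultimately show ?thesis
    by (simp add: fun_eq_iff flip: kmap_comp del: split_paired_All)
qed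

text \<open>The \<open>i\<close>-component of \<open>p i qconj p\<close>. For Euler angles it is
  \<open>cos (2 * y)\<close>, so its sign decides whether \<open>y\<close> exceeds
  \<open>pi / 4\<close>.\<close>

definition icomp :: "quat \<Rightarrow> real" where
  "icomp p = (p$1)\<^sup>2 + (p$2)\<^sup>2 - (p$3)\<^sup>2 - (p$4)\<^sup>2"

lemma icomp_qmult_qi: "icomp (qmult p (- quat_i)) = icomp p" "icomp (qmult p quat_i) = icomp p"
  by (simp_all add: icomp_def quat_nth)

lemma icomp_qmult_qj':
  shows "icomp (qmult p (- qj')) = - icomp p" "icomp (qmult p qj') = - icomp p"
proof -
  have s: "sqrt 2 * (sqrt 2 * z) = 2 * z" for z
    by (simp flip: mult.assoc)
  show "icomp (qmult p (- qj')) = - icomp p" "icomp (qmult p qj') = - icomp p"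
    by (simp_all add: icomp_def quat_nth qj'_nth cos_45 sin_45 power2_eq_square algebra_simps s)
qed

lemma icomp_qP: "icomp (qP x y z) = cos (2 * y)"
proof -
  have "icomp (qP x y z) = (cos y)\<^sup>2 * ((cos (x + z))\<^sup>2 + (sin (x + z))\<^sup>2) - (sin y)\<^sup>2 * ((cos (z - x))\<^sup>2 + (sin (z - x))\<^sup>2)"
    unfolding icomp_def qP_nth power_mult_distrib power2_minus by (simp only: ring_distribs)
  then show ?thesis
    by (simp add: cos_double)
qed

lemma icomp_uminus [simp]: "icomp (- p) = icomp p"
  by (simp add: icomp_def)

lemma normalize_icomp:
  assumes k: "qunit q" "qunit p" "qunit q'" "qunit p'"
  obtains r s r' s' where "qunit r" "qunit s" "qunit r'" "qunit s'" "0 \<le> icomp s"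
    "kmap q p \<circ> amap x y \<circ> kmap q' p' = kmap r s \<circ> amap x y \<circ> kmap r' s'"
proof (cases "0 \<le> icomp p")
  case True
  then show ?thesis using that k by blast
next
  case False
  then show ?thesis
    by (intro that[of "qmult q qj'" "qmult p (- qj')" "qmult (qconj qj') q'" "qmult (qconj (- qj')) p'"] kmap_amap_insert)
      (simp_all add: k qunit_qmult icomp_qmult_qj' del: qmult_minus)
qed

lemma qQ_mult_minus_i: "qmult (qQ x y z) (- quat_i) = qQ x y (z - pi / 2)"
proof -
  have *: "x + (z - pi / 2) = (x + z) - pi / 2" "z - pi / 2 - x = (z - x) - pi / 2"
    by simp_all
  show ?thesis
    unfolding quat_eq_iff qQ_nth * cos_diff[of _ "pi / 2"] sin_diff[of _ "pi / 2"] by (simp add: quat_nth qQ_nth)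
qed

text \<open>First \<open>qj'\<close> makes \<open>icomp\<close> nonnegative, which gives
  \<open>e \<le> pi / 4\<close>; then \<open>quat_i\<close>, which preserves \<open>icomp\<close>,
  brings \<open>c\<close> below \<open>pi / 2\<close>; finally the sign of \<open>q\<close> is moved
  to \<open>p\<close>.\<close>

lemma left_euler_angles:
  assumes k: "qunit q" "qunit p" "qunit q'" "qunit p'"
  obtains a b c d e f r s where
    "0 \<le> a" "a \<le> pi" "0 \<le> b" "b \<le> pi / 2" "0 \<le> c" "c \<le> pi / 2"
    "0 \<le> d" "d \<le> 2 * pi" "0 \<le> e" "e \<le> pi / 4" "0 \<le> f" "f \<le> pi"
    "qunit r" "qunit s"
    "kmap q p \<circ> amap x y \<circ> kmap q' p' = kmap (qQ a b c) (qP d e f) \<circ> amap x y \<circ> kmap r s"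
proof -
  obtain q2 p2 q2' p2' where 2: "qunit q2" "qunit p2" "qunit q2'" "qunit p2'" "0 \<le> icomp p2"
    "kmap q p \<circ> amap x y \<circ> kmap q' p' = kmap q2 p2 \<circ> amap x y \<circ> kmap q2' p2'"
    using normalize_icomp[OF k] .
  obtain a b c h where Q: "0 \<le> a" "a \<le> pi" "0 \<le> b" "b \<le> pi / 2" "0 \<le> c" "c \<le> pi"
    and h: "h = 1 \<or> h = - 1" and q2: "q2 = h *\<^sub>R qQ a b c"
    using euler_angles_qQ[OF 2(1)] .
  obtain c' p3 r s where c': "0 \<le> c'" "c' \<le> pi / 2" and p3: "qunit p3" "0 \<le> icomp p3" and rs: "qunit r" "qunit s"
    and 3: "kmap q2 p2 \<circ> amap x y \<circ> kmap q2' p2' = kmap (h *\<^sub>R qQ a b c') p3 \<circ> amap x y \<circ> kmap r s"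
  proof (cases "c \<le> pi / 2")
    case True
    then show thesis
      using that[of c p2 q2' p2'] 2 Q q2 by blast
  next
    case False
    \<comment> \<open>Passing \<open>- quat_i\<close> through the torus lowers \<open>c\<close> by
      \<open>pi / 2\<close>.\<close>
    have "kmap q2 p2 \<circ> amap x y \<circ> kmap q2' p2' = kmap (qmult q2 (- quat_i)) (qmult p2 (- quat_i)) \<circ> amap x y \<circ>
        kmap (qmult (qconj (- quat_i)) q2') (qmult (qconj (- quat_i)) p2')"
      by (intro kmap_amap_insert) simp
    moreover have "qmult q2 (- quat_i) = h *\<^sub>R qQ a b (c - pi / 2)"
      unfolding q2 qmult_scaleR qQ_mult_minus_i ..
    ultimately show thesis
      using that[of "c - pi / 2" "qmult p2 (- quat_i)" "qmult (qconj (- quat_i)) q2'" "qmult (qconj (- quat_i)) p2'"]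
        2 Q False
      by (simp add: qunit_qmult icomp_qmult_qi del: qmult_minus qconj_simps)
  qed
  \<comment> \<open>The sign \<open>h\<close> goes over to \<open>p\<close>, whose first Euler angle
    has a full period at its disposal.\<close>
  define p4 where "p4 = h *\<^sub>R p3"
  have p4: "qunit p4" "0 \<le> icomp p4" "kmap (h *\<^sub>R qQ a b c') p3 = kmap (qQ a b c') p4"
    using h p3 kmap_uminus[of "qQ a b c'" "- p3"] by (auto simp: p4_def)
  obtain d e f where P: "0 \<le> d" "d \<le> 2 * pi" "0 \<le> e" "e \<le> pi / 2" "0 \<le> f" "f \<le> pi" "p4 = qP d e f"
    using euler_angles_qP[OF p4(1)] .
  have "cos (pi / 2) \<le> cos (2 * e)"
    using p4(2) by (simp add: P(7) icomp_qP)
  then have "e \<le> pi / 4"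
    using cos_mono_le_eq[of "pi / 2" "2 * e"] P pi_gt_zero by simp
  then show ?thesis
    using that[OF Q(1-4) c' P(1-3) _ P(5,6) rs] 2(6) 3 p4(3) P(7) by simp
qed

lemma right_euler_angles:
  assumes k: "qunit q" "qunit p"
  obtains a b c d e f where
    "0 \<le> a" "a \<le> pi" "0 \<le> b" "b \<le> pi / 2" "0 \<le> c" "c \<le> pi"
    "0 \<le> d" "d \<le> 2 * pi" "0 \<le> e" "e \<le> pi / 2" "0 \<le> f" "f \<le> pi"
    "kmap q p = kmap (qQ a b c) (qP d e f)"
proof -
  obtain a b c h where Q: "0 \<le> a" "a \<le> pi" "0 \<le> b" "b \<le> pi / 2" "0 \<le> c" "c \<le> pi"
    and h: "h = 1 \<or> h = - 1" and q: "q = h *\<^sub>R qQ a b c"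
    using euler_angles_qQ[OF k(1)] .
  have hp: "qunit (h *\<^sub>R p)" using h k by auto
  obtain d e f where P: "0 \<le> d" "d \<le> 2 * pi" "0 \<le> e" "e \<le> pi / 2" "0 \<le> f" "f \<le> pi" "h *\<^sub>R p = qP d e f"
    using euler_angles_qP[OF hp] .
  have "kmap q p = kmap (qQ a b c) (qP d e f)"
    unfolding P(7)[symmetric] q using h kmap_uminus[of "qQ a b c" "- p"] by auto
  then show ?thesis
    using that Q P by blast
qed

lemma euler_map_surj:
  assumes "M \<in> G2"
  shows "M \<in> euler_map ` euler_region"
proof -
  obtain f where f: "octonion_automorphism f" "represents M f"
    using assms by (auto simp: G2_iff)
  obtain q p q' p' x y where k: "qunit q" "qunit p" "qunit q'" "qunit p'"
    and xy: "0 \<le> x" "x \<le> pi / 6" "3 * x \<le> y" "y \<le> pi / 2" and f_eq: "f = kmap q p \<circ> amap x y \<circ> kmap q' p'"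
    using cartan_decomposition[OF f] .
  obtain a1 a2 a3 a4 a5 a6 r s where L:
    "0 \<le> a1" "a1 \<le> pi" "0 \<le> a2" "a2 \<le> pi / 2" "0 \<le> a3" "a3 \<le> pi / 2"
    "0 \<le> a4" "a4 \<le> 2 * pi" "0 \<le> a5" "a5 \<le> pi / 4" "0 \<le> a6" "a6 \<le> pi"
    "qunit r" "qunit s"
    "kmap q p \<circ> amap x y \<circ> kmap q' p' = kmap (qQ a1 a2 a3) (qP a4 a5 a6) \<circ> amap x y \<circ> kmap r s"
    using left_euler_angles[OF k] .
  obtain b1 b2 b3 b4 b5 b6 where R:
    "0 \<le> b1" "b1 \<le> pi" "0 \<le> b2" "b2 \<le> pi / 2" "0 \<le> b3" "b3 \<le> pi"
    "0 \<le> b4" "b4 \<le> 2 * pi" "0 \<le> b5" "b5 \<le> pi / 2" "0 \<le> b6" "b6 \<le> pi"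
    "kmap r s = kmap (qQ b1 b2 b3) (qP b4 b5 b6)"
    using right_euler_angles[OF L(13,14)] .
  \<comment> \<open>On the right the parameters of \<open>euler_s\<close> precede those of
    \<open>euler_sigma\<close>, hence the \<open>b4, b5, b6\<close> come first.\<close>
  define a :: "real ^ 14" where "a = vector [a1, a2, a3, a4, a5, a6, x, y, b4, b5, b6, b1, b2, b3]"
  have a: "a$1 = a1" "a$2 = a2" "a$3 = a3" "a$4 = a4" "a$5 = a5" "a$6 = a6" "a$7 = x" "a$8 = y"
    "a$9 = b4" "a$10 = b5" "a$11 = b6" "a$12 = b1" "a$13 = b2" "a$14 = b3"
    unfolding a_def vector_def by simp_all
  have "a \<in> euler_region"
    unfolding euler_region_def mem_Collect_eq a using L(1-12) R(1-12) xy by blast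
  moreover have "M = euler_map a"
    using represents_unique[of M f] f(2) represents_euler_map[of a]
    unfolding a f_eq L(15) R(13) by blast
  ultimately show ?thesis by blast
qed

section \<open>Uniqueness of the Cartan decomposition\<close>

text \<open>With \<open>C\<close>, \<open>D\<close> diagonal and \<open>Q C = D P\<close> one gets
  \<open>Q C^2 Q^T = D^2\<close>, hence \<open>Q C^2 = D^2 Q\<close>. The squares on the diagonals
  are strictly decreasing, so they coincide and \<open>Q\<close> is diagonal.\<close>

lemma sorted_singular_values_unique:
  fixes Q P :: "real ^ 3 ^ 3" and c d :: "real ^ 3"
  assumes Q: "orthogonal_matrix Q" and P: "orthogonal_matrix P"
    and c: "c$2 < c$1" "\<bar>c$3\<bar> < c$2" and d: "d$2 < d$1" "\<bar>d$3\<bar> < d$2"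
    and eq: "\<And>i j. Q$i$j * c$j = d$i * P$i$j"
  shows "c$1 = d$1" "c$2 = d$2" "\<And>i j. i \<noteq> j \<Longrightarrow> Q$i$j = 0"
proof -
  have "(\<Sum>j\<in>UNIV. Q$i$j * (c$j)\<^sup>2 * Q$k$j) = (if i = k then (d$i)\<^sup>2 else 0)" for i k
  proof -
    have "(\<Sum>j\<in>UNIV. Q$i$j * (c$j)\<^sup>2 * Q$k$j) = (\<Sum>j\<in>UNIV. (Q$i$j * c$j) * (Q$k$j * c$j))"
      by (simp add: power2_eq_square mult_ac)
    also have "\<dots> = d$i * d$k * (P ** transpose P) $ i $ k"
      unfolding eq by (simp add: matrix_matrix_mult_def transpose_def sum_distrib_left mult_ac)
    finally show ?thesis
      using P by (simp add: orthogonal_matrix_def mat_def power2_eq_square)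
  qed
  note QQ = this
  have key: "Q$i$k * (c$k)\<^sup>2 = (d$i)\<^sup>2 * Q$i$k" for i k
  proof -
    have "Q$i$k * (c$k)\<^sup>2 = (\<Sum>j\<in>UNIV. Q$i$j * (c$j)\<^sup>2 * (transpose Q ** Q) $ j $ k)"
    proof -
      have "(\<Sum>j\<in>UNIV. Q$i$j * (c$j)\<^sup>2 * (transpose Q ** Q) $ j $ k) = (\<Sum>j\<in>UNIV. if j = k then Q$i$k * (c$k)\<^sup>2 else 0)"
        using Q by (intro sum.cong) (auto simp: orthogonal_matrix_def mat_def)
      then show ?thesis by simp
    qed
    also have "\<dots> = (\<Sum>l\<in>UNIV. (\<Sum>j\<in>UNIV. Q$i$j * (c$j)\<^sup>2 * Q$l$j) * Q$l$k)"
      by (simp add: matrix_matrix_mult_def transpose_def sum_distrib_left sum_distrib_right mult_ac)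
        (rule sum.swap)
    also have "\<dots> = (\<Sum>l\<in>UNIV. if l = i then (d$i)\<^sup>2 * Q$i$k else 0)"
      unfolding QQ by (intro sum.cong) auto
    finally show ?thesis by simp
  qed
  \<comment> \<open>A nonzero entry in row \<open>i\<close> of \<open>Q\<close> shows that the
    \<open>i\<close>-th square of \<open>d\<close> occurs among the squares of
    \<open>c\<close>.\<close>
  have row: "Q$i$1 \<noteq> 0 \<or> Q$i$2 \<noteq> 0 \<or> Q$i$3 \<noteq> 0" for i
  proof (rule ccontr)
    assume "\<not> ?thesis"
    then have "(Q ** transpose Q) $ i $ i = 0"
      by (simp add: matrix_matrix_mult_def sum_3)
    then show False
      using Q by (simp add: orthogonal_matrix_def mat_def)
  qed
  then have mem: "(d$i)\<^sup>2 = (c$1)\<^sup>2 \<or> (d$i)\<^sup>2 = (c$2)\<^sup>2 \<or> (d$i)\<^sup>2 = (c$3)\<^sup>2" for i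
    using key[of i 1] key[of i 2] key[of i 3] row[of i] by auto
  have sq: "y\<^sup>2 < x\<^sup>2" if "\<bar>y\<bar> < x" for x y :: real
    using that by (metis abs_ge_zero power2_abs power_strict_mono zero_less_numeral)
  have lt: "(c$2)\<^sup>2 < (c$1)\<^sup>2" "(c$3)\<^sup>2 < (c$2)\<^sup>2" "(d$2)\<^sup>2 < (d$1)\<^sup>2" "(d$3)\<^sup>2 < (d$2)\<^sup>2"
    using c d by (auto intro!: sq)
  have eqs: "(d$1)\<^sup>2 = (c$1)\<^sup>2" "(d$2)\<^sup>2 = (c$2)\<^sup>2" "(d$3)\<^sup>2 = (c$3)\<^sup>2"
    using mem[of 1] mem[of 2] mem[of 3] lt by linarith+
  then show "c$1 = d$1" "c$2 = d$2"
    using c d by (auto simp: power2_eq_iff)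
  show "Q$i$j = 0" if "i \<noteq> j" for i j
  proof -
    have "(c$j)\<^sup>2 \<noteq> (d$i)\<^sup>2"
      using that lt eqs exhaust_3[of i] exhaust_3[of j] by auto
    then show ?thesis
      using key[of i j] by (simp add: mult.commute)
  qed
qed

text \<open>The Euler-Rodrigues matrix: for unit \<open>q\<close>, the rotation
  \<open>x \<mapsto> q x qconj q\<close> of the imaginary quaternions in the basis
  \<open>i, j, k\<close>.\<close>

definition rotm :: "quat \<Rightarrow> real ^ 3 ^ 3" where
  "rotm q = vector [
     vector [(q$1)\<^sup>2 + (q$2)\<^sup>2 - (q$3)\<^sup>2 - (q$4)\<^sup>2, 2 * (q$2 * q$3 - q$1 * q$4), 2 * (q$2 * q$4 + q$1 * q$3)],
     vector [2 * (q$2 * q$3 + q$1 * q$4), (q$1)\<^sup>2 - (q$2)\<^sup>2 + (q$3)\<^sup>2 - (q$4)\<^sup>2, 2 * (q$3 * q$4 - q$1 * q$2)],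
     vector [2 * (q$2 * q$4 - q$1 * q$3), 2 * (q$3 * q$4 + q$1 * q$2), (q$1)\<^sup>2 - (q$2)\<^sup>2 - (q$3)\<^sup>2 + (q$4)\<^sup>2]]"

lemma kmap_units:
  "fst (kmap q p (quat_i, 0)) = vector [0, rotm q $ 1 $ 1, rotm q $ 2 $ 1, rotm q $ 3 $ 1]"
  "fst (kmap q p (quat_j, 0)) = vector [0, rotm q $ 1 $ 2, rotm q $ 2 $ 2, rotm q $ 3 $ 2]"
  "fst (kmap q p (quat_k, 0)) = vector [0, rotm q $ 1 $ 3, rotm q $ 2 $ 3, rotm q $ 3 $ 3]"
  by (simp_all add: rotm_def quat_eq_iff kmap_nth quat_nth power2_eq_square)

lemma orthogonal_rotm:
  assumes "qunit q"
  shows "orthogonal_matrix (rotm q)"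
proof -
  have "transpose (rotm q) ** rotm q = ((q$1)\<^sup>2 + (q$2)\<^sup>2 + (q$3)\<^sup>2 + (q$4)\<^sup>2)\<^sup>2 *\<^sub>R mat 1"
    by (simp add: vec_eq_iff forall_3 matrix_matrix_mult_def sum_3 transpose_def mat_def rotm_def)
      (intro conjI; algebra)
  then show ?thesis
    using assms by (simp add: orthogonal_matrix qunit_def)
qed

text \<open>Sums and differences of opposite off-diagonal entries show that all products of two
  different coordinates vanish, so a single coordinate is nonzero. The first diagonal entry is
  recorded because it becomes the ratio of \<open>p\<close> to \<open>q\<close>.\<close>

lemma qunit_diagonal_rotm:
  assumes q: "qunit q" and off: "\<And>i j. i \<noteq> j \<Longrightarrow> rotm q $ i $ j = 0"
  obtains e where "e = 1 \<or> e = - 1"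
    "(q, rotm q $ 1 $ 1) \<in> {(e *\<^sub>R quat_1, 1), (e *\<^sub>R quat_i, 1), (e *\<^sub>R quat_j, - 1), (e *\<^sub>R quat_k, - 1)}"
proof -
  have *: "q$2 * q$3 = q$1 * q$4" "q$2 * q$3 = - (q$1 * q$4)" "q$2 * q$4 = - (q$1 * q$3)" "q$2 * q$4 = q$1 * q$3"
     "q$3 * q$4 = q$1 * q$2" "q$3 * q$4 = - (q$1 * q$2)"
    using off[of 1 2] off[of 2 1] off[of 1 3] off[of 3 1] off[of 2 3] off[of 3 2]
    by (simp_all add: rotm_def)
  then have z: "q$2 * q$3 = 0" "q$1 * q$4 = 0" "q$2 * q$4 = 0" "q$1 * q$3 = 0" "q$3 * q$4 = 0" "q$1 * q$2 = 0"
    by linarith+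
  consider "q$2 = 0" "q$3 = 0" "q$4 = 0" | "q$1 = 0" "q$3 = 0" "q$4 = 0" | "q$1 = 0" "q$2 = 0" "q$4 = 0"
     | "q$1 = 0" "q$2 = 0" "q$3 = 0"
    using z by fastforce
  then show ?thesis
  proof cases
    case 1
    then have "q$1 = 1 \<or> q$1 = -1" using q by (simp add: qunit_def power2_eq_1_iff)
    then show ?thesis using that[of "q$1"] 1 by (auto simp: rotm_def quat_eq_iff quat_nth)
  next
    case 2
    then have "q$2 = 1 \<or> q$2 = -1" using q by (simp add: qunit_def power2_eq_1_iff)
    then show ?thesis using that[of "q$2"] 2 by (auto simp: rotm_def quat_eq_iff quat_nth)
  next
    case 3
    then have "q$3 = 1 \<or> q$3 = -1" using q by (simp add: qunit_def power2_eq_1_iff)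
    then show ?thesis using that[of "q$3"] 3 by (auto simp: rotm_def quat_eq_iff quat_nth)
  next
    case 4
    then have "q$4 = 1 \<or> q$4 = -1" using q by (simp add: qunit_def power2_eq_1_iff)
    then show ?thesis using that[of "q$4"] 4 by (auto simp: rotm_def quat_eq_iff quat_nth)
  qed
qed

lemma kmap_tmap_commute':
  assumes "(m, m') \<in> {(quat_1, quat_1), (quat_i, quat_i), (quat_j, - quat_j), (quat_k, - quat_k)}"
  shows "kmap m m' (tmap u v x) = tmap u v (kmap m m' x)"
  using assms by (auto simp: prod_eq_iff quat_eq_iff kmap_nth tmap_nth quat_nth)

text \<open>The quaternion block of both sides has the cosines of the torus angles as signed
  singular values, which are strictly sorted inside the alcove. So the angles agree and
  \<open>q\<close> is a signed unit; the image of \<open>i\<close> then determines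
  \<open>p\<close>.\<close>

lemma tmap_decomposition_unique:
  assumes k: "qunit q" "qunit p" "qunit r" "qunit s"
    and u: "0 < u" "u < v" "u + 2 * v < pi" and u': "0 < u'" "u' < v'" "u' + 2 * v' < pi"
    and eq: "\<And>x. kmap q p (tmap u v x) = tmap u' v' (kmap r s x)"
  obtains m m' e where "u = u'" "v = v'" "e = 1 \<or> e = - 1" "q = e *\<^sub>R m" "p = e *\<^sub>R m'"
    "(m, m') \<in> {(quat_1, quat_1), (quat_i, quat_i), (quat_j, - quat_j), (quat_k, - quat_k)}"
    "kmap r s = kmap m m'"
proof -
  define c d :: "real ^ 3" where "c = vector [cos u, cos v, cos (u + v)]" "d = vector [cos u', cos v', cos (u' + v')]"
  have c: "c$1 = cos u" "c$2 = cos v" "c$3 = cos (u + v)" "d$1 = cos u'" "d$2 = cos v'" "d$3 = cos (u' + v')"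
    by (simp_all add: c_d_def)
  have ord: "cos v < cos u" "\<bar>cos (u + v)\<bar> < cos v" if "0 < u" "u < v" "u + 2 * v < pi" for u v :: real
  proof -
    show "cos v < cos u" using that by (intro cos_monotone_0_pi) auto
    have "cos (u + v) < cos v" using that by (intro cos_monotone_0_pi) auto
    moreover have "cos (pi - v) < cos (u + v)" using that by (intro cos_monotone_0_pi) auto
    ultimately show "\<bar>cos (u + v)\<bar> < cos v" by simp
  qed
  have "\<forall>i j. rotm q $ i $ j * c $ j = d $ i * rotm r $ i $ j"
    using arg_cong[OF eq[of "(quat_i, 0)"], of fst] arg_cong[OF eq[of "(quat_j, 0)"], of fst]
      arg_cong[OF eq[of "(quat_k, 0)"], of fst]
    unfolding forall_3 c
    by (simp add: quat_eq_iff kmap_nth tmap_nth quat_nth rotm_def power2_eq_square algebra_simps)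
  then have e1: "rotm q $ i $ j * c $ j = d $ i * rotm r $ i $ j" for i j
    by blast
  note sv = sorted_singular_values_unique[OF orthogonal_rotm[OF k(1)] orthogonal_rotm[OF k(3)] _ _ _ _ e1,
     unfolded c, OF ord[OF u] ord[OF u']]
  have uv: "u = u'" "v = v'"
    using sv(1,2) u u' cos_inj_pi[of u u'] cos_inj_pi[of v v'] by auto
  have s1: "sin u > 0" "cos u \<noteq> 0"
    using u sin_gt_zero[of u] cos_gt_zero[of u] by auto
  have r11: "rotm r $ 1 $ 1 = rotm q $ 1 $ 1" "rotm r $ 2 $ 1 = 0"
    using e1[of 1 1] e1[of 2 1] sv(3)[of 2 1] s1 ord[OF u] unfolding c uv by auto
  obtain e where e: "e = 1 \<or> e = - 1"
    "(q, rotm q $ 1 $ 1) \<in> {(e *\<^sub>R quat_1, 1), (e *\<^sub>R quat_i, 1), (e *\<^sub>R quat_j, - 1), (e *\<^sub>R quat_k, - 1)}"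
    using qunit_diagonal_rotm[OF k(1) sv(3)] .
  have "(rotm r $ 1 $ 1)\<^sup>2 + (rotm r $ 2 $ 1)\<^sup>2 + (rotm r $ 3 $ 1)\<^sup>2 = (transpose (rotm r) ** rotm r) $ 1 $ 1"
    by (simp add: matrix_matrix_mult_def transpose_def sum_3 power2_eq_square)
  also have "\<dots> = 1"
    using orthogonal_rotm[OF k(3)] by (simp add: orthogonal_matrix_def mat_def)
  finally have r31: "rotm r $ 3 $ 1 = 0"
    unfolding r11 using e by auto
  have "kmap r s (quat_i, 0) = (rotm q $ 1 $ 1 *\<^sub>R quat_i, 0)"
    using kmap_units(1)[of r s] r11 r31 by (simp add: prod_eq_iff quat_eq_iff quat_nth) (simp add: kmap_nth)
  with eq[of "(quat_i, 0)"] have "kmap q p (tmap u v (quat_i, 0)) = tmap u v (rotm q $ 1 $ 1 *\<^sub>R quat_i, 0)"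
    unfolding uv by simp
  moreover have "tmap u v (t *\<^sub>R quat_i, 0) = (t *\<^sub>R cos u *\<^sub>R quat_i, t *\<^sub>R sin u *\<^sub>R quat_1)" for t
    by (simp add: prod_eq_iff quat_eq_iff tmap_nth quat_nth)
  note this[of 1] this[of "rotm q $ 1 $ 1"]
  \<comment> \<open>Comparison of the second components; dividing by \<open>sin u > 0\<close> gives
    \<open>p\<close> as \<open>q\<close> times a sign.\<close>
  ultimately have "sin u *\<^sub>R qmult p (qconj q) = sin u *\<^sub>R (rotm q $ 1 $ 1 *\<^sub>R quat_1)"
    by (simp add: kmap_def mult.commute)
  then have "qmult p (qconj q) = rotm q $ 1 $ 1 *\<^sub>R quat_1"
    using s1(1) by (metis scaleR_cancel_left less_irrefl)
  then have "qmult (qmult p (qconj q)) q = rotm q $ 1 $ 1 *\<^sub>R q" by simp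
  then have p: "p = rotm q $ 1 $ 1 *\<^sub>R q"
    using k by (simp add: qmult_assoc qunit_cancel)
  obtain m m' where m: "q = e *\<^sub>R m" "p = e *\<^sub>R m'"
      "(m, m') \<in> {(quat_1, quat_1), (quat_i, quat_i), (quat_j, - quat_j), (quat_k, - quat_k)}"
    using e p by auto
  have qp: "kmap q p = kmap m m'"
    unfolding m(1,2) using e(1) kmap_uminus[of m m'] by (elim disjE) simp_all
  have "kmap r s x = kmap m m' x" for x
  proof -
    have "tmap u v (kmap m m' x) = tmap u v (kmap r s x)"
      using eq[of x] kmap_tmap_commute'[OF m(3)] by (simp add: qp uv)
    then have "tmap (- u) (- v) (tmap u v (kmap m m' x)) = tmap (- u) (- v) (tmap u v (kmap r s x))"
      by simp
    then show ?thesis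
      by (simp add: tmap_add)
  qed
  then show ?thesis
    using that[OF uv e(1) m] by blast
qed

text \<open>The quotient \<open>(a, b)\<close> acts trivially. Fixing \<open>i, j, k\<close> forces
  \<open>a\<close> to be a sign, and fixing \<open>(0, 1)\<close> forces
  \<open>b = a\<close>.\<close>

lemma kmap_inject:
  assumes k: "qunit q" "qunit p" "qunit q'" "qunit p'" and eq: "kmap q p = kmap q' p'"
  obtains e where "e = 1 \<or> e = - 1" "q = e *\<^sub>R q'" "p = e *\<^sub>R p'"
proof -
  define a b where "a = qmult (qconj q') q" "b = qmult (qconj p') p"
  have ab: "qunit a" "qunit b" using k by (simp_all add: a_b_def qunit_qmult)
  have id: "kmap a b x = x" for x
  proof -
    have "kmap a b x = kmap (qconj q') (qconj p') (kmap q p x)"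
      by (simp add: a_b_def kmap_comp)
    also have "\<dots> = x"
      unfolding eq using k kmap_inverse(2)[of q' p'] by simp
    finally show ?thesis .
  qed
  have off: "rotm a $ i $ j = (if i = j then 1 else 0)" for i j
  proof -
    have "\<forall>i j. rotm a $ i $ j = (if i = j then 1 else 0)"
      using kmap_units[of a b] unfolding id forall_3 by (simp add: quat_eq_iff quat_nth)
    then show ?thesis by blast
  qed
  then obtain e where e: "e = 1 \<or> e = - 1" "a = e *\<^sub>R quat_1"
  proof -
    obtain e where "e = 1 \<or> e = - 1"
      "(a, rotm a $ 1 $ 1) \<in> {(e *\<^sub>R quat_1, 1), (e *\<^sub>R quat_i, 1), (e *\<^sub>R quat_j, - 1), (e *\<^sub>R quat_k, - 1)}"
      using qunit_diagonal_rotm[OF ab(1)] off by metis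
    moreover have "rotm a $ 1 $ 1 = 1" "rotm a $ 2 $ 2 = 1" using off by auto
    ultimately show thesis
      using that by (auto simp: rotm_def quat_nth)
  qed
  have "kmap a b (0, quat_1) = (0, quat_1)" by (rule id)
  then have "qmult b (qconj a) = quat_1" by (simp add: kmap_def)
  then have "qmult (qmult b (qconj a)) a = a" by simp
  then have "b = a" using ab by (simp add: qmult_assoc qunit_cancel)
  have "q = qmult q' a" "p = qmult p' b"
    using k by (simp_all add: a_b_def qunit_cancel)
  then show ?thesis
    using that[OF e(1)] \<open>b = a\<close> e(2) by simp
qed

text \<open>Conjugation by \<open>w\<close> reduces this to \<open>tmap\<close>. The cases of
  \<open>j\<close> and \<open>k\<close> are merged, since only the vanishing of two coordinates of
  \<open>m'\<close> is used to exclude them.\<close>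

lemma amap_decomposition_unique:
  assumes k: "qunit q" "qunit p" "qunit r" "qunit s" "qunit q'" "qunit p'" "qunit r'" "qunit s'"
    and x: "0 < x" "3 * x < y" "y < pi / 2" and x': "0 < x'" "3 * x' < y'" "y' < pi / 2"
    and eq: "kmap q p \<circ> amap x y \<circ> kmap r s = kmap q' p' \<circ> amap x' y' \<circ> kmap r' s'"
  obtains m m' e where "x = x'" "y = y'" "e = 1 \<or> e = - 1" "q = e *\<^sub>R qmult q' m" "p = e *\<^sub>R qmult p' m'"
    "m = quat_1 \<and> m' = quat_1 \<and> kmap r s = kmap r' s' \<or> m = quat_i \<and> m' = quat_i \<or>
     qunit m' \<and> m'$1 = 0 \<and> m'$2 = 0"
proof -
  define w where "w = qi (pi / 8)"
  have w: "qunit w" "qi (- pi / 8) = qconj w" by (simp_all add: w_def)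
  define a b c d where abcd: "a = qmult (qconj w) (qmult (qconj q') (qmult q w))"
    "b = qmult (qconj w) (qmult (qconj p') (qmult p w))"
    "c = qmult (qconj w) (qmult r' (qmult (qconj r) w))"
    "d = qmult (qconj w) (qmult s' (qmult (qconj s) w))"
  have units: "qunit a" "qunit b" "qunit c" "qunit d"
    using k w by (simp_all add: abcd qunit_qmult)
  have "kmap a b (tmap (2 * x) (y - x) z) = tmap (2 * x') (y' - x') (kmap c d z)" for z
  proof -
    have "kmap a b (tmap (2 * x) (y - x) z) =
      kmap (qmult (qconj w) (qconj q')) (qmult (qconj w) (qconj p'))
       ((kmap q p \<circ> amap x y \<circ> kmap r s) (kmap (qmult (qconj r) w) (qmult (qconj s) w) z))"
      unfolding amap_def w w_def[symmetric] comp_def kmap_comp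
      using k w by (simp add: abcd qmult_assoc qunit_cancel)
    also have "\<dots> = tmap (2 * x') (y' - x') (kmap c d z)"
      unfolding eq unfolding amap_def w w_def[symmetric] comp_def kmap_comp
      using k w by (simp add: abcd qmult_assoc qunit_cancel)
    finally show ?thesis .
  qed
  note k_eq = this
  have xy: "0 < 2 * x" "2 * x < y - x" "2 * x + 2 * (y - x) < pi"
     "0 < 2 * x'" "2 * x' < y' - x'" "2 * x' + 2 * (y' - x') < pi"
    using x x' by simp_all
  obtain n n' e where n: "2 * x = 2 * x'" "y - x = y' - x'" "e = 1 \<or> e = - 1" "a = e *\<^sub>R n" "b = e *\<^sub>R n'"
    "(n, n') \<in> {(quat_1, quat_1), (quat_i, quat_i), (quat_j, - quat_j), (quat_k, - quat_k)}"
    "kmap c d = kmap n n'"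
    using tmap_decomposition_unique[OF units xy k_eq] .
  define m m' where m: "m = qmult w (qmult n (qconj w))" "m' = qmult w (qmult n' (qconj w))"
  have "q = qmult q' (qmult w (qmult a (qconj w)))" "p = qmult p' (qmult w (qmult b (qconj w)))"
    using k w by (simp_all add: abcd qmult_assoc qunit_cancel)
  then have qp: "q = e *\<^sub>R qmult q' m" "p = e *\<^sub>R qmult p' m'"
    by (simp_all add: n m)
  have "kmap r s = kmap r' s'" if "n = quat_1" "n' = quat_1"
  proof
    fix z
    have "kmap r' s' z = kmap w w (kmap c d (kmap (qmult (qconj w) r) (qmult (qconj w) s) z))"
      unfolding kmap_comp using k w by (simp add: abcd qmult_assoc qunit_cancel)
    also have "\<dots> = kmap r s z"
      unfolding n(7) that using w by (simp add: kmap_comp qunit_cancel)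
    finally show "kmap r s z = kmap r' s' z" ..
  qed
  moreover have "qmult w (qmult quat_i (qconj w)) = quat_i"
    by (simp add: w_def quat_eq_iff quat_nth qijk_nth algebra_simps sqr_sin)
  moreover have "qmult w (qmult quat_j (qconj w)) $ 1 = 0" "qmult w (qmult quat_j (qconj w)) $ 2 = 0"
    "qmult w (qmult quat_k (qconj w)) $ 1 = 0" "qmult w (qmult quat_k (qconj w)) $ 2 = 0"
    by (simp_all add: w_def quat_nth qijk_nth)
  moreover have "qunit m'"
    using n(6) w by (auto simp: m qunit_qmult)
  ultimately have "m = quat_1 \<and> m' = quat_1 \<and> kmap r s = kmap r' s' \<or> m = quat_i \<and> m' = quat_i \<or>
     qunit m' \<and> m'$1 = 0 \<and> m'$2 = 0"
    using n(6) w by (auto simp: m qunit_cancel)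
  then show ?thesis
    using that[OF _ _ n(3) qp] n(1,2) by simp
qed

section \<open>Injectivity\<close>

text \<open>The radii determine \<open>y\<close>. The angles \<open>x + z\<close> and
  \<open>z - x\<close> are determined modulo \<open>2 * pi\<close> up to a common shift by 0 or
  \<open>pi\<close>, so \<open>x\<close> and \<open>z\<close> are known modulo \<open>pi\<close>,
  with a parity that records the sign.\<close>

lemma euler_angles_unique:
  fixes x y z x' y' z' e :: real
  assumes y: "0 < y" "y < pi / 2" "0 < y'" "y' < pi / 2" and e: "e = 1 \<or> e = - 1"
    and eq: "cos y * cos (x + z) = e * (cos y' * cos (x' + z'))" "cos y * sin (x + z) = e * (cos y' * sin (x' + z'))"
      "sin y * cos (z - x) = e * (sin y' * cos (z' - x'))" "sin y * sin (z - x) = e * (sin y' * sin (z' - x'))"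
  obtains k l :: int where "y = y'" "z = z' + pi * k" "x = x' + pi * l" "e = 1 \<longleftrightarrow> even (k + l)"
proof -
  have pos: "cos y > 0" "cos y' > 0" "sin y > 0" "sin y' > 0"
    using y by (auto intro: cos_gt_zero sin_gt_zero2)
  have e2: "e\<^sup>2 = 1" using e by auto
  have "(cos y)\<^sup>2 * ((sin (x + z))\<^sup>2 + (cos (x + z))\<^sup>2) = (cos y')\<^sup>2 * ((sin (x' + z'))\<^sup>2 + (cos (x' + z'))\<^sup>2)"
    using arg_cong2[OF eq(1) eq(2), of "\<lambda>a b. a\<^sup>2 + b\<^sup>2"] e2 by (simp only: power_mult_distrib) (simp add: cos_squared_eq[of "x + z"] cos_squared_eq[of "x' + z'"] algebra_simps)
  then have "cos y = cos y'"
    using pos by (simp add: power2_eq_iff_nonneg)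
  then have yy: "y = y'"
    using y cos_inj_pi[of y y'] by simp
  have cs: "cos (x + z) = e * cos (x' + z')" "sin (x + z) = e * sin (x' + z')"
      "cos (z - x) = e * cos (z' - x')" "sin (z - x) = e * sin (z' - x')"
    using eq pos unfolding yy by (simp_all add: field_simps)
  \<comment> \<open>The sign \<open>e\<close> is rewritten as a phase shift.\<close>
  define f where "f = (if e = 1 then 0 else pi)"
  have f: "e * cos t = cos (t + f)" "e * sin t = sin (t + f)" for t
    using e by (auto simp: f_def)
  have "sin (x + z) = sin (x' + z' + f) \<and> cos (x + z) = cos (x' + z' + f)"
    using cs by (simp add: f)
  then obtain i :: int where i: "x + z = x' + z' + f + 2 * pi * i"
    using sin_cos_eq_iff by blast
  have "sin (z - x) = sin (z' - x' + f) \<and> cos (z - x) = cos (z' - x' + f)"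
    using cs by (simp add: f)
  then obtain j :: int where j: "z - x = z' - x' + f + 2 * pi * j"
    using sin_cos_eq_iff by blast
  have "2 * z = (x + z) + (z - x)" "2 * x = (x + z) - (z - x)" by simp_all
  then have zx: "z = z' + f + pi * i + pi * j" "x = x' + pi * i - pi * j"
    using i j by (simp_all add: algebra_simps)
  show ?thesis
  proof (cases "e = 1")
    case True
    then have "z = z' + pi * (i + j)" "x = x' + pi * (i - j)"
      by (simp_all add: zx f_def algebra_simps)
    then show ?thesis
      using that[of "i + j" "i - j", OF yy] True by simp
  next
    case False
    then have "z = z' + pi * (i + j + 1)" "x = x' + pi * (i - j)"
      by (simp_all add: zx f_def algebra_simps)
    then show ?thesis
      using that[of "i + j + 1" "i - j", OF yy] False by simp
  qed
qed

text \<open>An automorphism fixes 1, so its values on imaginary octonions determine it.\<close>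

lemma represents_inject:
  assumes f: "octonion_automorphism f" "octonion_automorphism g" and M: "represents M f" "represents M g"
  shows "f = g"
proof
  fix x :: octonion
  have lin: "linear f" "linear g" using f by (auto simp: octonion_automorphism_def)
  define y where "y = x - fst x $ 1 *\<^sub>R (quat_1, 0)"
  have "fst y $ 1 = 0" by (simp add: y_def quat_nth)
  then obtain v where v: "y = im_octonion v" using imaginary_iff by blast
  have x: "x = fst x $ 1 *\<^sub>R (quat_1, 0) + im_octonion v"
    by (simp add: y_def flip: v)
  have "h x = fst x $ 1 *\<^sub>R (quat_1, 0) + im_octonion (M *v v)" if "octonion_automorphism h" "represents M h" for h
  proof -
    have h: "linear h" using that by (simp add: octonion_automorphism_def)
    have "h x = fst x $ 1 *\<^sub>R h (quat_1, 0) + h (im_octonion v)"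
      by (subst x) (simp only: linear_add[OF h] linear_scale[OF h])
    then show ?thesis
      using that by (simp add: octonion_automorphism_one represents_def)
  qed
  then show "f x = g x" using f M by metis
qed

section \<open>Injectivity on the open parameter region\<close>

lemma forall_14: "(\<forall>i::14. P i) \<longleftrightarrow> P 1 \<and> P 2 \<and> P 3 \<and> P 4 \<and> P 5 \<and> P 6 \<and> P 7 \<and>
  P 8 \<and> P 9 \<and> P 10 \<and> P 11 \<and> P 12 \<and> P 13 \<and> P 14"
proof -
  have "card {1, 2, 3, 4, 5, 6, 7, 8, 9, 10, 11, 12, 13, 14 :: 14} = CARD(14)" by simp
  then have "(UNIV :: 14 set) = {1, 2, 3, 4, 5, 6, 7, 8, 9, 10, 11, 12, 13, 14}"
    by (metis card_subset_eq finite_class.finite_UNIV subset_UNIV)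
  then have "(\<forall>i::14. P i) \<longleftrightarrow> (\<forall>i\<in>{1, 2, 3, 4, 5, 6, 7, 8, 9, 10, 11, 12, 13, 14}. P i)"
    by (metis UNIV_I)
  then show ?thesis by auto
qed

definition euler_interior :: "(real ^ 14) set" where
  "euler_interior = {a.
     0 < a$1 \<and> a$1 < pi \<and> 0 < a$2 \<and> a$2 < pi / 2 \<and> 0 < a$3 \<and> a$3 < pi / 2 \<and>
     0 < a$4 \<and> a$4 < 2 * pi \<and> 0 < a$5 \<and> a$5 < pi / 4 \<and> 0 < a$6 \<and> a$6 < pi \<and>
     0 < a$7 \<and> a$7 < pi / 6 \<and> 3 * a$7 < a$8 \<and> a$8 < pi / 2 \<and>
     0 < a$9 \<and> a$9 < 2 * pi \<and> 0 < a$10 \<and> a$10 < pi / 2 \<and> 0 < a$11 \<and> a$11 < pi \<and>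
     0 < a$12 \<and> a$12 < pi \<and> 0 < a$13 \<and> a$13 < pi / 2 \<and> 0 < a$14 \<and> a$14 < pi}"

lemma icomp_flip:
  assumes "qunit m" "m$1 = 0" "m$2 = 0"
  shows "icomp (qmult p m) = - icomp p"
proof -
  have "icomp (qmult p m) = - icomp p * ((m$3)\<^sup>2 + (m$4)\<^sup>2)"
    using assms(2,3) by (simp add: icomp_def quat_nth power2_eq_square algebra_simps)
  then show ?thesis using assms by (simp add: qunit_def)
qed

lemma pi_multiple_small:
  fixes k :: int
  assumes "\<bar>pi * k\<bar> < pi * real n"
  shows "\<bar>k\<bar> < int n"
proof -
  have "pi * \<bar>real_of_int k\<bar> < pi * real n"
    using assms by (simp add: abs_mult)
  then have "\<bar>real_of_int k\<bar> < real n" by simp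
  then show ?thesis by linarith
qed

lemma qQ_unique:
  assumes y: "0 < y" "y < pi / 2" "0 < y'" "y' < pi / 2" and e: "e = 1 \<or> e = - 1"
    and eq: "qQ x y z = e *\<^sub>R qQ x' y' z'"
  obtains k l :: int where "y = y'" "z = z' + pi * k" "x = x' + pi * l" "e = 1 \<longleftrightarrow> even (k + l)"
proof -
  have "cos y * cos (x + z) = e * (cos y' * cos (x' + z'))" "cos y * sin (x + z) = e * (cos y' * sin (x' + z'))"
      "sin y * cos (z - x) = e * (sin y' * cos (z' - x'))" "sin y * sin (z - x) = e * (sin y' * sin (z' - x'))"
    using eq unfolding quat_eq_iff vector_scaleR_component qQ_nth real_scaleR_def by blast+
  from euler_angles_unique[OF y e this] that show ?thesis by blast
qed

text \<open>The range of \<open>z\<close> forces \<open>k = 0\<close> and that of \<open>x\<close>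
  leaves \<open>l\<close> in \<open>{-1, 0, 1}\<close>; parity then excludes the odd values.\<close>

lemma qP_unique:
  assumes "0 < x" "x < 2 * pi" "0 < y" "y < pi / 2" "0 < z" "z < pi"
    and "0 < x'" "x' < 2 * pi" "0 < y'" "y' < pi / 2" "0 < z'" "z' < pi"
    and eq: "qP x y z = qP x' y' z'"
  shows "x = x'" "y = y'" "z = z'"
proof -
  have "cos y * cos (x + z) = 1 * (cos y' * cos (x' + z'))" "cos y * sin (x + z) = 1 * (cos y' * sin (x' + z'))"
      "sin y * cos (z - x) = 1 * (sin y' * cos (z' - x'))" "sin y * sin (z - x) = 1 * (sin y' * sin (z' - x'))"
    using eq unfolding quat_eq_iff qP_nth by simp_all
  from euler_angles_unique[OF _ _ _ _ _ this]
  obtain k l :: int where kl: "y = y'" "z = z' + pi * k" "x = x' + pi * l" "even (k + l)"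
    using assms by metis
  have "\<bar>k\<bar> < int 1" "\<bar>l\<bar> < int 2"
    using kl assms by (intro pi_multiple_small; simp)+
  then have "k = 0" by simp
  with kl(4) \<open>\<bar>l\<bar> < int 2\<close> have "l = 0" by (auto elim!: evenE)
  then show "x = x'" "y = y'" "z = z'"
    using kl \<open>k = 0\<close> by simp_all
qed

text \<open>Both ranges are shorter than \<open>pi\<close>, so both multiples of \<open>pi\<close>
  vanish, and parity yields the sign as well.\<close>

lemma qQ_unique_small:
  assumes "0 < x" "x < pi" "0 < y" "y < pi / 2" "0 < z" "z < pi"
    and "0 < x'" "x' < pi" "0 < y'" "y' < pi / 2" "0 < z'" "z' < pi"
    and e: "e = 1 \<or> e = - 1" and eq: "qQ x y z = e *\<^sub>R qQ x' y' z'"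
  shows "x = x'" "y = y'" "z = z'" "e = 1"
proof -
  obtain k l :: int where kl: "y = y'" "z = z' + pi * k" "x = x' + pi * l" "e = 1 \<longleftrightarrow> even (k + l)"
    using qQ_unique[OF _ _ _ _ e eq] assms by metis
  have "\<bar>k\<bar> < int 1" "\<bar>l\<bar> < int 1"
    using kl assms by (intro pi_multiple_small; simp)+
  then have "k = 0" "l = 0" by simp_all
  then show "x = x'" "y = y'" "z = z'" "e = 1"
    using kl by simp_all
qed

text \<open>Of the centraliser alternatives, the \<open>j\<close>-type would flip the sign of
  \<open>icomp\<close>, which is positive as \<open>a$5 < pi / 4\<close>; \<open>quat_i\<close>
  would shift \<open>a$3\<close> by \<open>pi / 2\<close> modulo \<open>pi\<close>, impossible in an
  open interval of length \<open>pi / 2\<close>. For the identity, uniqueness of Euler angles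
  applies on both sides.\<close>

lemma euler_map_inj: "inj_on euler_map euler_interior"
proof (rule inj_onI)
  fix a b
  assume ab: "a \<in> euler_interior" "b \<in> euler_interior" and eq: "euler_map a = euler_map b"
  note a = ab(1)[unfolded euler_interior_def mem_Collect_eq]
  note b = ab(2)[unfolded euler_interior_def mem_Collect_eq]
  let ?f = "\<lambda>a::real^14. kmap (qQ (a$1) (a$2) (a$3)) (qP (a$4) (a$5) (a$6)) \<circ> amap (a$7) (a$8) \<circ>
      kmap (qQ (a$12) (a$13) (a$14)) (qP (a$9) (a$10) (a$11))"
  have aut: "octonion_automorphism (?f a)" for a
    by (intro octonion_automorphism_comp octonion_automorphism_amap octonion_automorphism_kmap qunit_qQ qunit_qP)
  have f: "?f a = ?f b"
    by (rule represents_inject[OF aut aut represents_euler_map[of a]]) (simp only: eq represents_euler_map)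
  have ranges: "0 < a$7" "3 * a$7 < a$8" "a$8 < pi / 2" "0 < b$7" "3 * b$7 < b$8" "b$8 < pi / 2"
    using a b by blast+
  obtain m m' e where m: "a$7 = b$7" "a$8 = b$8" "e = 1 \<or> e = - 1"
    "qQ (a$1) (a$2) (a$3) = e *\<^sub>R qmult (qQ (b$1) (b$2) (b$3)) m"
    "qP (a$4) (a$5) (a$6) = e *\<^sub>R qmult (qP (b$4) (b$5) (b$6)) m'"
    "m = quat_1 \<and> m' = quat_1 \<and> kmap (qQ (a$12) (a$13) (a$14)) (qP (a$9) (a$10) (a$11)) =
         kmap (qQ (b$12) (b$13) (b$14)) (qP (b$9) (b$10) (b$11)) \<or>
     m = quat_i \<and> m' = quat_i \<or> qunit m' \<and> m'$1 = 0 \<and> m'$2 = 0"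
    using amap_decomposition_unique[OF qunit_qQ qunit_qP qunit_qQ qunit_qP qunit_qQ qunit_qP qunit_qQ qunit_qP ranges f] .
  have pos: "0 < cos (2 * a$5)" "0 < cos (2 * b$5)"
    using a b by (auto intro!: cos_gt_zero)
  have "icomp (qP (a$4) (a$5) (a$6)) = icomp (qmult (qP (b$4) (b$5) (b$6)) m')"
    unfolding m(5) using m(3) by auto
  then have "\<not> (qunit m' \<and> m'$1 = 0 \<and> m'$2 = 0)"
    using icomp_flip[of m' "qP (b$4) (b$5) (b$6)"] pos by (auto simp: icomp_qP)
  moreover have "\<not> (m = quat_i \<and> m' = quat_i)"
  proof
    assume "m = quat_i \<and> m' = quat_i"
    moreover have "qmult (qQ x y z) quat_i = qQ x y (z + pi / 2)" for x y z
    proof -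
      have *: "x + (z + pi / 2) = (x + z) + pi / 2" "z + pi / 2 - x = (z - x) + pi / 2"
        by simp_all
      show ?thesis
        unfolding quat_eq_iff qQ_nth * cos_add[of _ "pi / 2"] sin_add[of _ "pi / 2"] by (simp add: quat_nth qQ_nth)
    qed
    ultimately have "qQ (a$1) (a$2) (a$3) = e *\<^sub>R qQ (b$1) (b$2) (b$3 + pi / 2)"
      using m(4) by simp
    then obtain k :: int where k: "a$3 = b$3 + pi / 2 + pi * k"
      using qQ_unique[OF _ _ _ _ m(3)] a b by metis
    then have "- 1 * pi < pi * k" "pi * k < pi * 0"
      using k a b by simp_all
    then have "- 1 < real_of_int k" "real_of_int k < 0"
      using mult_less_cancel_left_pos[OF pi_gt_zero, of "-1" k] mult_less_cancel_left_pos[OF pi_gt_zero, of k 0] by auto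
    then have "- 1 < k" "k < 0" by linarith+
    then show False by simp
  qed
  ultimately have m1: "m = quat_1" "m' = quat_1" and r: "kmap (qQ (a$12) (a$13) (a$14)) (qP (a$9) (a$10) (a$11)) =
         kmap (qQ (b$12) (b$13) (b$14)) (qP (b$9) (b$10) (b$11))"
    using m(6) by blast+
  have "qQ (a$1) (a$2) (a$3) = e *\<^sub>R qQ (b$1) (b$2) (b$3)"
    using m(4) m1 by simp
  from qQ_unique_small[OF _ _ _ _ _ _ _ _ _ _ _ _ m(3) this]
  have 1: "a$1 = b$1" "a$2 = b$2" "a$3 = b$3" "e = 1"
    using a b by auto
  have "qP (a$4) (a$5) (a$6) = qP (b$4) (b$5) (b$6)"
    using m(5) m1 1(4) by simp
  from qP_unique[OF _ _ _ _ _ _ _ _ _ _ _ _ this]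
  have 2: "a$4 = b$4" "a$5 = b$5" "a$6 = b$6"
    using a b by auto
  obtain h where h: "h = 1 \<or> h = - 1" "qQ (a$12) (a$13) (a$14) = h *\<^sub>R qQ (b$12) (b$13) (b$14)"
     "qP (a$9) (a$10) (a$11) = h *\<^sub>R qP (b$9) (b$10) (b$11)"
    using kmap_inject[OF qunit_qQ qunit_qP qunit_qQ qunit_qP r] .
  from qQ_unique_small[OF _ _ _ _ _ _ _ _ _ _ _ _ h(1,2)]
  have 3: "a$12 = b$12" "a$13 = b$13" "a$14 = b$14" "h = 1"
    using a b by auto
  have "qP (a$9) (a$10) (a$11) = qP (b$9) (b$10) (b$11)"
    using h(3) 3(4) by simp
  from qP_unique[OF _ _ _ _ _ _ _ _ _ _ _ _ this]
  have 4: "a$9 = b$9" "a$10 = b$10" "a$11 = b$11"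
    using a b by auto
  show "a = b"
    using 1 2 3 4 m(1,2) by (simp add: vec_eq_iff forall_14)
qed

section \<open>Strict differentiability\<close>

text \<open>Unlike differentiability at \<open>0\<close>, this makes a map with an injective derivative bi-Lipschitz
  near \<open>0\<close>.\<close>

definition strict_deriv :: "('a::euclidean_space \<Rightarrow> 'b::euclidean_space) \<Rightarrow> ('a \<Rightarrow> 'b) \<Rightarrow> bool" where
  "strict_deriv f L \<longleftrightarrow> linear L \<and> isCont f 0 \<and>
     Zfun (\<lambda>(s, t). (f s - f t - L (s - t)) /\<^sub>R norm (s - t)) (nhds (0, 0))"

lemma bounded_bilinear_matrix_mult:
  "bounded_bilinear ((**) :: real ^ 'n ^ 'm \<Rightarrow> real ^ 'p ^ 'n \<Rightarrow> real ^ 'p ^ 'm)"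
proof -
  have "bilinear ((**) :: real ^ 'n ^ 'm \<Rightarrow> real ^ 'p ^ 'n \<Rightarrow> real ^ 'p ^ 'm)"
    unfolding bilinear_def
    by (auto intro!: linearI simp: vec_eq_iff matrix_matrix_mult_def sum.distrib sum_distrib_left algebra_simps)
  then show ?thesis
    using bilinear_conv_bounded_bilinear by blast
qed

interpretation matrix_mult: bounded_bilinear "(**) :: real ^ 'n ^ 'm \<Rightarrow> real ^ 'p ^ 'n \<Rightarrow> real ^ 'p ^ 'm"
  by (rule bounded_bilinear_matrix_mult)

lemma tendsto_imp_Bfun:
  fixes f :: "'a \<Rightarrow> 'b::real_normed_vector"
  assumes "(f \<longlongrightarrow> l) F"
  shows "Bfun f F"
proof (rule BfunI)
  have "eventually (\<lambda>x. dist (f x) l < 1) F"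
    using assms by (rule tendstoD) simp
  then show "eventually (\<lambda>x. norm (f x) \<le> norm l + 1) F"
    by (rule eventually_mono) (metis dist_norm add.commute less_imp_le norm_triangle_sub add_left_mono order_trans)
qed

lemma strict_deriv_const: "strict_deriv (\<lambda>t. c) (\<lambda>h. 0)"
  by (simp add: strict_deriv_def Zfun_zero split_def linear_zero)

lemma strict_deriv_matrix_mult:
  fixes f g :: "'a::euclidean_space \<Rightarrow> real ^ 'n ^ 'n"
  assumes f: "strict_deriv f L" and g: "strict_deriv g M"
  shows "strict_deriv (\<lambda>t. f t ** g t) (\<lambda>h. L h ** g 0 + f 0 ** M h)"
  unfolding strict_deriv_def
proof (intro conjI)
  let ?F = "nhds (0 :: 'a \<times> 'a)"
  have lin: "linear L" "linear M" and cont: "isCont f 0" "isCont g 0"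
    using f g by (auto simp: strict_deriv_def)
  show "linear (\<lambda>h. L h ** g 0 + f 0 ** M h)"
    by (rule linearI)
      (simp_all add: linear_add[OF lin(1)] linear_add[OF lin(2)] linear_scale[OF lin(1)] linear_scale[OF lin(2)]
        matrix_mult.add_left matrix_mult.add_right matrix_mult.scaleR_left matrix_mult.scaleR_right algebra_simps)
  show "isCont (\<lambda>t. f t ** g t) 0"
    using cont by (rule matrix_mult.isCont)
  have lim: "((\<lambda>z. f (fst z)) \<longlongrightarrow> f 0) ?F" "((\<lambda>z. f (snd z)) \<longlongrightarrow> f 0) ?F"
     "((\<lambda>z. g (fst z)) \<longlongrightarrow> g 0) ?F" "((\<lambda>z. g (snd z)) \<longlongrightarrow> g 0) ?F"
    using isCont_tendsto_compose[OF cont(1)] isCont_tendsto_compose[OF cont(2)]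
      tendsto_fst[of "\<lambda>z. z" "0 :: 'a \<times> 'a" ?F] tendsto_snd[of "\<lambda>z. z" "0 :: 'a \<times> 'a" ?F]
    by (auto simp: filterlim_ident)
  have Bf: "Bfun (\<lambda>z. f (snd z)) ?F" "Bfun (\<lambda>z. g (fst z)) ?F"
    using lim(2,3) by (auto intro!: tendsto_imp_Bfun)
  have Z: "Zfun (\<lambda>z. g (fst z) - g 0) ?F" "Zfun (\<lambda>z. f (snd z) - f 0) ?F"
    using lim(2,3) by (simp_all add: tendsto_Zfun_iff)
  have BL: "Bfun (\<lambda>z. K (fst z - snd z) /\<^sub>R norm (fst z - snd z)) ?F" if K: "linear K" for K :: "'a \<Rightarrow> real ^ 'n ^ 'n"
  proof -
    obtain B where "\<And>h. norm (K h) \<le> B * norm h"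
      using linear_bounded[OF K] by blast
    then have "norm (K h /\<^sub>R norm h) \<le> \<bar>B\<bar>" for h
      by (cases "h = 0") (auto simp: divide_simps intro: order_trans[OF _ mult_right_mono[OF abs_ge_self]])
    then show ?thesis
      by (intro BfunI[of _ "\<bar>B\<bar>"] always_eventually) blast
  qed
  let ?qf = "\<lambda>z. (f (fst z) - f (snd z) - L (fst z - snd z)) /\<^sub>R norm (fst z - snd z)"
  let ?qg = "\<lambda>z. (g (fst z) - g (snd z) - M (fst z - snd z)) /\<^sub>R norm (fst z - snd z)"
  have q: "Zfun ?qf ?F" "Zfun ?qg ?F"
    using f g by (simp_all add: strict_deriv_def split_def zero_prod_def)
  \<comment> \<open>The increment of the product is telescoped into four terms, each the product of
    a bounded and a vanishing factor.\<close>
  have "Zfun (\<lambda>z. ?qf z ** g (fst z) + (L (fst z - snd z) /\<^sub>R norm (fst z - snd z)) ** (g (fst z) - g 0) +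
      f (snd z) ** ?qg z + (f (snd z) - f 0) ** (M (fst z - snd z) /\<^sub>R norm (fst z - snd z))) ?F"
    by (intro Zfun_add matrix_mult.Zfun_prod_Bfun matrix_mult.Bfun_prod_Zfun q Bf Z BL lin)
  moreover have "(f s ** g s - f t ** g t - (L (s - t) ** g 0 + f 0 ** M (s - t))) /\<^sub>R norm (s - t) =
     (f s - f t - L (s - t)) /\<^sub>R norm (s - t) ** g s + (L (s - t) /\<^sub>R norm (s - t)) ** (g s - g 0) +
      f t ** ((g s - g t - M (s - t)) /\<^sub>R norm (s - t)) + (f t - f 0) ** (M (s - t) /\<^sub>R norm (s - t))" for s t
    unfolding matrix_mult.scaleR_left matrix_mult.scaleR_right scaleR_add_right[symmetric]
      matrix_mult.diff_left matrix_mult.diff_right by (simp add: algebra_simps)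
  ultimately show "Zfun (\<lambda>(s, t). (f s ** g s - f t ** g t - (L (s - t) ** g 0 + f 0 ** M (s - t))) /\<^sub>R norm (s - t)) (nhds (0, 0))"
    by (simp add: split_def zero_prod_def)
qed

text \<open>Mean value inequality on the interval of radius \<open>r\<close>, where the derivatives
  \<open>- sin z\<close> and \<open>cos z - 1\<close> are bounded by \<open>r\<close>.\<close>

lemma sin_cos_strict:
  assumes "\<bar>x\<bar> < r" "\<bar>y\<bar> < (r::real)"
  shows "\<bar>cos x - cos y\<bar> \<le> r * \<bar>x - y\<bar>" "\<bar>sin x - sin y - (x - y)\<bar> \<le> r * \<bar>x - y\<bar>"
proof -
  let ?S = "ball (0::real) r"
  have xy: "x \<in> ?S" "y \<in> ?S" using assms by auto
  have "norm (cos x - cos y) \<le> r * norm (x - y)"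
  proof (rule field_differentiable_bound[OF convex_ball _ _ xy])
    show "(cos has_field_derivative - sin z) (at z within ?S)" for z
      by (auto intro!: derivative_eq_intros)
    show "norm (- sin z) \<le> r" if "z \<in> ?S" for z :: real
      using that abs_sin_x_le_abs_x[of z] by simp
  qed
  then show "\<bar>cos x - cos y\<bar> \<le> r * \<bar>x - y\<bar>" by simp
  have cos1: "\<bar>cos z - cos 0\<bar> \<le> 1 * \<bar>z - 0\<bar>" for z :: real
  proof -
    have "norm (cos z - cos 0) \<le> 1 * norm (z - 0)"
      by (rule field_differentiable_bound[where S=UNIV and f'="\<lambda>z. - sin z"]) (auto intro!: derivative_eq_intros)
    then show ?thesis by simp
  qed
  have "norm ((sin x - x) - (sin y - y)) \<le> r * norm (x - y)"
  proof (rule field_differentiable_bound[OF convex_ball _ _ xy])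
    show "((\<lambda>z. sin z - z) has_field_derivative cos z - 1) (at z within ?S)" for z
      by (auto intro!: derivative_eq_intros)
    show "norm (cos z - 1) \<le> r" if "z \<in> ?S" for z :: real
      using that cos1[of z] by simp
  qed
  moreover have "(sin x - x) - (sin y - y) = sin x - sin y - (x - y)" by simp
  ultimately show "\<bar>sin x - sin y - (x - y)\<bar> \<le> r * \<bar>x - y\<bar>" by simp
qed

lemma strict_deriv_prot:
  "strict_deriv (\<lambda>t :: real ^ 'n. prot a b (w * t $ i)) (\<lambda>h. (w * h $ i) *\<^sub>R skew_unit b a)"
  unfolding strict_deriv_def
proof (intro conjI)
  let ?F = "nhds (0 :: (real ^ 'n) \<times> (real ^ 'n))"
  show "linear (\<lambda>h :: real ^ 'n. (w * h $ i) *\<^sub>R skew_unit b a)"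
    by (rule linearI) (simp_all add: algebra_simps)
  show "isCont (\<lambda>t :: real ^ 'n. prot a b (w * t $ i)) 0"
    unfolding prot_def by (intro continuous_intros)
  let ?c = "\<lambda>z :: (real ^ 'n) \<times> (real ^ 'n). (cos (w * fst z $ i) - cos (w * snd z $ i)) /\<^sub>R norm (fst z - snd z)"
  let ?s = "\<lambda>z :: (real ^ 'n) \<times> (real ^ 'n). (sin (w * fst z $ i) - sin (w * snd z $ i) - w * (fst z - snd z) $ i) /\<^sub>R norm (fst z - snd z)"
  have "Zfun ?c ?F \<and> Zfun ?s ?F"
  proof -
    have "eventually (\<lambda>z. norm (?c z) < r \<and> norm (?s z) < r) ?F" if "r > 0" for r
    proof -
      \<comment> \<open>\<open>C\<close> bounds the functional \<open>v \<mapsto> w * v $ i\<close>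
        and is positive even for \<open>w = 0\<close>. With \<open>d = r / (2 * C)\<close> the
        quotients are at most \<open>r / 2\<close>, hence strictly below \<open>r\<close>.\<close>
      define C where "C = \<bar>w\<bar> + 1"
      have C: "C > 0" by (simp add: C_def)
      define d where "d = r / (2 * C)"
      have "eventually (\<lambda>z :: (real ^ 'n) \<times> (real ^ 'n). dist z 0 < d / C) ?F"
        using that C by (intro eventually_nhds_metric[THEN iffD2]) (auto simp: d_def intro!: exI[of _ "d / C"])
      then show ?thesis
      proof (rule eventually_mono)
        fix z :: "(real ^ 'n) \<times> (real ^ 'n)"
        assume "dist z 0 < d / C"
        then have "norm (fst z) < d / C" "norm (snd z) < d / C"
          using norm_fst_le[of "fst z" "snd z"] norm_snd_le[of "snd z" "fst z"] by simp_all
        moreover have lin: "\<bar>w * v $ i\<bar> \<le> C * norm v" for v :: "real ^ 'n"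
          using component_le_norm_cart[of v i] C by (simp add: abs_mult C_def mult_mono)
        ultimately have "\<bar>w * fst z $ i\<bar> < d" "\<bar>w * snd z $ i\<bar> < d"
          using C lin[of "fst z"] lin[of "snd z"] by (auto simp: field_simps intro: le_less_trans)
        note sc = sin_cos_strict[OF this]
        have "d * \<bar>w * fst z $ i - w * snd z $ i\<bar> \<le> d * (C * norm (fst z - snd z))"
          using lin[of "fst z - snd z"] that C by (intro mult_left_mono) (auto simp: d_def algebra_simps)
        also have "\<dots> = (r / 2) * norm (fst z - snd z)"
          using C by (simp add: d_def)
        finally have *: "d * \<bar>w * fst z $ i - w * snd z $ i\<bar> \<le> (r / 2) * norm (fst z - snd z)" .
        have quot: "norm (x /\<^sub>R norm h) < r" if "\<bar>x\<bar> \<le> (r / 2) * norm h" for x :: real and h :: "real ^ 'n"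
        proof (cases "h = 0")
          case False
          then have "r * norm h > 0" using \<open>r > 0\<close> by simp
          then have "\<bar>x\<bar> < r * norm h" using that by linarith
          then show ?thesis using False by (simp add: field_simps)
        qed (use \<open>r > 0\<close> in simp)
        show "norm (?c z) < r \<and> norm (?s z) < r"
        proof
          show "norm (?c z) < r" by (rule quot) (rule order_trans[OF sc(1) *])
          show "norm (?s z) < r"
            by (rule quot) (use order_trans[OF sc(2) *] in \<open>simp add: right_diff_distrib\<close>)
        qed
      qed
    qed
    then show ?thesis
      unfolding Zfun_def eventually_conj_iff by blast
  qed
  then have "Zfun (\<lambda>z. ?c z *\<^sub>R (matrix_unit a a + matrix_unit b b)) ?F" "Zfun (\<lambda>z. ?s z *\<^sub>R skew_unit b a) ?F"
    using bounded_linear.Zfun[OF bounded_linear_scaleR_left] by blast+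
  then have "Zfun (\<lambda>z. ?c z *\<^sub>R (matrix_unit a a + matrix_unit b b) + ?s z *\<^sub>R skew_unit b a) ?F"
    by (rule Zfun_add)
  moreover have "(prot a b (w * s $ i) - prot a b (w * t $ i) - (w * (s - t) $ i) *\<^sub>R skew_unit b a) /\<^sub>R norm (s - t)
     = ?c (s, t) *\<^sub>R (matrix_unit a a + matrix_unit b b) + ?s (s, t) *\<^sub>R skew_unit b a" for s t :: "real ^ 'n"
    by (simp add: prot_def algebra_simps)
  ultimately show "Zfun (\<lambda>(s, t). (prot a b (w * s $ i) - prot a b (w * t $ i) - (w * (s - t) $ i) *\<^sub>R skew_unit b a) /\<^sub>R norm (s - t))
    (nhds (0 :: real ^ 'n, 0))"
    by (simp add: split_def zero_prod_def)
qed

text \<open>Composed with a left inverse \<open>P\<close> of \<open>L\<close>, the map differs from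
  the identity by a map of Lipschitz constant \<open>1 / 2\<close> near 0. Moreover \<open>P\<close>
  leads back to the parameter space, so dimensions match.\<close>

lemma strict_deriv_lower_bound:
  fixes f :: "'a::euclidean_space \<Rightarrow> 'b::euclidean_space"
  assumes f: "strict_deriv f L" and "inj L"
  obtains P :: "'b \<Rightarrow> 'a" and d where "linear P" "0 < d"
    "\<And>s t. s \<in> ball 0 d \<Longrightarrow> t \<in> ball 0 d \<Longrightarrow> norm (s - t) \<le> 2 * norm (P (f s) - P (f t))"
proof -
  have L: "linear L" using f by (simp add: strict_deriv_def)
  obtain P where P: "linear P" "P \<circ> L = id"
    using linear_injective_left_inverse[OF L \<open>inj L\<close>] by blast
  obtain B where B: "B > 0" "\<And>h. norm (P h) \<le> B * norm h"
    using linear_bounded_pos[OF P(1)] by blast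
  let ?q = "\<lambda>z. (f (fst z) - f (snd z) - L (fst z - snd z)) /\<^sub>R norm (fst z - snd z)"
  have "Zfun ?q (nhds 0)"
    using f by (simp add: strict_deriv_def split_def zero_prod_def)
  then have "eventually (\<lambda>z. norm (?q z) < 1 / (2 * B)) (nhds 0)"
    by (rule ZfunD) (use B(1) in simp)
  then have "\<exists>e>0. \<forall>z. dist z 0 < e \<longrightarrow> norm (?q z) < 1 / (2 * B)"
    by (simp only: eventually_nhds_metric)
  then obtain e where e: "e > 0" "\<And>z. dist z 0 < e \<Longrightarrow> norm (?q z) < 1 / (2 * B)"
    by blast
  have nq: "norm (x /\<^sub>R norm h) = norm x / norm h" for x :: 'b and h :: 'a
    by (simp add: divide_inverse_commute)
  have "norm (s - t) \<le> 2 * norm (P (f s) - P (f t))" if "s \<in> ball 0 (e / 2)" "t \<in> ball 0 (e / 2)" for s t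
  proof -
    have "norm (s, t) \<le> norm s + norm t"
      using norm_triangle_ineq[of "(s, 0)" "(0, t)"] by simp
    then have "norm ((f s - f t - L (s - t)) /\<^sub>R norm (s - t)) < 1 / (2 * B)"
      using e(2)[of "(s, t)"] that by simp
    then have *: "norm (f s - f t - L (s - t)) / norm (s - t) < 1 / (2 * B)"
      unfolding nq .
    have "norm (f s - f t - L (s - t)) \<le> norm (s - t) / (2 * B)"
    proof (cases "s = t")
      case False
      then have "norm (s - t) > 0" by simp
      then show ?thesis using * by (simp add: pos_divide_less_eq)
    qed (simp add: linear_0[OF L])
    then have "B * norm (f s - f t - L (s - t)) \<le> norm (s - t) / 2"
      using B(1) by (simp add: field_simps)
    then have "norm (P (f s - f t - L (s - t))) \<le> norm (s - t) / 2"
      using B(2)[of "f s - f t - L (s - t)"] by linarith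
    moreover have "P (f s - f t - L (s - t)) = (P (f s) - P (f t)) - (s - t)"
      using P(2) by (simp add: linear_diff[OF P(1)] fun_eq_iff)
    ultimately show ?thesis
      using norm_triangle_ineq2[of "s - t" "P (f s) - P (f t)"] by (simp add: norm_minus_commute)
  qed
  then show ?thesis
    using that[OF P(1), of "e / 2"] e(1) by simp
qed

section \<open>A chart of the group at the identity\<close>

text \<open>The chart and the Euler map are both of this form, so smoothness is proved once, by
  induction on the list.\<close>

fun rotprod :: "(7 \<times> 7 \<times> real \<times> 'n) list \<Rightarrow> real ^ 'n \<Rightarrow> real ^ 7 ^ 7" where
  "rotprod [] t = mat 1"
| "rotprod ((a, b, w, i) # l) t = prot a b (w * t $ i) ** rotprod l t"

text \<open>The derivative of \<open>rotprod\<close> at 0.\<close>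

fun rotsum :: "(7 \<times> 7 \<times> real \<times> 'n) list \<Rightarrow> real ^ 'n \<Rightarrow> real ^ 7 ^ 7" where
  "rotsum [] h = 0"
| "rotsum ((a, b, w, i) # l) h = (w * h $ i) *\<^sub>R skew_unit b a + rotsum l h"

lemma rotprod_append: "rotprod (l @ l') t = rotprod l t ** rotprod l' t"
  by (induction l t rule: rotprod.induct) (simp_all add: matrix_mul_assoc)

lemma rotprod_0: "rotprod l 0 = mat 1"
  by (induction l "0 :: real ^ 'a" rule: rotprod.induct) simp_all

lemma strict_deriv_rotprod:
  fixes l :: "(7 \<times> 7 \<times> real \<times> 'n::finite) list"
  shows "strict_deriv (rotprod l) (rotsum l)"
proof (induction l)
  case Nil
  have "rotprod [] = (\<lambda>t :: real ^ 'n. mat 1)" "rotsum [] = (\<lambda>h :: real ^ 'n. 0)" by auto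
  then show ?case
    by (simp only: strict_deriv_const)
next
  case (Cons x l)
  obtain a b w i where x: "x = (a, b, w, i)" by (metis prod_cases4)
  have "rotprod (x # l) = (\<lambda>t. prot a b (w * t $ i) ** rotprod l t)"
    "rotsum (x # l) = (\<lambda>h. (w * h $ i) *\<^sub>R skew_unit b a ** rotprod l 0 + prot a b (w * 0 $ i) ** rotsum l h)"
    by (simp_all add: x fun_eq_iff rotprod_0)
  then show ?case
    using strict_deriv_matrix_mult[OF strict_deriv_prot Cons.IH, of a b w i] by simp
qed

lemma rotprod_has_derivative:
  fixes l :: "(7 \<times> 7 \<times> real \<times> 'n::finite) list"
  shows "\<exists>f'. (rotprod l has_derivative f') (at t)"
proof (induction l)
  case Nil
  have "rotprod [] = (\<lambda>t :: real ^ 'n. mat 1)" by auto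
  then show ?case
    by (metis has_derivative_const)
next
  case (Cons x l)
  obtain a b w i where x: "x = (a, b, w, i)" by (metis prod_cases4)
  obtain f' where f': "(rotprod l has_derivative f') (at t)" using Cons.IH by blast
  have "((\<lambda>t. prot a b (w * t $ i)) has_derivative
     (\<lambda>h. (- (w * h $ i) * sin (w * t $ i)) *\<^sub>R (matrix_unit a a + matrix_unit b b) + ((w * h $ i) * cos (w * t $ i)) *\<^sub>R skew_unit b a)) (at t)"
    unfolding prot_def by (auto intro!: derivative_eq_intros bounded_linear.has_derivative[OF bounded_linear_vec_nth] simp: algebra_simps)
  from bounded_bilinear.FDERIV[OF bounded_bilinear_matrix_mult this f'] have "\<exists>f'. ((\<lambda>t. prot a b (w * t $ i) ** rotprod l t) has_derivative f') (at t)"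
    by blast
  moreover have "rotprod (x # l) = (\<lambda>t. prot a b (w * t $ i) ** rotprod l t)"
    by (auto simp: x)
  ultimately show ?case by simp
qed

lemma continuous_on_rotprod: "continuous_on S (rotprod l)"
  by (meson rotprod_has_derivative has_derivative_continuous continuous_at_imp_continuous_on)

text \<open>An entry \<open>(a, b, w, i)\<close> rotates the plane of \<open>e\<^sub>a, e\<^sub>b\<close> by \<open>w t\<^sub>i\<close>; each inner list is a one-parameter
  subgroup. The first six generate \<open>K\<close>, the others are conjugates of \<open>tmap t 0\<close> and \<open>tmap 0 t\<close>.\<close>

definition chart_list :: "(7 \<times> 7 \<times> real \<times> 14) list list" where
  "chart_list = [
    [(2, 3, 2, 1), (5, 4, 1, 1), (6, 7, 1, 1)], [(3, 1, 2, 2), (6, 4, 1, 2), (7, 5, 1, 2)],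
    [(1, 2, 2, 3), (7, 4, 1, 3), (5, 6, 1, 3)],
    [(4, 5, 1, 4), (6, 7, 1, 4)], [(6, 4, 1, 5), (5, 7, 1, 5)], [(4, 7, 1, 6), (5, 6, 1, 6)],
    [(1, 4, 1, 7), (6, 3, 1, 7)], [(1, 5, 1, 8), (7, 3, 1, 8)], [(1, 6, 1, 9), (3, 4, 1, 9)],
    [(1, 7, 1, 10), (3, 5, 1, 10)], [(7, 2, 1, 11), (6, 3, 1, 11)], [(2, 6, 1, 12), (7, 3, 1, 12)],
    [(5, 2, 1, 13), (3, 4, 1, 13)], [(2, 4, 1, 14), (3, 5, 1, 14)]]"

lemma G2I: "represents M f \<Longrightarrow> octonion_automorphism f \<Longrightarrow> M \<in> G2"
  by (auto simp: G2_iff)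

lemma octonion_automorphism_tconj: "qunit w \<Longrightarrow> octonion_automorphism (tconj w u v)"
  unfolding tconj_def
  by (intro octonion_automorphism_comp octonion_automorphism_kmap octonion_automorphism_tmap) simp_all

lemma chart_in_G2: "rotprod (concat chart_list) t \<in> G2"
proof -
  have K: "octonion_automorphism (kmap (qi s) quat_1)" "octonion_automorphism (kmap (qj s) quat_1)"
    "octonion_automorphism (kmap (qk s) quat_1)" "octonion_automorphism (kmap quat_1 (qi s))"
    "octonion_automorphism (kmap quat_1 (qj s))" "octonion_automorphism (kmap quat_1 (qk s))" for s
    by (intro octonion_automorphism_kmap; simp)+
  have T: "octonion_automorphism (tconj quat_1 u v)" "octonion_automorphism (tconj quat_i u v)"
    "octonion_automorphism (tconj quat_j u v)" "octonion_automorphism (tconj quat_k u v)" for u v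
    by (intro octonion_automorphism_tconj; simp)+
  have "\<forall>l\<in>set chart_list. rotprod l t \<in> G2"
    unfolding chart_list_def
    by (simp add: matrix_mul_assoc K T
       G2I[OF represents_kmap(1) K(1)] G2I[OF represents_kmap(2) K(2)] G2I[OF represents_kmap(3) K(3)]
       G2I[OF represents_kmap(4) K(4)] G2I[OF represents_kmap(5) K(5)] G2I[OF represents_kmap(6) K(6)]
       G2I[OF represents_tconj(1) T(1)] G2I[OF represents_tconj(2) T(2)] G2I[OF represents_tconj(3) T(3)]
       G2I[OF represents_tconj(4) T(4)] G2I[OF represents_tconj(5) T(1)] G2I[OF represents_tconj(6) T(2)]
       G2I[OF represents_tconj(7) T(3)] G2I[OF represents_tconj(8) T(4)])
  then have "rotprod (concat ls) t \<in> G2" if "set ls \<subseteq> set chart_list" for ls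
    using that by (induction ls) (auto simp: G2_1 rotprod_append G2_mult)
  then show ?thesis by blast
qed

text \<open>The matrix entries are read in an order in which each contains only one coordinate not
  yet known to vanish: the first two columns below the block, then the block, then the rest.\<close>

lemma inj_rotsum_chart: "inj (rotsum (concat chart_list))"
proof -
  have lin: "linear (rotsum (concat chart_list))"
    using strict_deriv_rotprod unfolding strict_deriv_def by blast
  have "h = 0" if h: "rotsum (concat chart_list) h = 0" for h
  proof -
    have ent: "rotsum (concat chart_list) h $ r $ c = 0" for r c
      using h by simp
    note simps = chart_list_def skew_unit_def matrix_unit_def
    have "h$7 = 0" "h$8 = 0" "h$9 = 0" "h$10 = 0"
      using ent[of 4 1] ent[of 5 1] ent[of 6 1] ent[of 7 1] by (simp_all add: simps)
    moreover have "h$11 = 0" "h$12 = 0" "h$13 = 0" "h$14 = 0"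
      using ent[of 7 2] ent[of 6 2] ent[of 5 2] ent[of 4 2] by (simp_all add: simps)
    moreover have "h$1 = 0" "h$2 = 0" "h$3 = 0"
      using ent[of 3 2] ent[of 1 3] ent[of 2 1] by (simp_all add: simps)
    moreover from calculation have "h$4 = 0" "h$5 = 0" "h$6 = 0"
      using ent[of 5 4] ent[of 6 4] ent[of 7 4] by (simp_all add: simps)
    ultimately show ?thesis
      by (simp add: vec_eq_iff forall_14)
  qed
  then show ?thesis
    using linear_injective_0[OF lin] by blast
qed

section \<open>Sets of Haar measure zero\<close>

text \<open>Averaging \<open>\<mu>(\<phi>(t)\<inverse> Z) = \<mu>(Z)\<close> over \<open>t \<in> U\<close> and exchanging the integrals expresses \<open>\<mu>(Z)\<close> by the
  Lebesgue measures of the sets \<open>{t \<in> U. \<phi>(t) x \<in> Z}\<close>.\<close>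

lemma haar_null_set:
  fixes G :: "(real ^ 'n ^ 'n) set" and \<phi> :: "'a::euclidean_space \<Rightarrow> real ^ 'n ^ 'n"
  assumes haar: "haar_measure_on G \<mu>"
    and mult: "\<And>x y. x \<in> G \<Longrightarrow> y \<in> G \<Longrightarrow> x ** y \<in> G"
    and inv: "\<And>x. x \<in> G \<Longrightarrow> \<exists>y\<in>G. y ** x = mat 1 \<and> x ** y = mat 1"
    and Z: "closed Z" "Z \<subseteq> G"
    and \<phi>: "continuous_on UNIV \<phi>" "\<And>t. \<phi> t \<in> G"
    and U: "open U" "U \<noteq> {}"
    and null: "\<And>x. x \<in> G \<Longrightarrow> negligible {t \<in> U. \<phi> t ** x \<in> Z}"
  shows "emeasure \<mu> Z = 0"
proof -
  have sets: "sets \<mu> = sets (restrict_space borel G)" and fin: "finite_measure \<mu>"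
    and left: "\<And>h A. h \<in> G \<Longrightarrow> A \<in> sets \<mu> \<Longrightarrow> emeasure \<mu> ((\<lambda>M. h ** M) ` A) = emeasure \<mu> A"
    using haar by (auto simp: haar_measure_on_def)
  have space: "space \<mu> = G"
    using sets_eq_imp_space_eq[OF sets] by (simp add: space_restrict_space)
  interpret M: finite_measure \<mu> by (rule fin)
  interpret pair_sigma_finite "lborel :: 'a measure" \<mu> ..
  have Zs: "Z \<in> sets \<mu>"
    unfolding sets sets_restrict_space using Z by (auto intro!: image_eqI[of _ _ Z])
  have id: "(\<lambda>x. x) \<in> borel_measurable \<mu>"
    unfolding measurable_cong_sets[OF sets refl] by (intro measurable_restrict_space1) simp
  have "(\<lambda>z. \<phi> (fst z) ** snd z) \<in> borel_measurable (lborel \<Otimes>\<^sub>M \<mu>)"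
  proof (rule borel_measurable_continuous_Pair[where f = "\<lambda>z. \<phi> (fst z)" and g = snd and H = "(**)"])
    show "(\<lambda>z. \<phi> (fst z)) \<in> borel_measurable (lborel \<Otimes>\<^sub>M \<mu>)"
      by (rule measurable_compose[OF measurable_fst]) (simp add: borel_measurable_continuous_onI \<phi>)
    show "snd \<in> borel_measurable ((lborel :: 'a measure) \<Otimes>\<^sub>M \<mu>)"
      by (rule measurable_compose[OF measurable_snd id])
    show "continuous_on UNIV (\<lambda>x :: (real ^ 'n ^ 'n) \<times> (real ^ 'n ^ 'n). fst x ** snd x)"
      by (intro matrix_mult.continuous_on continuous_intros)
  qed
  note \<phi>_meas = this
  define S where "S = {z \<in> space (lborel \<Otimes>\<^sub>M \<mu>). fst z \<in> U \<and> \<phi> (fst z) ** snd z \<in> Z}"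
  have S_eq: "S = (fst -` U \<inter> space (lborel \<Otimes>\<^sub>M \<mu>)) \<inter> ((\<lambda>z. \<phi> (fst z) ** snd z) -` Z \<inter> space (lborel \<Otimes>\<^sub>M \<mu>))"
    by (auto simp: S_def)
  have S: "S \<in> sets (lborel \<Otimes>\<^sub>M \<mu>)"
    unfolding S_eq
  proof (rule sets.Int)
    show "fst -` U \<inter> space (lborel \<Otimes>\<^sub>M \<mu>) \<in> sets (lborel \<Otimes>\<^sub>M \<mu>)"
      by (rule measurable_sets[OF measurable_fst]) (simp add: U(1))
    show "(\<lambda>z. \<phi> (fst z) ** snd z) -` Z \<inter> space (lborel \<Otimes>\<^sub>M \<mu>) \<in> sets (lborel \<Otimes>\<^sub>M \<mu>)"
      by (rule measurable_sets[OF \<phi>_meas]) (simp add: Z(1))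
  qed
  \<comment> \<open>The slice over \<open>t \<in> U\<close> is the translate of \<open>Z\<close> by
    the inverse of \<open>\<phi> t\<close>, so left invariance applies.\<close>
  have sec1: "emeasure \<mu> (Pair t -` S) = emeasure \<mu> Z * indicator U t" for t
  proof (cases "t \<in> U")
    case True
    obtain h where h: "h \<in> G" "h ** \<phi> t = mat 1" "\<phi> t ** h = mat 1"
      using inv \<phi>(2) by blast
    have "Pair t -` S = (\<lambda>M. h ** M) ` Z"
    proof (intro equalityI subsetI)
      fix x assume "x \<in> Pair t -` S"
      then have x: "x \<in> G" "\<phi> t ** x \<in> Z"
        by (auto simp: S_def space_pair_measure space)
      have "x = h ** (\<phi> t ** x)"
        by (simp add: matrix_mul_assoc h)
      with x show "x \<in> (\<lambda>M. h ** M) ` Z" by blast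
    next
      fix x assume "x \<in> (\<lambda>M. h ** M) ` Z"
      then obtain z where z: "z \<in> Z" "x = h ** z" by blast
      then have "\<phi> t ** x = z"
        by (simp add: matrix_mul_assoc h)
      then show "x \<in> Pair t -` S"
        using z True mult h(1) Z(2) by (auto simp: S_def space_pair_measure space)
    qed
    then show ?thesis
      using left[OF h(1) Zs] True by simp
  next
    case False
    then have "Pair t -` S = {}" by (auto simp: S_def)
    then show ?thesis using False by simp
  qed
  have sec2: "emeasure lborel ((\<lambda>t. (t, x)) -` S) = 0" if "x \<in> space \<mu>" for x
  proof -
    have "(\<lambda>t. (t, x)) -` S = {t \<in> U. \<phi> t ** x \<in> Z}"
      using that by (auto simp: S_def space_pair_measure)
    then have "(\<lambda>t. (t, x)) -` S \<in> null_sets lebesgue"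
      using null[of x] that by (simp add: space negligible_iff_null_sets)
    \<comment> \<open>Negligibility concerns the completed measure; since the slice is Borel, it is
      null for \<open>lborel\<close> too.\<close>
    moreover have "(\<lambda>t. (t, x)) -` S \<in> sets lborel"
      using S by (rule sets_Pair2)
    ultimately show ?thesis
      by (simp add: null_sets_def)
  qed
  have "emeasure \<mu> Z * emeasure lborel U = (\<integral>\<^sup>+t. emeasure \<mu> (Pair t -` S) \<partial>lborel)"
    unfolding sec1 using U(1) by (simp add: nn_integral_cmult)
  also have "\<dots> = emeasure (lborel \<Otimes>\<^sub>M \<mu>) S"
    by (rule M.emeasure_pair_measure_alt[OF S, symmetric])
  also have "\<dots> = (\<integral>\<^sup>+x. emeasure lborel ((\<lambda>t. (t, x)) -` S) \<partial>\<mu>)"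
    by (rule emeasure_pair_measure_alt2[OF S])
  also have "\<dots> = (\<integral>\<^sup>+x. 0 \<partial>\<mu>)"
    by (intro nn_integral_cong sec2)
  finally have "emeasure \<mu> Z * emeasure lborel U = 0" by simp
  \<comment> \<open>A nonempty open set has positive Lebesgue measure, which allows
    cancellation.\<close>
  moreover have "emeasure lborel U \<noteq> 0"
  proof
    assume "emeasure lborel U = 0"
    then have "negligible U"
      using U(1) by (simp add: negligible_iff_null_sets null_sets_def)
    then show False
      using U open_not_negligible by blast
  qed
  ultimately show ?thesis by simp
qed

text \<open>The exponentials of \<open>euler_map\<close> in order, each split into its plane
  rotations; the weights 2 come from the coefficients \<open>-2\<close> in \<open>C8\<close>,
  \<open>C9\<close> and \<open>C11\<close>.\<close>

definition euler_list :: "(7 \<times> 7 \<times> real \<times> 14) list" where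
  "euler_list = [
    (2, 3, 2, 1), (5, 4, 1, 1), (6, 7, 1, 1), (1, 2, 2, 2), (7, 4, 1, 2), (5, 6, 1, 2),
    (2, 3, 2, 3), (5, 4, 1, 3), (6, 7, 1, 3),
    (4, 5, 1, 4), (6, 7, 1, 4), (6, 4, 1, 5), (5, 7, 1, 5), (4, 5, 1, 6), (6, 7, 1, 6),
    (1, 4, 2, 7), (2, 7, 1, 7), (6, 3, 1, 7), (2, 6, 1, 8), (7, 3, 1, 8),
    (4, 5, 1, 9), (6, 7, 1, 9), (6, 4, 1, 10), (5, 7, 1, 10), (4, 5, 1, 11), (6, 7, 1, 11),
    (2, 3, 2, 12), (5, 4, 1, 12), (6, 7, 1, 12), (1, 2, 2, 13), (7, 4, 1, 13), (5, 6, 1, 13),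
    (2, 3, 2, 14), (5, 4, 1, 14), (6, 7, 1, 14)]"

lemma euler_map_eq_rotprod: "euler_map = rotprod euler_list"
  by (rule ext) (simp add: euler_map_def euler_sigma_def euler_s_def euler_list_def mexp_C2 mexp_C3 mexp_C5
      mexp_C8 mexp_C9 mexp_C11 matrix_mul_assoc)

text \<open>For fixed \<open>x\<close>, the composition of \<open>P\<close> with the chart sends the
  parameters in question into the image of \<open>N\<close> under a differentiable map of
  14-dimensional spaces, which is negligible; its inverse is Lipschitz, so the parameters form a
  negligible set.\<close>

lemma euler_map_null_image:
  assumes haar: "haar_measure_on G2 \<mu>" and N: "compact N" "negligible N"
  shows "emeasure \<mu> (euler_map ` N) = 0"
proof -
  let ?\<phi> = "rotprod (concat chart_list)"
  obtain P :: "real ^ 7 ^ 7 \<Rightarrow> real ^ 14" and d where P: "linear P" "0 < d"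
    and bound: "\<And>s t. s \<in> ball 0 d \<Longrightarrow> t \<in> ball 0 d \<Longrightarrow> norm (s - t) \<le> 2 * norm (P (?\<phi> s) - P (?\<phi> t))"
    using strict_deriv_lower_bound[OF strict_deriv_rotprod inj_rotsum_chart] by blast
  have inj: "inj_on (\<lambda>t. P (?\<phi> t)) (ball 0 d)"
  proof (rule inj_onI)
    fix s t assume "s \<in> ball 0 d" "t \<in> ball 0 d" "P (?\<phi> s) = P (?\<phi> t)"
    with bound[of s t] show "s = t" by simp
  qed
  show ?thesis
  proof (rule haar_null_set[OF haar, where \<phi> = ?\<phi> and U = "ball 0 d"])
    show "x ** y \<in> G2" if "x \<in> G2" "y \<in> G2" for x y
      using that by (rule G2_mult)
    show "\<exists>y\<in>G2. y ** x = mat 1 \<and> x ** y = mat 1" if "x \<in> G2" for x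
      using G2_inverse[OF that] by metis
    have "compact (euler_map ` N)"
      unfolding euler_map_eq_rotprod by (intro compact_continuous_image continuous_on_rotprod N(1))
    then show "closed (euler_map ` N)" by (rule compact_imp_closed)
    show "euler_map ` N \<subseteq> G2" using euler_map_in_G2 by blast
    show "continuous_on UNIV ?\<phi>" by (rule continuous_on_rotprod)
    show "?\<phi> t \<in> G2" for t by (rule chart_in_G2)
    show "ball 0 d \<noteq> ({} :: (real ^ 14) set)" using P(2) by simp
    show "negligible {t \<in> ball 0 d. ?\<phi> t ** x \<in> euler_map ` N}" if x: "x \<in> G2" for x
    proof -
      obtain y where y: "x ** y = mat 1"
        using G2_inverse[OF x] by metis
      \<comment> \<open>As \<open>y\<close> inverts \<open>x\<close>, the condition on
        \<open>t\<close> becomes \<open>?\<phi> t = euler_map a ** y\<close>, and applying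
        \<open>P\<close> makes the right side a map between spaces of equal dimension.\<close>
      define E where "E a = P (euler_map a ** y)" for a
      have "E differentiable (at a)" for a
      proof -
        obtain f' where f': "(euler_map has_derivative f') (at a)"
          unfolding euler_map_eq_rotprod using rotprod_has_derivative by blast
        have "bounded_linear (\<lambda>M. P (M ** y))"
          using bounded_linear_compose[OF _ matrix_mult.bounded_linear_left] P(1)
          by (simp add: linear_conv_bounded_linear)
        from bounded_linear.has_derivative[OF this f'] show ?thesis
          unfolding E_def by (rule differentiableI)
      qed
      then have "E differentiable_on N"
        by (simp add: differentiable_at_imp_differentiable_on)
      then have "negligible (E ` N)"
        by (intro negligible_differentiable_image_negligible N(2)) simp_all
      define T where "T = E ` N \<inter> (\<lambda>t. P (?\<phi> t)) ` ball 0 d"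
      have "negligible T"
        unfolding T_def using \<open>negligible (E ` N)\<close> by (rule negligible_subset) blast
      define g where "g = inv_into (ball 0 d) (\<lambda>t. P (?\<phi> t))"
      have g: "g (P (?\<phi> t)) = t" if "t \<in> ball 0 d" for t
        unfolding g_def using inv_into_f_f[OF inj that] .
      have "norm (g v - g w) \<le> 2 * norm (v - w)" if "v \<in> T" "w \<in> T" for v w
        using that bound by (auto simp: T_def g)
      then have "negligible (g ` T)"
        by (intro negligible_locally_Lipschitz_image \<open>negligible T\<close>) (auto intro!: exI[of _ UNIV] exI[of _ 2])
      moreover have "{t \<in> ball 0 d. ?\<phi> t ** x \<in> euler_map ` N} \<subseteq> g ` T"
      proof
        fix t assume "t \<in> {t \<in> ball 0 d. ?\<phi> t ** x \<in> euler_map ` N}"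
        then obtain a where t: "t \<in> ball 0 d" "a \<in> N" "?\<phi> t ** x = euler_map a" by auto
        have "?\<phi> t = ?\<phi> t ** (x ** y)" by (simp add: y)
        also have "\<dots> = euler_map a ** y" by (simp add: t matrix_mul_assoc)
        finally have "P (?\<phi> t) = E a" by (simp add: E_def)
        then have "P (?\<phi> t) \<in> E ` N" using t(2) by blast
        then have "P (?\<phi> t) \<in> T" using t(1) unfolding T_def by blast
        then show "t \<in> g ` T" using g[OF t(1)] by (metis image_eqI)
      qed
      ultimately show ?thesis by (rule negligible_subset)
    qed
  qed simp
qed

section \<open>The boundary of the parameter region\<close>

lemma euler_interior_subset: "euler_interior \<subseteq> euler_region"
  by (auto simp: euler_interior_def euler_region_def)

lemma open_euler_interior: "open euler_interior"
  unfolding euler_interior_def by (intro open_Collect_conj open_Collect_less continuous_intros)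

lemma compact_euler_region: "compact euler_region"
proof -
  have "closed euler_region"
    unfolding euler_region_def by (intro closed_Collect_conj closed_Collect_le continuous_intros)
  moreover have "euler_region \<subseteq> cbox (\<chi> i. 0) (\<chi> i. 2 * pi)"
    using pi_gt_zero by (auto simp: euler_region_def mem_box_cart forall_14)
  then have "bounded euler_region"
    using bounded_cbox bounded_subset by blast
  ultimately show ?thesis
    by (simp add: compact_eq_bounded_closed)
qed

text \<open>A point of the region with some inequality not strict lies on one of finitely many
  hyperplanes: a coordinate equals an end point, or \<open>3 * a$7 = a$8\<close>.\<close>

lemma negligible_euler_boundary: "negligible (euler_region - euler_interior)"
proof -
  have "axis 7 3 - axis 8 1 \<noteq> (0 :: real ^ 14)"
  proof
    assume "axis 7 3 - axis 8 1 = (0 :: real ^ 14)"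
    then have "(axis 7 3 - axis 8 1 :: real ^ 14) $ 7 = 0" by simp
    then show False by (simp add: axis_def)
  qed
  then have "negligible {a :: real ^ 14. (axis 7 3 - axis 8 1) \<bullet> a = 0}"
    by (intro negligible_hyperplane) simp
  moreover have "(axis 7 3 - axis 8 1) \<bullet> a = 3 * a $ 7 - a $ 8" for a :: "real ^ 14"
    by (simp add: inner_diff_left inner_axis')
  ultimately have slant: "negligible {a :: real ^ 14. 3 * a $ 7 - a $ 8 = 0}" by simp
  have flat: "negligible (\<Union>i\<in>UNIV. \<Union>c\<in>{0, pi / 6, pi / 4, pi / 2, pi, 2 * pi}. {a :: real ^ 14. a $ i = c})"
  proof (rule negligible_Union)
    fix B assume "B \<in> range (\<lambda>i. \<Union>c\<in>{0, pi / 6, pi / 4, pi / 2, pi, 2 * pi}. {a :: real ^ 14. a $ i = c})"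
    then obtain i where B: "B = (\<Union>c\<in>{0, pi / 6, pi / 4, pi / 2, pi, 2 * pi}. {a :: real ^ 14. a $ i = c})"
      by blast
    show "negligible B"
      unfolding B
    proof (rule negligible_Union)
      fix C assume "C \<in> (\<lambda>c. {a :: real ^ 14. a $ i = c}) ` {0, pi / 6, pi / 4, pi / 2, pi, 2 * pi}"
      then obtain c where "C = {a. a $ i = c}" by blast
      then show "negligible C" by (simp add: cart_eq_inner_axis negligible_standard_hyperplane)
    qed simp
  qed simp
  have "euler_region - euler_interior \<subseteq> {a. 3 * a $ 7 - a $ 8 = 0} \<union>
     (\<Union>i\<in>UNIV. \<Union>c\<in>{0, pi / 6, pi / 4, pi / 2, pi, 2 * pi}. {a :: real ^ 14. a $ i = c})"
  proof
    fix a assume a: "a \<in> euler_region - euler_interior"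
    show "a \<in> {a. 3 * a $ 7 - a $ 8 = 0} \<union>
     (\<Union>i\<in>UNIV. \<Union>c\<in>{0, pi / 6, pi / 4, pi / 2, pi, 2 * pi}. {a :: real ^ 14. a $ i = c})"
    proof (rule ccontr)
      assume "\<not> ?thesis"
      then have "3 * a $ 7 \<noteq> a $ 8" "\<And>i. a $ i \<noteq> 0 \<and> a $ i \<noteq> pi / 6 \<and> a $ i \<noteq> pi / 4 \<and> a $ i \<noteq> pi / 2 \<and>
          a $ i \<noteq> pi \<and> a $ i \<noteq> 2 * pi"
        by auto
      then have "a \<in> euler_interior"
        using a unfolding euler_region_def euler_interior_def Diff_iff mem_Collect_eq less_le by metis
      with a show False by blast
    qed
  qed
  then show ?thesis
    using negligible_Un[OF slant flat] negligible_subset by blast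
qed

section \<open>Covering of the group, exactly once up to null sets\<close>

theorem mainTheorem1:
  shows "euler_map ` euler_region = G2 \<and>
    (\<exists>N. N \<subseteq> euler_region \<and> N \<in> null_sets lebesgue \<and>
         inj_on euler_map (euler_region - N) \<and>
         (\<forall>\<mu>. haar_measure_on G2 \<mu> \<longrightarrow>
            (AE M in \<mu>. M \<in> euler_map ` (euler_region - N))))"
proof
  show surj: "euler_map ` euler_region = G2"
    using euler_map_surj euler_map_in_G2 by blast
  \<comment> \<open>The exceptional set is compact, so its image is closed and thus
    measurable.\<close>
  let ?N = "euler_region - euler_interior"
  have diff: "euler_region - ?N = euler_interior"
    using euler_interior_subset by blast
  have compact: "compact ?N"
    by (rule compact_diff[OF compact_euler_region open_euler_interior])
  have "AE M in \<mu>. M \<in> euler_map ` euler_interior" if haar: "haar_measure_on G2 \<mu>" for \<mu>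
  proof (rule AE_I')
    have sets: "sets \<mu> = sets (restrict_space borel G2)"
      using haar by (simp add: haar_measure_on_def)
    have "closed (euler_map ` ?N)"
      unfolding euler_map_eq_rotprod
      by (intro compact_imp_closed compact_continuous_image continuous_on_rotprod compact)
    then have "euler_map ` ?N \<in> sets \<mu>"
      unfolding sets sets_restrict_space using euler_map_in_G2
      by (auto intro!: image_eqI[of _ _ "euler_map ` ?N"])
    then show "euler_map ` ?N \<in> null_sets \<mu>"
      using euler_map_null_image[OF haar compact negligible_euler_boundary] by (simp add: null_sets_def)
    have "space \<mu> = G2"
      using sets_eq_imp_space_eq[OF sets] by (simp add: space_restrict_space)
    \<comment> \<open>By surjectivity, whatever the interior misses is hit by the exceptional
      set.\<close>
    then show "{M \<in> space \<mu>. M \<notin> euler_map ` euler_interior} \<subseteq> euler_map ` ?N"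
      using surj by blast
  qed
  then show "\<exists>N. N \<subseteq> euler_region \<and> N \<in> null_sets lebesgue \<and> inj_on euler_map (euler_region - N) \<and>
         (\<forall>\<mu>. haar_measure_on G2 \<mu> \<longrightarrow> (AE M in \<mu>. M \<in> euler_map ` (euler_region - N)))"
    using negligible_euler_boundary euler_map_inj
    by (intro exI[of _ ?N]) (simp add: diff negligible_iff_null_sets)
qed

end
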